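(* Let $\mathcal{A}$, $A_1$, $\hat A_2$ be the operators defined in the context. Then: (i) $\sigma(\mathcal{A})=\sigma(A_1)\cup\sigma(\hat A_2)$. (ii) If $\mu\in\sigma(\mathcal{A})\setminus\bigl(\sigma(A_1)\cap\sigma(\hat A_2)\bigr)$, then $\mu$ is a simple eigenvalue of $\mathcal{A}$. If $\mu\in\sigma(A_1)\cap\sigma(\hat A_2)$, then $\mu$ is an eigenvalue of $\mathcal{A}$ of (algebraic) multiplicity $2$ and the corresponding root space is generated by an eigenvector and an adjoined vector of $\mathcal{A}$. (iii) The set of eigenvectors and adjoined vectors of $\mathcal{A}$ forms a complete system in $\mathcal{L}$.
   Context: Let $a<0<b$, $I_a=(a,0)$, $I_b=(0,b)$. Let $k,r$ be smooth positive functions on $[a,0]$ and $\kappa,\rho$ smooth positive functions on $[0,b]$. For a positive weight $g$ on an interval $I$, $L_2(g,I)$ is the weighted space with norm $\|v\|=\bigl(\int_I g|v|^2\,dx\bigr)^{1/2}$. Put $\mathcal{L}=L_2(r,I_a)\oplus L_2(\rho,I_b)$. Define the operators $A_1=-\frac1r\frac{d}{dx}k\frac{d}{dx}$ in $L_2(r,I_a)$ with domain $\mathcal{D}(A_1)=\{u\in H^2(I_a): u(a)=0,\ u'(0)=0\}$; $A_2=-\frac1\rho\frac{d}{dx}\kappa\frac{d}{dx}$ in $L_2(\rho,I_b)$ with domain $\mathcal{D}(A_2)=\{u\in H^2(I_b): u(b)=0\}$; $\hat A_2$, the restriction of $A_2$ to $\mathcal{D}(\hat A_2)=\{u\in\mathcal{D}(A_2):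 u(0)=0\}$; and $\mathcal{A}(u_1,u_2)=(A_1u_1,A_2u_2)$ in $\mathcal{L}$ with domain $\mathcal{D}(\mathcal{A})=\{(u_1,u_2)\in\mathcal{D}(A_1)\oplus\mathcal{D}(A_2): u_1(0)=u_2(0)\}$. If $u$ is an eigenvector of $\mathcal{A}$ with eigenvalue $\mu$, a solution $u_*$ of $(\mathcal{A}-\mu\mathcal{I})u_*=u$ is called an adjoined vector of $\mathcal{A}$ corresponding to $\mu$. The root space of $\mu$ is $\bigcup_{n\ge1}\ker(\mathcal{A}-\mu\mathcal{I})^n$; its dimension is the (algebraic) multiplicity of $\mu$. $\sigma(\cdot)$ denotes the spectrum. A system is complete in $\mathcal{L}$ if its linear span is dense in $\mathcal{L}$. *)

theory Defs
  imports "HOL-Analysis.Analysis"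
begin

section \<open>Complex vector spaces\<close>

class complex_vector = ab_group_add +
  fixes scaleC :: "complex \<Rightarrow> 'a \<Rightarrow> 'a" (infixr "*\<^sub>C" 75)
  assumes scaleC_add_right: "c *\<^sub>C (x + y) = c *\<^sub>C x + c *\<^sub>C y"
    and scaleC_add_left: "(c + d) *\<^sub>C x = c *\<^sub>C x + d *\<^sub>C x"
    and scaleC_scaleC: "c *\<^sub>C d *\<^sub>C x = (c * d) *\<^sub>C x"
    and scaleC_one: "1 *\<^sub>C x = x"

global_interpretation complex_vector: vector_space "scaleC :: complex \<Rightarrow> 'a \<Rightarrow> 'a::complex_vector"
  by unfold_locales (simp_all add: scaleC_add_right scaleC_add_left scaleC_scaleC scaleC_one)

instantiation prod :: (complex_vector, complex_vector) complex_vector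
begin

definition scaleC_prod :: "complex \<Rightarrow> 'a \<times> 'b \<Rightarrow> 'a \<times> 'b"
  where "scaleC_prod c p = (c *\<^sub>C fst p, c *\<^sub>C snd p)"

instance
  by standard
    (simp_all add: scaleC_prod_def scaleC_add_right scaleC_add_left scaleC_scaleC scaleC_one)

end

section \<open>Unbounded operators in a normed subspace of a vector space\<close>

text \<open>
  A function space is a set of vectors of an ambient complex vector space together with
  a norm, of which only the values on that set matter.  An operator is a function together
  with its domain; its values outside the domain do not matter.
\<close>

record 'v nspace =
  vecs :: "'v set"
  nrm :: "'v \<Rightarrow> real"

record 'v lin_op =
  op_dom :: "'v set"
  op_app :: "'v \<Rightarrow> 'v"

definition direct_sum :: "'v nspace \<Rightarrow> 'w nspace \<Rightarrow> ('v \<times> 'w) nspace"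
  where "direct_sum X Y =
    \<lparr> vecs = vecs X \<times> vecs Y, nrm = (\<lambda>p. sqrt ((nrm X (fst p))\<^sup>2 + (nrm Y (snd p))\<^sup>2)) \<rparr>"

definition op_shift :: "('v::complex_vector) lin_op \<Rightarrow> complex \<Rightarrow> 'v lin_op"
  where "op_shift A \<mu> = \<lparr> op_dom = op_dom A, op_app = (\<lambda>u. op_app A u - \<mu> *\<^sub>C u) \<rparr>"

definition op_comp :: "'v lin_op \<Rightarrow> 'v lin_op \<Rightarrow> 'v lin_op"
  where "op_comp B A =
    \<lparr> op_dom = {u \<in> op_dom A. op_app A u \<in> op_dom B}, op_app = op_app B \<circ> op_app A \<rparr>"

primrec op_power :: "'v lin_op \<Rightarrow> nat \<Rightarrow> 'v lin_op"
  where
    "op_power A 0 = \<lparr> op_dom = UNIV, op_app = id \<rparr>"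
  | "op_power A (Suc n) = op_comp (op_power A n) A"

definition op_ker :: "('v::zero) lin_op \<Rightarrow> 'v set"
  where "op_ker A = {u \<in> op_dom A. op_app A u = 0}"

definition resolvent_set :: "('v::complex_vector) nspace \<Rightarrow> 'v lin_op \<Rightarrow> complex set"
  where "resolvent_set X A =
    {\<mu>. bij_betw (op_app (op_shift A \<mu>)) (op_dom A) (vecs X) \<and>
        (\<exists>C. \<forall>f\<in>vecs X. nrm X (inv_into (op_dom A) (op_app (op_shift A \<mu>)) f) \<le> C * nrm X f)}"

definition spectrum :: "('v::complex_vector) nspace \<Rightarrow> 'v lin_op \<Rightarrow> complex set"
  where "spectrum X A = - resolvent_set X A"

definition is_eigenvector :: "('v::complex_vector) lin_op \<Rightarrow> complex \<Rightarrow> 'v \<Rightarrow> bool"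
  where "is_eigenvector A \<mu> u \<longleftrightarrow> u \<noteq> 0 \<and> u \<in> op_dom A \<and> op_app A u = \<mu> *\<^sub>C u"

definition is_eigenvalue :: "('v::complex_vector) lin_op \<Rightarrow> complex \<Rightarrow> bool"
  where "is_eigenvalue A \<mu> \<longleftrightarrow> (\<exists>u. is_eigenvector A \<mu> u)"

definition is_adjoined_to :: "('v::complex_vector) lin_op \<Rightarrow> complex \<Rightarrow> 'v \<Rightarrow> 'v \<Rightarrow> bool"
  where "is_adjoined_to A \<mu> u w \<longleftrightarrow>
    is_eigenvector A \<mu> u \<and> w \<in> op_dom A \<and> op_app (op_shift A \<mu>) w = u"

definition root_space :: "('v::complex_vector) lin_op \<Rightarrow> complex \<Rightarrow> 'v set"
  where "root_space A \<mu> = (\<Union>n\<in>{1..}. op_ker (op_power (op_shift A \<mu>) n))"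

text \<open>
  \<open>complex_vector.dim\<close> is 0 on infinite-dimensional spaces, so a positive value of
  the multiplicity entails that the root space is finite-dimensional.
\<close>

definition multiplicity_of :: "('v::complex_vector) lin_op \<Rightarrow> complex \<Rightarrow> nat"
  where "multiplicity_of A \<mu> = complex_vector.dim (root_space A \<mu>)"

definition is_simple_eigenvalue :: "('v::complex_vector) lin_op \<Rightarrow> complex \<Rightarrow> bool"
  where "is_simple_eigenvalue A \<mu> \<longleftrightarrow> is_eigenvalue A \<mu> \<and> multiplicity_of A \<mu> = 1"

definition complete_in :: "('v::complex_vector) nspace \<Rightarrow> 'v set \<Rightarrow> bool"
  where "complete_in X S \<longleftrightarrow> S \<subseteq> vecs X \<and>
    (\<forall>f\<in>vecs X. \<forall>\<epsilon>>0. \<exists>g\<in>complex_vector.span S. nrm X (f - g) < \<epsilon>)"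

section \<open>Measurable functions modulo almost everywhere equality\<close>

quotient_type aefun = "real \<Rightarrow> complex" / partial:
  "\<lambda>f g. f \<in> borel_measurable lborel \<and> g \<in> borel_measurable lborel \<and> (AE x in lborel. f x = g x)"
proof (rule part_equivpI)
  show "\<exists>f::real \<Rightarrow> complex. f \<in> borel_measurable lborel \<and> f \<in> borel_measurable lborel \<and>
      (AE x in lborel. f x = f x)"
    by (rule exI[of _ "\<lambda>_. 0"]) simp
qed (auto intro!: sympI transpI)

instantiation aefun :: complex_vector
begin

lift_definition zero_aefun :: aefun is "\<lambda>_. 0"
  by simp

lift_definition plus_aefun :: "aefun \<Rightarrow> aefun \<Rightarrow> aefun" is "\<lambda>f g x. f x + g x"
  by auto

lift_definition minus_aefun :: "aefun \<Rightarrow> aefun \<Rightarrow> aefun" is "\<lambda>f g x. f x - g x"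
  by auto

lift_definition uminus_aefun :: "aefun \<Rightarrow> aefun" is "\<lambda>f x. - f x"
  by auto

lift_definition scaleC_aefun :: "complex \<Rightarrow> aefun \<Rightarrow> aefun" is "\<lambda>c f x. c * f x"
  by auto

instance
  by standard (transfer; auto simp: algebra_simps)+

end

section \<open>Function spaces on an interval\<close>

text \<open>
  A function on an open interval \<open>I\<close> is identified with its extension by zero to the
  real line.  Everything below is expressed through the representative \<open>rep_aefun\<close>
  but depends only on the class.
\<close>

definition L2 :: "(real \<Rightarrow> real) \<Rightarrow> real set \<Rightarrow> aefun nspace"
  where "L2 g I =
    \<lparr> vecs = {f. (AE x in lborel. x \<notin> I \<longrightarrow> rep_aefun f x = 0) \<and>
               set_integrable lborel I (\<lambda>x. g x * (cmod (rep_aefun f x))\<^sup>2)},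
      nrm = (\<lambda>f. sqrt (LBINT x:I. g x * (cmod (rep_aefun f x))\<^sup>2)) \<rparr>"

definition mult_on :: "real set \<Rightarrow> (real \<Rightarrow> real) \<Rightarrow> aefun \<Rightarrow> aefun"
  where "mult_on I g f =
    abs_aefun (\<lambda>x. if x \<in> I then complex_of_real (g x) * rep_aefun f x else 0)"

definition test_function :: "real \<Rightarrow> real \<Rightarrow> (real \<Rightarrow> real) \<Rightarrow> (real \<Rightarrow> real) \<Rightarrow> bool"
  where "test_function c d \<phi> \<phi>' \<longleftrightarrow>
    (\<forall>x. (\<phi> has_real_derivative \<phi>' x) (at x)) \<and> continuous_on UNIV \<phi>' \<and>
    (\<exists>K. compact K \<and> K \<subseteq> {c<..<d} \<and> (\<forall>x. x \<notin> K \<longrightarrow> \<phi> x = 0))"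

text \<open>
  Weak derivatives are tested against continuously differentiable functions with compact
  support, as in Brezis, Functional Analysis, Sobolev Spaces and PDE, Section 8.2.
\<close>

definition is_weak_deriv :: "real \<Rightarrow> real \<Rightarrow> aefun \<Rightarrow> aefun \<Rightarrow> bool"
  where "is_weak_deriv c d u v \<longleftrightarrow>
    (\<forall>\<phi> \<phi>'. test_function c d \<phi> \<phi>' \<longrightarrow>
      (LBINT x:{c<..<d}. rep_aefun u x * complex_of_real (\<phi>' x)) =
      - (LBINT x:{c<..<d}. rep_aefun v x * complex_of_real (\<phi> x)))"

definition H1 :: "real \<Rightarrow> real \<Rightarrow> aefun set"
  where "H1 c d = {u \<in> vecs (L2 (\<lambda>_. 1) {c<..<d}).
    \<exists>v\<in>vecs (L2 (\<lambda>_. 1) {c<..<d}). is_weak_deriv c d u v}"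

definition weak_deriv :: "real \<Rightarrow> real \<Rightarrow> aefun \<Rightarrow> aefun"
  where "weak_deriv c d u =
    (THE v. v \<in> vecs (L2 (\<lambda>_. 1) {c<..<d}) \<and> is_weak_deriv c d u v)"

definition H2 :: "real \<Rightarrow> real \<Rightarrow> aefun set"
  where "H2 c d = {u \<in> H1 c d. weak_deriv c d u \<in> H1 c d}"

text \<open>
  The value at \<open>x\<close>, an end point being allowed, of the representative that is
  continuous on the closed interval; it exists for elements of \<open>H1 c d\<close>.
\<close>

definition value_at :: "real \<Rightarrow> real \<Rightarrow> aefun \<Rightarrow> real \<Rightarrow> complex"
  where "value_at c d u x =
    (THE y. \<exists>w. continuous_on {c..d} w \<and>
       (AE t in lborel. t \<in> {c<..<d} \<longrightarrow> rep_aefun u t = w t) \<and> y = w x)"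

text \<open>
  Smoothness up to the end points, with one-sided derivatives there; the values of
  \<open>f\<close> outside the closed interval are irrelevant.
\<close>

definition smooth_on_Icc :: "real \<Rightarrow> real \<Rightarrow> (real \<Rightarrow> real) \<Rightarrow> bool"
  where "smooth_on_Icc c d f \<longleftrightarrow>
    (\<exists>D. D 0 = f \<and>
      (\<forall>n::nat. \<forall>x\<in>{c..d}. (D n has_real_derivative D (Suc n) x) (at x within {c..d})))"

section \<open>The operators\<close>

definition sturm_expr ::
    "real \<Rightarrow> real \<Rightarrow> (real \<Rightarrow> real) \<Rightarrow> (real \<Rightarrow> real) \<Rightarrow> aefun \<Rightarrow> aefun"
  where "sturm_expr c d p w u =
    mult_on {c<..<d} (\<lambda>x. - 1 / w x)
      (weak_deriv c d (mult_on {c<..<d} p (weak_deriv c d u)))"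

definition A1 :: "real \<Rightarrow> (real \<Rightarrow> real) \<Rightarrow> (real \<Rightarrow> real) \<Rightarrow> aefun lin_op"
  where "A1 a k r =
    \<lparr> op_dom = {u \<in> H2 a 0. value_at a 0 u a = 0 \<and> value_at a 0 (weak_deriv a 0 u) 0 = 0},
      op_app = sturm_expr a 0 k r \<rparr>"

definition A2 :: "real \<Rightarrow> (real \<Rightarrow> real) \<Rightarrow> (real \<Rightarrow> real) \<Rightarrow> aefun lin_op"
  where "A2 b \<kappa> \<rho> =
    \<lparr> op_dom = {u \<in> H2 0 b. value_at 0 b u b = 0}, op_app = sturm_expr 0 b \<kappa> \<rho> \<rparr>"

definition A2_hat :: "real \<Rightarrow> (real \<Rightarrow> real) \<Rightarrow> (real \<Rightarrow> real) \<Rightarrow> aefun lin_op"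
  where "A2_hat b \<kappa> \<rho> =
    \<lparr> op_dom = {u \<in> op_dom (A2 b \<kappa> \<rho>). value_at 0 b u 0 = 0},
      op_app = op_app (A2 b \<kappa> \<rho>) \<rparr>"

definition A_mat ::
    "real \<Rightarrow> real \<Rightarrow> (real \<Rightarrow> real) \<Rightarrow> (real \<Rightarrow> real) \<Rightarrow> (real \<Rightarrow> real) \<Rightarrow> (real \<Rightarrow> real)
      \<Rightarrow> (aefun \<times> aefun) lin_op"
  where "A_mat a b k r \<kappa> \<rho> =
    \<lparr> op_dom = {(u1, u2). u1 \<in> op_dom (A1 a k r) \<and> u2 \<in> op_dom (A2 b \<kappa> \<rho>) \<and>
                  value_at a 0 u1 0 = value_at 0 b u2 0},
      op_app = (\<lambda>(u1, u2). (op_app (A1 a k r) u1, op_app (A2 b \<kappa> \<rho>) u2)) \<rparr>"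

definition L_space :: "real \<Rightarrow> real \<Rightarrow> (real \<Rightarrow> real) \<Rightarrow> (real \<Rightarrow> real) \<Rightarrow> (aefun \<times> aefun) nspace"
  where "L_space a b r \<rho> = direct_sum (L2 r {a<..<0}) (L2 \<rho> {0<..<b})"

end

theory Submission
  imports Defs "HOL-Complex_Analysis.Great_Picard"
begin

text \<open>
  The coupling is triangular.  In an equation \<open>(\<A> - \<mu>) u = f\<close> the first component satisfies
  a boundary value problem of its own, and it enters the second one only through the number
  \<open>u\<^sub>1(0)\<close>.  Let \<open>\<psi>\<close> solve the homogeneous equation on the left interval with \<open>\<psi>(a) = 0\<close> and
  \<open>(k \<psi>')(a) = 1\<close>, and let \<open>\<phi>\<^sub>1\<close>, \<open>\<phi>\<^sub>2\<close> solve it on the right interval with the data \<open>(1, 0)\<close> and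
  \<open>(0, 1)\<close> for \<open>(u, \<kappa> u')\<close> at \<open>0\<close>.  The condition at \<open>a\<close> and the coupling condition determine
  \<open>u\<^sub>1\<close> up to a multiple \<open>s \<psi>\<close> and then \<open>u\<^sub>2\<close> up to a multiple \<open>t \<phi>\<^sub>2\<close>.  The two conditions left,
  \<open>u\<^sub>1'(0) = 0\<close> and \<open>u\<^sub>2(b) = 0\<close>, are a triangular linear system for \<open>(s, t)\<close> with diagonal
  entries \<open>DA \<mu> = (k \<psi>')(0)\<close> and \<open>DB \<mu> = \<phi>\<^sub>2(b)\<close>.  The zeros of these two functions are
  the spectra of \<open>A\<^sub>1\<close> and of \<open>A\<^sub>2\<close> with a Dirichlet condition at \<open>0\<close> (\<open>spectrum_T\<close>), and the
  spectrum of \<open>\<A>\<close> is where the determinant vanishes (\<open>spectrum_A\<close>).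

  Multiplicities.  By constancy of the Wronskian, \<open>\<psi>(0) \<noteq> 0\<close> where \<open>DA\<close> vanishes and
  \<open>\<phi>\<^sub>1(b) \<noteq> 0\<close> where \<open>DB\<close> vanishes, and with this the kernel of \<open>\<A> - \<mu>\<close> is a line at every
  point of the spectrum.  A chain of root vectors
  can be continued only if a boundary value of a particular solution vanishes, and
  symmetry of the two scalar problems, in the form of the Lagrange identity, says that it does
  not (\<open>no_adjoined_function\<close>).  So the chain has length one if only one of \<open>DA \<mu>\<close>, \<open>DB \<mu>\<close>
  vanishes.  If both vanish, the eigenvector is \<open>(0, \<phi>\<^sub>2)\<close>; there is an adjoined vector
  whose first component is a nonzero multiple of \<open>\<psi>\<close>, and the chain stops there because
  \<open>\<psi>\<close> is not in the range of \<open>A\<^sub>1 - \<mu>\<close>.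

  Completeness.  Each scalar problem has a complete system of eigenfunctions
  (\<open>eigenvectors_complete\<close>): zero is not in its spectrum, its inverse is compact and symmetric,
  and its domain is dense.  Eigenfunctions \<open>v\<close> of the right problem give eigenvectors \<open>(0, v)\<close> of
  \<open>\<A>\<close>, and every eigenfunction of \<open>A\<^sub>1\<close> is the first component of a multiple of an eigenvector
  or of an adjoined vector.  The span of all these therefore approximates the first
  component of a given pair, and the remaining error in the second component can be corrected
  without disturbing the first.

  All this is done with functions instead of classes of functions: by the du Bois-Reymond
  lemma the elements of the Sobolev space of order two are the classes of functions \<open>U\<close> that
  come with a flux \<open>V = p U'\<close> and a right-hand side \<open>F\<close>, linked by the integrated equations of \<open>sol\<close>.
\<close>

section \<open>Linear operators\<close>

lemma scaleC_Pair: "a *\<^sub>C (x, y) = (a *\<^sub>C x, a *\<^sub>C y)"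
  by (simp add: scaleC_prod_def)

locale linear_op =
  fixes B :: "('v::complex_vector) lin_op"
  assumes zero_dom [simp, intro]: "0 \<in> op_dom B"
    and lin: "\<And>s u v. u \<in> op_dom B \<Longrightarrow> v \<in> op_dom B \<Longrightarrow>
      s *\<^sub>C u + v \<in> op_dom B \<and> op_app B (s *\<^sub>C u + v) = s *\<^sub>C op_app B u + op_app B v"
begin

lemma app_zero [simp]: "op_app B 0 = 0"
  using lin[of 0 0 1] by (simp add: scaleC_one)

lemma dom_closed [simp, intro]:
  "u \<in> op_dom B \<Longrightarrow> v \<in> op_dom B \<Longrightarrow> u + v \<in> op_dom B"
  "u \<in> op_dom B \<Longrightarrow> a *\<^sub>C u \<in> op_dom B"
  "u \<in> op_dom B \<Longrightarrow> v \<in> op_dom B \<Longrightarrow> u - v \<in> op_dom B"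
  using lin[of u v 1] lin[of u 0 a] lin[of v u "-1"] by (simp_all add: scaleC_one)

lemma app_add: "u \<in> op_dom B \<Longrightarrow> v \<in> op_dom B \<Longrightarrow> op_app B (u + v) = op_app B u + op_app B v"
  using lin[of u v 1] by (simp add: scaleC_one)

lemma app_scale: "u \<in> op_dom B \<Longrightarrow> op_app B (a *\<^sub>C u) = a *\<^sub>C op_app B u"
  using lin[of u 0 a] by simp

lemma app_diff: "u \<in> op_dom B \<Longrightarrow> v \<in> op_dom B \<Longrightarrow> op_app B (u - v) = op_app B u - op_app B v"
  using lin[of v u "-1"] by (simp add: scaleC_one)

lemma shift: "linear_op (op_shift B \<mu>)"
  by unfold_locales
    (auto simp: op_shift_def lin complex_vector.scale_right_distrib complex_vector.scale_right_diff_distrib mult.commute)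

text \<open>
  Injectivity of the shifted operator is reduced to a trivial kernel, so that the solution
  operator \<open>S\<close> needs to be verified on one side only.
\<close>

lemma resolvent_setI:
  assumes S: "\<And>f. f \<in> vecs X \<Longrightarrow> S f \<in> op_dom B \<and> op_app (op_shift B \<mu>) (S f) = f"
    and maps: "\<And>u. u \<in> op_dom B \<Longrightarrow> op_app (op_shift B \<mu>) u \<in> vecs X"
    and ker: "\<And>u. u \<in> op_dom B \<Longrightarrow> op_app (op_shift B \<mu>) u = 0 \<Longrightarrow> u = 0"
    and bound: "\<And>f. f \<in> vecs X \<Longrightarrow> nrm X (S f) \<le> C * nrm X f"
  shows "\<mu> \<in> resolvent_set X B"
proof -
  interpret s: linear_op "op_shift B \<mu>" by (rule shift)
  have dom: "op_dom (op_shift B \<mu>) = op_dom B" by (simp add: op_shift_def)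
  have inj: "inj_on (op_app (op_shift B \<mu>)) (op_dom B)"
  proof (rule inj_onI)
    fix u v assume uv: "u \<in> op_dom B" "v \<in> op_dom B" "op_app (op_shift B \<mu>) u = op_app (op_shift B \<mu>) v"
    then have "op_app (op_shift B \<mu>) (u - v) = 0" using s.app_diff by (simp add: dom)
    then show "u = v" using ker[of "u - v"] uv by simp
  qed
  then have "bij_betw (op_app (op_shift B \<mu>)) (op_dom B) (vecs X)"
    using S maps by (auto simp: bij_betw_def image_iff) metis
  moreover have "inv_into (op_dom B) (op_app (op_shift B \<mu>)) f = S f" if "f \<in> vecs X" for f
    using S[OF that] inj by (metis inv_into_f_f)
  ultimately show ?thesis using bound by (auto simp: resolvent_set_def)
qed

lemma spectrumI:
  assumes "u \<in> op_dom B" "u \<noteq> 0" "op_app (op_shift B \<mu>) u = 0"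
  shows "\<mu> \<in> spectrum X B"
proof -
  have "op_app (op_shift B \<mu>) u = op_app (op_shift B \<mu>) 0"
    using assms by (simp add: op_shift_def)
  then have "\<not> inj_on (op_app (op_shift B \<mu>)) (op_dom B)" using assms by (metis inj_onD zero_dom)
  then show ?thesis by (auto simp: spectrum_def resolvent_set_def bij_betw_def)
qed

lemma ker_power_Suc:
  "op_ker (op_power B (Suc n)) = {u \<in> op_dom B. op_app B u \<in> op_ker (op_power B n)}"
  by (auto simp: op_ker_def op_comp_def)

lemma ker_power_0: "op_ker (op_power B 0) = {0}"
  by (auto simp: op_ker_def)

text \<open>
  If \<open>e\<close> spans the kernel but is not in the range, a vector that \<open>B\<close> maps to a nonzero multiple
  of \<open>e\<close> would put \<open>e\<close> into the range; so the kernels of the powers do not grow.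
\<close>

lemma root_space_simple:
  assumes e: "e \<in> op_dom B" "op_app B e = 0"
    and ker: "\<And>u. u \<in> op_dom B \<Longrightarrow> op_app B u = 0 \<Longrightarrow> u \<in> complex_vector.span {e}"
    and range: "\<And>z. z \<in> op_dom B \<Longrightarrow> op_app B z \<noteq> e"
  shows "(\<Union>n\<in>{1..}. op_ker (op_power B n)) = complex_vector.span {e}"
proof -
  have "op_ker (op_power B n) \<subseteq> complex_vector.span {e}" for n
  proof (induction n)
    case 0
    then show ?case by (simp add: ker_power_0 complex_vector.span_zero del: op_power.simps)
  next
    case (Suc n)
    show ?case
    proof
      fix u assume "u \<in> op_ker (op_power B (Suc n))"
      then have u: "u \<in> op_dom B" "op_app B u \<in> complex_vector.span {e}" using Suc by (auto simp: ker_power_Suc simp del: op_power.simps)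
      then obtain t where t: "op_app B u = t *\<^sub>C e" by (auto simp: complex_vector.span_singleton)
      have "t = 0"
      proof (rule ccontr)
        assume "t \<noteq> 0"
        then have "op_app B ((1 / t) *\<^sub>C u) = e" using u t by (simp add: app_scale scaleC_one)
        with range u show False by blast
      qed
      then show "u \<in> complex_vector.span {e}" using ker u t by simp
    qed
  qed
  moreover have "complex_vector.span {e} \<subseteq> op_ker (op_power B (Suc 0))"
    using e by (auto simp: complex_vector.span_singleton ker_power_Suc ker_power_0 app_scale simp del: op_power.simps)
  ultimately show ?thesis by fastforce
qed

text \<open>
  The same argument one level higher: modulo \<open>w\<close> every root vector is mapped into the kernel,
  and \<open>w\<close> not being in the range stops the growth at the second power.
\<close>

lemma root_space_double:
  assumes e: "e \<in> op_dom B" "op_app B e = 0" and w: "w \<in> op_dom B" "op_app B w = e"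
    and ker: "\<And>u. u \<in> op_dom B \<Longrightarrow> op_app B u = 0 \<Longrightarrow> u \<in> complex_vector.span {e}"
    and range: "\<And>z. z \<in> op_dom B \<Longrightarrow> op_app B z \<noteq> w"
  shows "(\<Union>n\<in>{1..}. op_ker (op_power B n)) = complex_vector.span {e, w}"
proof -
  have sp: "x \<in> complex_vector.span {e, w} \<longleftrightarrow> (\<exists>s t. x = s *\<^sub>C e + t *\<^sub>C w)" for x
    unfolding complex_vector.span_breakdown_eq[of x e "{w}"] complex_vector.span_singleton
    by (auto simp: image_iff diff_eq_eq) (metis add.commute)+
  have "op_ker (op_power B n) \<subseteq> complex_vector.span {e, w}" for n
  proof (induction n)
    case 0
    then show ?case by (simp add: ker_power_0 complex_vector.span_zero del: op_power.simps)
  next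
    case (Suc n)
    show ?case
    proof
      fix u assume "u \<in> op_ker (op_power B (Suc n))"
      then have u: "u \<in> op_dom B" "op_app B u \<in> complex_vector.span {e, w}" using Suc by (auto simp: ker_power_Suc simp del: op_power.simps)
      then obtain s t where t: "op_app B u = s *\<^sub>C e + t *\<^sub>C w" by (auto simp: sp)
      have 0: "op_app B (u - s *\<^sub>C w) = t *\<^sub>C w" using u w t by (simp add: app_diff app_scale)
      have "t = 0"
      proof (rule ccontr)
        assume "t \<noteq> 0"
        then have "op_app B ((1 / t) *\<^sub>C (u - s *\<^sub>C w)) = w"
          using 0 u w by (simp add: app_scale scaleC_one del: complex_vector.scale_right_diff_distrib)
        with range[of "(1 / t) *\<^sub>C (u - s *\<^sub>C w)"] u w show False by blast
      qed
      then have "u - s *\<^sub>C w \<in> complex_vector.span {e}" using ker[of "u - s *\<^sub>C w"] 0 u w by auto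
      then obtain r where "u - s *\<^sub>C w = r *\<^sub>C e" by (auto simp: complex_vector.span_singleton)
      then have "u = r *\<^sub>C e + s *\<^sub>C w" by (simp add: algebra_simps)
      then show "u \<in> complex_vector.span {e, w}" using sp by blast
    qed
  qed
  moreover have "complex_vector.span {e, w} \<subseteq> op_ker (op_power B (Suc (Suc 0)))"
    using e w unfolding subset_iff sp
    by (auto simp: ker_power_Suc ker_power_0 app_scale app_add simp del: op_power.simps)
  ultimately show ?thesis by fastforce
qed

lemma dim_double:
  assumes e: "e \<in> op_dom B" "op_app B e = 0" "e \<noteq> 0" and w: "w \<in> op_dom B" "op_app B w = e"
  shows "complex_vector.dim (complex_vector.span {e, w}) = 2"
proof -
  have "w \<notin> complex_vector.span {e}"
  proof
    assume "w \<in> complex_vector.span {e}"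
    then obtain t where "w = t *\<^sub>C e" by (auto simp: complex_vector.span_singleton)
    then have "op_app B w = t *\<^sub>C op_app B e" using app_scale[OF e(1), of t] by simp
    then show False using e w by simp
  qed
  moreover have "complex_vector.independent {e}" using e by simp
  ultimately have "complex_vector.independent (insert w {e})" by (rule complex_vector.independent_insertI)
  moreover have "w \<noteq> e" using e w by auto
  ultimately show ?thesis using complex_vector.dim_span_eq_card_independent[of "{w, e}"] by (simp add: insert_commute)
qed

end

lemma dim_single:
  fixes e :: "'v::complex_vector"
  assumes "e \<noteq> 0" shows "complex_vector.dim (complex_vector.span {e}) = 1"
  using complex_vector.dim_span_eq_card_independent[of "{e}"] assms by simp

section \<open>Compact symmetric operators\<close>

text \<open>
  The spectral theorem below is proved in an inner product space that may be incomplete.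
  The range of a compact operator already consists of limits, which replaces completeness
  wherever a limit has to exist.
\<close>

locale pre_hilbert =
  fixes X :: "'v::complex_vector set" and ip :: "'v \<Rightarrow> 'v \<Rightarrow> complex"
  assumes subspace_X: "complex_vector.subspace X"
    and ip_add: "\<And>x y z. x \<in> X \<Longrightarrow> y \<in> X \<Longrightarrow> z \<in> X \<Longrightarrow> ip (x + y) z = ip x z + ip y z"
    and ip_scale: "\<And>a x z. x \<in> X \<Longrightarrow> z \<in> X \<Longrightarrow> ip (a *\<^sub>C x) z = a * ip x z"
    and ip_cnj: "\<And>x y. x \<in> X \<Longrightarrow> y \<in> X \<Longrightarrow> ip y x = cnj (ip x y)"
    and ip_pos: "\<And>x. x \<in> X \<Longrightarrow> x \<noteq> 0 \<Longrightarrow> 0 < Re (ip x x)"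
begin

definition nm :: "'v \<Rightarrow> real"
  where "nm x = sqrt (Re (ip x x))"

lemma X_closed [simp, intro]:
  "0 \<in> X" "x \<in> X \<Longrightarrow> y \<in> X \<Longrightarrow> x + y \<in> X" "x \<in> X \<Longrightarrow> y \<in> X \<Longrightarrow> x - y \<in> X"
  "x \<in> X \<Longrightarrow> a *\<^sub>C x \<in> X"
  using subspace_X
  by (auto intro: complex_vector.subspace_0 complex_vector.subspace_add
      complex_vector.subspace_diff complex_vector.subspace_scale)

lemma X_sum [simp, intro]: "(\<And>i. i \<in> I \<Longrightarrow> f i \<in> X) \<Longrightarrow> sum f I \<in> X"
  using subspace_X by (rule complex_vector.subspace_sum)

lemma ip_add2: "x \<in> X \<Longrightarrow> y \<in> X \<Longrightarrow> z \<in> X \<Longrightarrow> ip z (x + y) = ip z x + ip z y"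
  using ip_cnj[of "x + y" z] ip_cnj[of x z] ip_cnj[of y z] ip_add[of x y z] by simp

lemma ip_scale2: "x \<in> X \<Longrightarrow> z \<in> X \<Longrightarrow> ip z (a *\<^sub>C x) = cnj a * ip z x"
  using ip_cnj[of "a *\<^sub>C x" z] ip_cnj[of x z] ip_scale[of x z a] by simp

lemma minus_eq_scale: "x - y = x + (-1) *\<^sub>C (y :: 'v)"
  by (simp add: complex_vector.scale_minus_left scaleC_one)

lemma ip_diff: "x \<in> X \<Longrightarrow> y \<in> X \<Longrightarrow> z \<in> X \<Longrightarrow> ip (x - y) z = ip x z - ip y z"
  unfolding minus_eq_scale by (simp add: ip_add ip_scale del: complex_vector.scale_minus_left)

lemma ip_diff2: "x \<in> X \<Longrightarrow> y \<in> X \<Longrightarrow> z \<in> X \<Longrightarrow> ip z (x - y) = ip z x - ip z y"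
  unfolding minus_eq_scale by (simp add: ip_add2 ip_scale2 del: complex_vector.scale_minus_left)

lemma ip_zero [simp]: "x \<in> X \<Longrightarrow> ip 0 x = 0" "x \<in> X \<Longrightarrow> ip x 0 = 0"
  using ip_diff[of x x x] ip_diff2[of x x x] by simp_all

lemma ip_sum: "(\<And>i. i \<in> I \<Longrightarrow> f i \<in> X) \<Longrightarrow> z \<in> X \<Longrightarrow> ip (sum f I) z = (\<Sum>i\<in>I. ip (f i) z)"
  by (induction I rule: infinite_finite_induct) (auto simp: ip_add)

lemma ip_self: "x \<in> X \<Longrightarrow> ip x x = of_real (Re (ip x x))"
  using ip_cnj[of x x] by (simp add: complex_eq_iff)

lemma ip_nonneg: "x \<in> X \<Longrightarrow> 0 \<le> Re (ip x x)"
  using ip_pos[of x] by (cases "x = 0") auto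

lemma nm_nonneg [simp]: "x \<in> X \<Longrightarrow> 0 \<le> nm x"
  by (simp add: nm_def ip_nonneg)

lemma nm_sq: "x \<in> X \<Longrightarrow> (nm x)\<^sup>2 = Re (ip x x)"
  by (simp add: nm_def ip_nonneg)

lemma nm_zero [simp]: "nm 0 = 0"
  by (simp add: nm_def)

lemma nm_pos: "x \<in> X \<Longrightarrow> x \<noteq> 0 \<Longrightarrow> 0 < nm x"
  by (simp add: nm_def ip_pos)

lemma nm_scale: "x \<in> X \<Longrightarrow> nm (a *\<^sub>C x) = cmod a * nm x"
proof -
  assume x: "x \<in> X"
  have "ip (a *\<^sub>C x) (a *\<^sub>C x) = (a * cnj a) * ip x x"
    using x by (simp add: ip_scale ip_scale2)
  also have "\<dots> = of_real ((cmod a)\<^sup>2 * Re (ip x x))"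
    using ip_self[OF x] by (metis complex_norm_square of_real_mult)
  finally have "Re (ip (a *\<^sub>C x) (a *\<^sub>C x)) = (cmod a)\<^sup>2 * Re (ip x x)"
    by (simp only: Re_complex_of_real)
  then show ?thesis
    by (simp add: nm_def real_sqrt_mult)
qed

lemma cauchy_schwarz:
  assumes x: "x \<in> X" and y: "y \<in> X"
  shows "cmod (ip x y) \<le> nm x * nm y"
proof (cases "y = 0")
  case True
  then show ?thesis using x by simp
next
  case False
  define n where "n = Re (ip y y)"
  have n: "0 < n" using False y by (simp add: n_def ip_pos)
  have yy: "ip y y = of_real n" using ip_self[OF y] by (simp add: n_def)
  define t where "t = ip x y / of_real n"
  have "0 \<le> Re (ip (x - t *\<^sub>C y) (x - t *\<^sub>C y))"
    using x y by (intro ip_nonneg) auto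
  also have "ip (x - t *\<^sub>C y) (x - t *\<^sub>C y)
      = ip x x - cnj t * ip x y - t * ip y x + t * cnj t * ip y y"
    using x y by (simp add: ip_diff ip_diff2 ip_scale ip_scale2 algebra_simps)
  also have "\<dots> = ip x x - ip x y * cnj (ip x y) / of_real n"
  proof -
    have "t * cnj t * of_real n = t * cnj (ip x y)" and "cnj t * ip x y = ip x y * cnj (ip x y) / of_real n"
      using n by (simp_all add: t_def)
    then show ?thesis unfolding ip_cnj[OF x y] yy by simp
  qed
  also have "ip x y * cnj (ip x y) / of_real n = of_real ((cmod (ip x y))\<^sup>2 / n)"
    unfolding complex_norm_square[symmetric] of_real_divide by simp
  finally have "(cmod (ip x y))\<^sup>2 / n \<le> Re (ip x x)"
    unfolding minus_complex.sel Re_complex_of_real by simp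
  then have "(cmod (ip x y))\<^sup>2 \<le> (nm x * nm y)\<^sup>2"
    using n x y by (simp add: power_mult_distrib nm_sq n_def[symmetric] field_simps)
  then show ?thesis
    by (rule power2_le_imp_le) (use x y in auto)
qed

lemma nm_add: assumes x: "x \<in> X" and y: "y \<in> X" shows "nm (x + y) \<le> nm x + nm y"
proof -
  have "(nm (x + y))\<^sup>2 = (nm x)\<^sup>2 + (nm y)\<^sup>2 + 2 * Re (ip x y)"
    using x y by (simp add: nm_sq ip_add ip_add2 ip_cnj[OF x y])
  also have "\<dots> \<le> (nm x)\<^sup>2 + (nm y)\<^sup>2 + 2 * (nm x * nm y)"
    using cauchy_schwarz[OF x y] complex_Re_le_cmod[of "ip x y"] by linarith
  also have "\<dots> = (nm x + nm y)\<^sup>2" by (simp add: power2_sum)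
  finally show ?thesis by (rule power2_le_imp_le) (use x y in auto)
qed

lemma nm_diff_commute: "x \<in> X \<Longrightarrow> y \<in> X \<Longrightarrow> nm (x - y) = nm (y - x)"
  using nm_scale[of "y - x" "-1"] by (simp add: scaleC_one)

lemma nm_triangle: "x \<in> X \<Longrightarrow> y \<in> X \<Longrightarrow> z \<in> X \<Longrightarrow> nm (x - z) \<le> nm (x - y) + nm (y - z)"
  using nm_add[of "x - y" "y - z"] by simp

lemma nm_triangle_diff: "x \<in> X \<Longrightarrow> y \<in> X \<Longrightarrow> \<bar>nm x - nm y\<bar> \<le> nm (x - y)"
  using nm_add[of "x - y" y] nm_add[of "y - x" x] nm_diff_commute[of x y] by auto

end

locale compact_symmetric = pre_hilbert X ip for X :: "'v::complex_vector set" and ip +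
  fixes G :: "'v \<Rightarrow> 'v"
  assumes G_in [simp, intro]: "\<And>x. x \<in> X \<Longrightarrow> G x \<in> X"
    and G_add: "\<And>x y. x \<in> X \<Longrightarrow> y \<in> X \<Longrightarrow> G (x + y) = G x + G y"
    and G_scale: "\<And>a x. x \<in> X \<Longrightarrow> G (a *\<^sub>C x) = a *\<^sub>C G x"
    and G_sym: "\<And>x y. x \<in> X \<Longrightarrow> y \<in> X \<Longrightarrow> ip (G x) y = ip x (G y)"
    and G_bounded: "\<exists>C. \<forall>x\<in>X. nm (G x) \<le> C * nm x"
    and G_compact: "\<And>f :: nat \<Rightarrow> 'v. (\<And>n. f n \<in> X) \<Longrightarrow> (\<And>n. nm (f n) \<le> 1) \<Longrightarrow>
      \<exists>h\<in>X. \<exists>s. strict_mono s \<and> (\<lambda>n. nm (G (f (s n)) - h)) \<longlonglongrightarrow> 0"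
begin

lemma G_diff: "x \<in> X \<Longrightarrow> y \<in> X \<Longrightarrow> G (x - y) = G x - G y"
  unfolding minus_eq_scale by (simp only: G_add G_scale X_closed)

lemma G_zero [simp]: "G 0 = 0"
  using G_diff[of 0 0] by simp

lemma bound_from_unit_ball:
  assumes W: "complex_vector.subspace W" "W \<subseteq> X"
    and le: "\<And>y. y \<in> W \<Longrightarrow> nm y \<le> 1 \<Longrightarrow> nm (G y) \<le> N" and y: "y \<in> W"
  shows "nm (G y) \<le> N * nm y"
proof (cases "y = 0")
  case False
  have yX: "y \<in> X" using y W by auto
  have p: "0 < nm y" using yX False nm_pos by auto
  define z where "z = of_real (1 / nm y) *\<^sub>C y"
  have "z \<in> W" using W(1) y by (simp add: z_def complex_vector.subspace_scale)
  moreover have "nm z = 1" using p yX by (simp add: z_def nm_scale norm_divide)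
  ultimately have "nm (G z) \<le> N" using le by auto
  moreover have "nm (G z) = nm (G y) / nm y"
    using p yX by (simp add: z_def G_scale nm_scale norm_divide)
  ultimately show ?thesis using p by (simp add: field_simps)
qed auto

lemma G_tendsto:
  assumes "\<And>n::nat. f n \<in> X" "h \<in> X" "(\<lambda>n. nm (f n - h)) \<longlonglongrightarrow> 0"
  shows "(\<lambda>n. nm (G (f n) - G h)) \<longlonglongrightarrow> 0"
proof -
  obtain C where C: "\<And>x. x \<in> X \<Longrightarrow> nm (G x) \<le> C * nm x"
    using G_bounded by blast
  show ?thesis
  proof (rule tendsto_sandwich[OF _ _ tendsto_const])
    show "\<forall>\<^sub>F n in sequentially. nm (G (f n) - G h) \<le> C * nm (f n - h)"
      using assms C by (auto simp: G_diff[symmetric])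
    show "(\<lambda>n. C * nm (f n - h)) \<longlonglongrightarrow> 0"
      using tendsto_mult_right_zero[OF assms(3), of C] by simp
  qed (use assms in auto)
qed

lemma nm_lim_unique:
  assumes "\<And>n::nat. f n \<in> X" "h \<in> X" "h' \<in> X"
    and "(\<lambda>n. nm (f n - h)) \<longlonglongrightarrow> 0" "(\<lambda>n. nm (f n - h')) \<longlonglongrightarrow> 0"
  shows "h = h'"
proof (rule ccontr)
  assume "h \<noteq> h'"
  then have "0 < nm (h - h')" using assms by (intro nm_pos) auto
  moreover have "(\<lambda>n::nat. nm (h - h')) \<longlonglongrightarrow> 0"
  proof (rule tendsto_sandwich[OF _ _ tendsto_const])
    show "\<forall>\<^sub>F n in sequentially. nm (h - h') \<le> nm (f n - h) + nm (f n - h')"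
      using nm_triangle[OF assms(2) assms(1) assms(3)] nm_diff_commute[OF assms(2) assms(1)] by auto
    show "(\<lambda>n. nm (f n - h) + nm (f n - h')) \<longlonglongrightarrow> 0"
      using tendsto_add[OF assms(4,5)] by simp
  qed (use assms in auto)
  ultimately show False by (simp add: LIMSEQ_const_iff)
qed

text \<open>
  Let \<open>N\<close> be the norm of \<open>G\<close> on \<open>W\<close> and \<open>f n\<close> a maximising sequence.  For \<open>\<parallel>f\<parallel> \<le> 1\<close>,
  \<open>\<parallel>G\<^sup>2 f - N\<^sup>2 f\<parallel>\<^sup>2 \<le> N\<^sup>2 (N\<^sup>2 - \<parallel>G f\<parallel>\<^sup>2)\<close>, so the \<open>f n\<close> are asymptotically eigenvectors
  of \<open>G\<^sup>2\<close>, and a limit \<open>h\<close> of a subsequence of \<open>G (f n)\<close> satisfies \<open>G\<^sup>2 h = N\<^sup>2 h\<close>.  Factoring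
  \<open>(G - N) (G + N) h = 0\<close> turns this into an eigenvector of \<open>G\<close> for \<open>N\<close> or for \<open>- N\<close>.
\<close>

lemma exists_eigenvector:
  assumes W: "complex_vector.subspace W" "W \<subseteq> X" "\<And>x. x \<in> W \<Longrightarrow> G x \<in> W"
    and closed: "\<And>f h. (\<And>n::nat. f n \<in> W) \<Longrightarrow> h \<in> X \<Longrightarrow> (\<lambda>n. nm (f n - h)) \<longlonglongrightarrow> 0 \<Longrightarrow> h \<in> W"
    and x: "x \<in> W" "nm x \<le> 1" "\<epsilon> < nm (G x)" "0 \<le> \<epsilon>"
  shows "\<exists>v l. v \<in> W \<and> v \<noteq> 0 \<and> \<epsilon> < \<bar>l\<bar> \<and> G v = of_real l *\<^sub>C v"
proof -
  have WX: "y \<in> W \<Longrightarrow> y \<in> X" for y using W(2) by blast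
  obtain C where C: "\<And>x. x \<in> X \<Longrightarrow> nm (G x) \<le> C * nm x"
    using G_bounded by blast
  define S where "S = (\<lambda>y. nm (G y)) ` {y \<in> W. nm y \<le> 1}"
  have bdd: "bdd_above S"
  proof (rule bdd_aboveI)
    fix t assume "t \<in> S"
    then obtain y where y: "y \<in> W" "nm y \<le> 1" "t = nm (G y)" by (auto simp: S_def)
    have "t \<le> C * nm y" using y C WX by auto
    also have "\<dots> \<le> \<bar>C\<bar> * 1" using y WX
      by (intro mult_mono) auto
    finally show "t \<le> \<bar>C\<bar>" by simp
  qed
  define N where "N = Sup S"
  have xS: "nm (G x) \<in> S" using x by (auto simp: S_def)
  have N: "\<epsilon> < N" using cSup_upper[OF xS bdd] x(3) by (simp add: N_def)
  have N0: "0 < N" using N x by simp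
  have leN: "nm (G y) \<le> N * nm y" if "y \<in> W" for y
  proof (rule bound_from_unit_ball[OF W(1,2) _ that])
    fix z assume "z \<in> W" "nm z \<le> 1"
    then have "nm (G z) \<in> S" by (auto simp: S_def)
    then show "nm (G z) \<le> N" using cSup_upper bdd by (simp add: N_def)
  qed
  have "\<exists>y\<in>W. nm y \<le> 1 \<and> N - 1 / real (Suc n) < nm (G y)" for n
  proof -
    have "N - 1 / real (Suc n) < Sup S" by (simp add: N_def)
    then obtain t where "t \<in> S" "N - 1 / real (Suc n) < t"
      using less_cSup_iff[of S] xS bdd by blast
    then show ?thesis by (auto simp: S_def)
  qed
  then obtain f where f: "\<And>n. f n \<in> W" "\<And>n. nm (f n) \<le> 1"
      "\<And>n. N - 1 / real (Suc n) < nm (G (f n))"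
    by metis
  obtain h s where h: "h \<in> X" "strict_mono s" "(\<lambda>n. nm (G (f (s n)) - h)) \<longlonglongrightarrow> 0"
    using G_compact[of f] f WX by blast
  have fX: "f n \<in> X" for n using f WX by auto
  have hW: "h \<in> W" using closed[of "\<lambda>n. G (f (s n))" h] h W f by auto
  have lim0: "(\<lambda>n. nm (G (f n))) \<longlonglongrightarrow> N"
  proof (rule tendsto_sandwich)
    show "\<forall>\<^sub>F n in sequentially. N - 1 / real (Suc n) \<le> nm (G (f n))"
      using f(3) less_imp_le by (intro always_eventually) blast
    have "nm (G (f n)) \<le> N" for n
      using leN[OF f(1)[of n]] f(2)[of n] N0 mult_left_le[of "nm (f n)" N] by linarith
    then show "\<forall>\<^sub>F n in sequentially. nm (G (f n)) \<le> N" by simp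
    show "(\<lambda>n. N - 1 / real (Suc n)) \<longlonglongrightarrow> N"
      using tendsto_diff[OF tendsto_const[of N] LIMSEQ_inverse_real_of_nat] by (simp add: inverse_eq_divide)
  qed auto
  have lim: "(\<lambda>n. nm (G (f (s n)))) \<longlonglongrightarrow> N"
    using LIMSEQ_subseq_LIMSEQ[OF lim0 h(2)] by (simp add: o_def)
  have nh: "nm h = N"
  proof -
    have "(\<lambda>n. nm (G (f (s n))) - nm h) \<longlonglongrightarrow> 0"
      by (rule tendsto_rabs_zero_cancel,
          rule tendsto_sandwich[OF _ _ tendsto_const h(3)])
        (use nm_triangle_diff h fX in auto)
    with lim have "N - nm h = 0"
      using LIMSEQ_unique tendsto_diff[OF lim tendsto_const[of "nm h"]] by blast
    then show ?thesis by simp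
  qed
  have main: "(\<lambda>n. nm (G (G (f (s n))) - of_real (N\<^sup>2) *\<^sub>C f (s n))) \<longlonglongrightarrow> 0"
  proof -
    have est: "(nm (G (G y) - of_real (N\<^sup>2) *\<^sub>C y))\<^sup>2 \<le> N\<^sup>2 * (N\<^sup>2 - (nm (G y))\<^sup>2)"
      if y: "y \<in> W" "nm y \<le> 1" for y
    proof -
      have yX: "y \<in> X" using y WX by auto
      have e: "ip (G (G y)) y = of_real ((nm (G y))\<^sup>2)" "ip y (G (G y)) = of_real ((nm (G y))\<^sup>2)"
        using yX ip_self[of "G y"] by (simp_all add: G_sym nm_sq flip: G_sym)
      have "(nm (G (G y) - of_real (N\<^sup>2) *\<^sub>C y))\<^sup>2
          = (nm (G (G y)))\<^sup>2 - 2 * N\<^sup>2 * (nm (G y))\<^sup>2 + N^4 * (nm y)\<^sup>2"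
        using yX by (simp add: nm_sq[of "G (G y) - _ *\<^sub>C _"] ip_diff ip_diff2 ip_scale ip_scale2 e nm_sq[of y] nm_sq[of "G (G y)"]
            flip: of_real_power of_real_mult) (simp add: algebra_simps power2_eq_square power4_eq_xxxx)
      also have "\<dots> \<le> N\<^sup>2 * (nm (G y))\<^sup>2 - 2 * N\<^sup>2 * (nm (G y))\<^sup>2 + N^4 * 1"
      proof -
        have "(nm (G (G y)))\<^sup>2 \<le> (N * nm (G y))\<^sup>2"
          using leN[of "G y"] y W yX by (intro power_mono) auto
        moreover have "(nm y)\<^sup>2 \<le> 1" using y yX by (simp add: power_le_one)
        ultimately show ?thesis
          by (intro add_mono diff_mono mult_left_mono) (auto simp: power_mult_distrib)
      qed
      also have "\<dots> = N\<^sup>2 * (N\<^sup>2 - (nm (G y))\<^sup>2)" by (simp add: algebra_simps power2_eq_square power4_eq_xxxx)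
      finally show ?thesis .
    qed
    have z: "(\<lambda>n. N\<^sup>2 * (N\<^sup>2 - (nm (G (f (s n))))\<^sup>2)) \<longlonglongrightarrow> 0"
      using tendsto_mult_right_zero[OF tendsto_diff[OF tendsto_const[of "N\<^sup>2"] tendsto_power[OF lim, of 2], simplified], of "N\<^sup>2"]
      by simp
    have "(\<lambda>n. (nm (G (G (f (s n))) - of_real (N\<^sup>2) *\<^sub>C f (s n)))\<^sup>2) \<longlonglongrightarrow> 0"
      by (rule tendsto_sandwich[OF _ _ tendsto_const z]) (use est f in auto)
    then have "(\<lambda>n. sqrt ((nm (G (G (f (s n))) - of_real (N\<^sup>2) *\<^sub>C f (s n)))\<^sup>2)) \<longlonglongrightarrow> sqrt 0"
      by (rule tendsto_real_sqrt)
    then show ?thesis using fX by simp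
  qed
  have GGh: "G (G h) = of_real (N\<^sup>2) *\<^sub>C h"
  proof (rule nm_lim_unique[where f = "\<lambda>n. G (G (G (f (s n))))"])
    show "(\<lambda>n. nm (G (G (G (f (s n)))) - G (G h))) \<longlonglongrightarrow> 0"
      using h fX by (intro G_tendsto) auto
    have 1: "(\<lambda>n. nm (G (G (G (f (s n)))) - G (of_real (N\<^sup>2) *\<^sub>C f (s n)))
          + N\<^sup>2 * nm (G (f (s n)) - h)) \<longlonglongrightarrow> 0"
    proof -
      have "(\<lambda>n. nm (G (G (G (f (s n)))) - G (of_real (N\<^sup>2) *\<^sub>C f (s n)))) \<longlonglongrightarrow> 0"
        by (rule tendsto_sandwich[OF _ _ tendsto_const tendsto_mult_right_zero[OF main, of C]])
          (use fX C in \<open>auto simp: G_diff[symmetric]\<close>)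
      from tendsto_add[OF this tendsto_mult_right_zero[OF h(3), of "N\<^sup>2"]] show ?thesis by simp
    qed
    show "(\<lambda>n. nm (G (G (G (f (s n)))) - of_real (N\<^sup>2) *\<^sub>C h)) \<longlonglongrightarrow> 0"
    proof (rule tendsto_sandwich[OF _ _ tendsto_const 1])
      have "nm (G (G (G (f (s n)))) - of_real (N\<^sup>2) *\<^sub>C h)
          \<le> nm (G (G (G (f (s n)))) - G (of_real (N\<^sup>2) *\<^sub>C f (s n))) + N\<^sup>2 * nm (G (f (s n)) - h)" for n
      proof -
        have "N\<^sup>2 * nm (G (f (s n)) - h) = nm (of_real (N\<^sup>2) *\<^sub>C (G (f (s n)) - h))"
          using fX h by (subst nm_scale) (auto simp: norm_power)
        also have "\<dots> = nm (G (of_real (N\<^sup>2) *\<^sub>C f (s n)) - of_real (N\<^sup>2) *\<^sub>C h)"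
          using fX by (simp add: G_scale complex_vector.scale_right_diff_distrib)
        finally show ?thesis
          using nm_triangle[of "G (G (G (f (s n))))" "G (of_real (N\<^sup>2) *\<^sub>C f (s n))" "of_real (N\<^sup>2) *\<^sub>C h"] fX h
          by simp
      qed
      then show "\<forall>\<^sub>F n in sequentially. nm (G (G (G (f (s n)))) - of_real (N\<^sup>2) *\<^sub>C h)
          \<le> nm (G (G (G (f (s n)))) - G (of_real (N\<^sup>2) *\<^sub>C f (s n))) + N\<^sup>2 * nm (G (f (s n)) - h)" by simp
    qed (use fX h in auto)
  qed (use fX h in auto)
  have h0: "h \<noteq> 0" using nh N0 by auto
  \<comment> \<open>\<open>g = (G + N) h\<close>: either it vanishes, and \<open>h\<close> is an eigenvector, or it is one itself.\<close>
  define g where "g = G h + of_real N *\<^sub>C h"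
  show ?thesis
  proof (cases "g = 0")
    case True
    then have "G h = of_real (- N) *\<^sub>C h"
      by (simp add: g_def eq_neg_iff_add_eq_0)
    then show ?thesis using h0 hW N N0 by (intro exI[of _ h] exI[of _ "- N"]) auto
  next
    case False
    have "G g = of_real N *\<^sub>C g"
      using h by (simp add: g_def G_add G_scale GGh complex_vector.scale_right_distrib power2_eq_square)
    moreover have "g \<in> W" using W hW by (simp add: g_def complex_vector.subspace_add complex_vector.subspace_scale)
    ultimately show ?thesis using False N N0 by (intro exI[of _ g] exI[of _ N]) auto
  qed
qed

definition eigvecs :: "'v set"
  where "eigvecs = {v \<in> X. v \<noteq> 0 \<and> (\<exists>l. l \<noteq> 0 \<and> G v = of_real (l::real) *\<^sub>C v)}"

text \<open>
  A maximal orthonormal set \<open>S\<close> of eigenvectors with eigenvalues of modulus at least \<open>\<epsilon>\<close> is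
  finite, because the images of two of its elements have distance at least \<open>\<epsilon>\<close> and \<open>G\<close> is
  compact.  On the orthogonal complement \<open>W\<close> of \<open>S\<close> the norm of \<open>G\<close> is at most \<open>\<epsilon>\<close>, since otherwise
  \<open>exists_eigenvector\<close> would enlarge \<open>S\<close>.  Hence \<open>G x\<close> differs from the image under \<open>G\<close> of the
  projection of \<open>x\<close> to the span of \<open>S\<close> by at most \<open>\<epsilon> \<parallel>x\<parallel>\<close>.
\<close>

theorem range_approx:
  assumes x: "x \<in> X" and e: "0 < \<epsilon>"
  shows "\<exists>g\<in>complex_vector.span eigvecs. nm (G x - g) \<le> \<epsilon> * nm x"
proof -
  define E where "E = {v \<in> X. nm v = 1 \<and> (\<exists>l. \<epsilon> \<le> \<bar>l\<bar> \<and> G v = of_real (l::real) *\<^sub>C v)}"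
  define \<A> where "\<A> = {S. S \<subseteq> E \<and> (\<forall>u\<in>S. \<forall>v\<in>S. u \<noteq> v \<longrightarrow> ip u v = 0)}"
  have "\<exists>S\<in>\<A>. \<forall>T\<in>\<A>. S \<subseteq> T \<longrightarrow> T = S"
  proof (rule subset_Zorn')
    fix \<C> assume c: "subset.chain \<A> \<C>"
    then have sub: "\<C> \<subseteq> \<A>" and ch: "\<And>A B. A \<in> \<C> \<Longrightarrow> B \<in> \<C> \<Longrightarrow> A \<subseteq> B \<or> B \<subseteq> A"
      by (auto simp: subset.chain_def)
    show "\<Union>\<C> \<in> \<A>"
      unfolding \<A>_def
    proof (intro CollectI conjI ballI impI)
      show "\<Union>\<C> \<subseteq> E" using sub by (auto simp: \<A>_def)
      fix u v assume uv: "u \<in> \<Union>\<C>" "v \<in> \<Union>\<C>" "u \<noteq> v"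
      then obtain A B where AB: "A \<in> \<C>" "B \<in> \<C>" "u \<in> A" "v \<in> B" by blast
      with ch[of A B] have "\<exists>D\<in>\<C>. u \<in> D \<and> v \<in> D" by blast
      then show "ip u v = 0" using sub uv by (auto simp: \<A>_def)
    qed
  qed
  then obtain S where SA: "S \<in> \<A>" and max: "\<And>T. T \<in> \<A> \<Longrightarrow> S \<subseteq> T \<Longrightarrow> T = S" by blast
  have SE: "S \<subseteq> E" and orth: "\<And>u v. u \<in> S \<Longrightarrow> v \<in> S \<Longrightarrow> u \<noteq> v \<Longrightarrow> ip u v = 0"
    using SA by (auto simp: \<A>_def)
  have EX: "E \<subseteq> X" by (auto simp: E_def)
  have SX: "v \<in> S \<Longrightarrow> v \<in> X" for v using SE EX by auto
  have SS: "ip v v = 1" if "v \<in> S" for v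
    using that SE SX ip_self[of v] nm_sq[of v] by (auto simp: E_def)
  have fin: "finite S"
  proof (rule ccontr)
    assume "infinite S"
    then obtain f :: "nat \<Rightarrow> 'v" where f: "inj f" "range f \<subseteq> S"
      using infinite_countable_subset by blast
    have fS: "f n \<in> S" for n using f by auto
    have fX: "f n \<in> X" for n using fS SX by auto
    have f1: "nm (f n) \<le> 1" for n using fS[of n] SE by (auto simp: E_def)
    obtain h s where h: "h \<in> X" "strict_mono s" "(\<lambda>n. nm (G (f (s n)) - h)) \<longlonglongrightarrow> 0"
      using G_compact[of f] fX f1 by fastforce
    have sep: "\<epsilon>\<^sup>2 \<le> (nm (G (f m) - G (f n)))\<^sup>2" if "m \<noteq> n" for m n
    proof -
      have ne: "f m \<noteq> f n" using f(1) that by (auto dest: injD)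
      obtain l where l: "\<epsilon> \<le> \<bar>l\<bar>" "G (f m) = of_real l *\<^sub>C f m" using fS[of m] SE by (auto simp: E_def)
      obtain k where k: "\<epsilon> \<le> \<bar>k\<bar>" "G (f n) = of_real k *\<^sub>C f n" using fS[of n] SE by (auto simp: E_def)
      have "(nm (G (f m) - G (f n)))\<^sup>2 = l\<^sup>2 + k\<^sup>2"
        using fX ne fS by (simp add: l k nm_sq ip_diff ip_diff2 ip_scale ip_scale2 orth SS)
          (simp add: power2_eq_square)
      moreover have "\<epsilon>\<^sup>2 \<le> l\<^sup>2" using l e by (metis power2_abs power_mono less_imp_le)
      ultimately show ?thesis using zero_le_power2[of k] by linarith
    qed
    have "\<forall>\<^sub>F n in sequentially. nm (G (f (s n)) - h) < \<epsilon> / 2"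
      using order_tendstoD(2)[OF h(3), of "\<epsilon> / 2"] e by simp
    then obtain n0 where n0: "\<And>n. n0 \<le> n \<Longrightarrow> nm (G (f (s n)) - h) < \<epsilon> / 2"
      by (auto simp: eventually_sequentially)
    have "nm (G (f (s n0)) - G (f (s (Suc n0)))) < \<epsilon>"
      using nm_triangle[of "G (f (s n0))" h "G (f (s (Suc n0)))"] n0[of n0] n0[of "Suc n0"]
        nm_diff_commute[of h "G (f (s (Suc n0)))"] fX h by auto
    moreover have "s n0 \<noteq> s (Suc n0)" using h(2) by (simp add: strict_mono_eq)
    ultimately show False using sep[of "s n0" "s (Suc n0)"] e fX
      by (metis G_in X_closed(3) nm_nonneg not_less power2_le_imp_le)
  qed
  define W where "W = {y \<in> X. \<forall>v\<in>S. ip y v = 0}"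
  have WX: "W \<subseteq> X" by (auto simp: W_def)
  have Wsub: "complex_vector.subspace W"
    unfolding complex_vector.subspace_def W_def using SX by (auto simp: ip_add ip_scale)
  have WG: "G y \<in> W" if "y \<in> W" for y
  proof -
    have "ip (G y) v = 0" if v: "v \<in> S" for v
    proof -
      obtain l where l: "G v = of_real l *\<^sub>C v" using v SE by (auto simp: E_def)
      show ?thesis using \<open>y \<in> W\<close> v SX by (simp add: W_def G_sym l ip_scale2)
    qed
    then show ?thesis using that by (auto simp: W_def)
  qed
  have Wclosed: "h \<in> W" if f: "\<And>n::nat. f n \<in> W" and h: "h \<in> X" and l: "(\<lambda>n. nm (f n - h)) \<longlonglongrightarrow> 0" for f h
  proof -
    have "ip h v = 0" if v: "v \<in> S" for v
    proof -
      have "cmod (ip h v) \<le> nm (f n - h)" for n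
      proof -
        have "ip h v = - ip (f n - h) v" using f[of n] h v SX by (simp add: ip_diff W_def)
        then show ?thesis using cauchy_schwarz[of "f n - h" v] f[of n] h v SX SE by (auto simp: W_def E_def)
      qed
      then have "cmod (ip h v) \<le> 0" using LIMSEQ_le_const[OF l] by blast
      then show ?thesis by simp
    qed
    then show ?thesis using h by (simp add: W_def)
  qed
  have small1: "nm (G y) \<le> \<epsilon>" if y: "y \<in> W" "nm y \<le> 1" for y
  proof (rule ccontr)
    assume "\<not> ?thesis"
    then have "\<exists>v l. v \<in> W \<and> v \<noteq> 0 \<and> \<epsilon> < \<bar>l\<bar> \<and> G v = of_real l *\<^sub>C v"
      using e by (intro exists_eigenvector[OF Wsub WX WG _ y]) (auto intro: Wclosed)
    then obtain v l where v: "v \<in> W" "v \<noteq> 0" "\<epsilon> < \<bar>l\<bar>" "G v = of_real l *\<^sub>C v"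
      by blast
    have vX: "v \<in> X" using v WX by auto
    define u where "u = of_real (1 / nm v) *\<^sub>C v"
    have p: "0 < nm v" using v WX nm_pos by auto
    have u1: "nm u = 1" using p vX by (simp add: u_def nm_scale norm_divide)
    have uW: "u \<in> W" using Wsub v by (simp add: u_def complex_vector.subspace_scale)
    have "G u = of_real l *\<^sub>C u"
      using v vX by (simp add: u_def G_scale complex_vector.scale_left_commute)
    then have uE: "u \<in> E" using u1 uW WX v by (auto simp: E_def intro!: exI[of _ l])
    have "insert u S \<in> \<A>"
    proof -
      have "ip v u = 0 \<and> ip u v = 0" if "v \<in> S" for v
        using that uW SX ip_cnj[of u v] by (simp add: W_def)
      then show ?thesis unfolding \<A>_def using uE SE orth by blast
    qed
    then have "u \<in> S" using max[of "insert u S"] by blast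
    then have "ip u u = 0" using uW by (auto simp: W_def)
    then show False using u1 by (simp add: nm_def)
  qed
  have small: "nm (G y) \<le> \<epsilon> * nm y" if "y \<in> W" for y
    by (rule bound_from_unit_ball[OF Wsub WX small1 that])
  define q where "q = (\<Sum>v\<in>S. ip x v *\<^sub>C v)"
  have qX: "q \<in> X" using SX by (auto simp: q_def)
  define y where "y = x - q"
  have yX: "y \<in> X" using x qX by (simp add: y_def)
  have yW: "y \<in> W"
  proof -
    have "ip q v = ip x v" if v: "v \<in> S" for v
    proof -
      have "ip q v = (\<Sum>u\<in>S. ip x u * ip u v)"
        using v SX by (simp add: q_def ip_sum ip_scale)
      also have "\<dots> = (\<Sum>u\<in>S. if u = v then ip x v else 0)"
        by (rule sum.cong) (use orth SS v in auto)
      finally show ?thesis using fin v by simp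
    qed
    then show ?thesis using yX x qX SX by (auto simp: W_def y_def ip_diff)
  qed
  have "ip q y = 0"
  proof -
    have "ip v y = 0" if "v \<in> S" for v
      using that yW yX SX ip_cnj[of y v] by (simp add: W_def)
    then show ?thesis using SX yX by (simp add: q_def ip_sum ip_scale)
  qed
  then have "ip y y = ip x y" using x qX yX by (simp add: y_def ip_diff)
  then have "(nm y)\<^sup>2 \<le> nm x * nm y"
    using cauchy_schwarz[OF x yX] complex_Re_le_cmod[of "ip x y"] yX by (simp add: nm_sq)
  then have nyx: "nm y \<le> nm x"
    using x yX by (metis mult_right_le_imp_le nm_nonneg order_le_less power2_eq_square)
  have Gq: "G q \<in> complex_vector.span eigvecs"
  proof -
    have Gsum: "G (sum g I) = (\<Sum>i\<in>I. G (g i))" if "finite I" "\<And>i. i \<in> I \<Longrightarrow> g i \<in> X" for g and I :: "'v set"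
      using that by (induction I) (auto simp: G_add)
    have "G q = (\<Sum>v\<in>S. ip x v *\<^sub>C G v)"
      unfolding q_def using fin SX by (simp add: Gsum G_scale)
    also have "\<dots> \<in> complex_vector.span eigvecs"
    proof (intro complex_vector.span_sum complex_vector.span_scale)
      fix v assume v: "v \<in> S"
      then obtain l where l: "\<epsilon> \<le> \<bar>l\<bar>" "G v = of_real l *\<^sub>C v" using SE by (auto simp: E_def)
      have "v \<noteq> 0" using SS[OF v] by auto
      then have "v \<in> eigvecs" using l e SX[OF v] by (auto simp: eigvecs_def intro!: exI[of _ l])
      then show "G v \<in> complex_vector.span eigvecs"
        by (simp add: l complex_vector.span_base complex_vector.span_scale)
    qed
    finally show ?thesis .
  qed
  have "nm (G x - G q) = nm (G y)" using x qX by (simp add: y_def G_diff)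
  also have "\<dots> \<le> \<epsilon> * nm x" using small[OF yW] nyx e by (meson mult_left_mono less_imp_le order_trans)
  finally show ?thesis using Gq by blast
qed

end

section \<open>Integration on a bounded interval\<close>

locale bounded_interval =
  fixes c d :: real
  assumes c_less_d: "c < d"
begin

text \<open>
  Integrals over the interval are taken with respect to Lebesgue measure restricted to
  the open interval: this is a finite measure, and every bounded measurable function is integrable.
\<close>

abbreviation M :: "real measure"
  where "M \<equiv> restrict_space lborel {c<..<d}"

lemma space_M [simp]: "space M = {c<..<d}"
  by (simp add: space_restrict_space)

lemma finite_measure_M: "finite_measure M"
  using c_less_d by (intro finite_measureI) (simp add: emeasure_restrict_space)

lemma measure_M: "measure M (space M) = d - c"
  using c_less_d by (simp add: measure_restrict_space)

lemma measurable_M: "f \<in> borel_measurable borel \<Longrightarrow> f \<in> borel_measurable M"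
  by (intro measurable_restrict_space1) auto

lemma AE_M: "(AE x in M. P x) \<longleftrightarrow> (AE x in lborel. x \<in> {c<..<d} \<longrightarrow> P x)"
  by (subst AE_restrict_space_iff) auto

lemma AE_M_in: "AE x in M. x \<in> {c<..<d}"
  unfolding AE_M by simp

lemma AE_M_neq: "AE x in M. x \<noteq> (y::real)"
  unfolding AE_M using AE_lborel_singleton[of y] by eventually_elim auto

lemma continuous_measurable:
  fixes f :: "real \<Rightarrow> 'b::topological_space"
  assumes "continuous_on {c..d} f" shows "f \<in> borel_measurable M"
proof -
  have "f \<in> borel_measurable (restrict_space borel {c<..<d})"
    by (intro borel_measurable_continuous_on_restrict continuous_on_subset[OF assms]) auto
  then show ?thesis
    by (subst measurable_cong_sets[OF sets_restrict_space_cong[OF sets_lborel] refl])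
qed

lemma continuous_bounded:
  fixes f :: "real \<Rightarrow> 'b::real_normed_vector"
  assumes "continuous_on {c..d} f"
  obtains B where "0 < B" "\<And>x. x \<in> {c..d} \<Longrightarrow> norm (f x) \<le> B"
proof -
  have "bounded (f ` {c..d})"
    using assms by (intro compact_imp_bounded compact_continuous_image) auto
  then show ?thesis using that by (auto simp: bounded_pos)
qed

lemma integrable_bounded:
  fixes f :: "real \<Rightarrow> 'b::{banach, second_countable_topology}"
  assumes "f \<in> borel_measurable M" "\<And>x. x \<in> {c<..<d} \<Longrightarrow> norm (f x) \<le> B"
  shows "integrable M f"
proof -
  interpret finite_measure M by (rule finite_measure_M)
  show ?thesis using assms by (intro integrable_const_bound[of _ B]) (auto simp: AE_M)
qed

lemma continuous_integrable:
  fixes f :: "real \<Rightarrow> 'b::{banach, second_countable_topology}"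
  assumes "continuous_on {c..d} f" shows "integrable M f"
proof -
  obtain B where "\<And>x. x \<in> {c..d} \<Longrightarrow> norm (f x) \<le> B" using continuous_bounded[OF assms] by metis
  then show ?thesis by (intro integrable_bounded[OF continuous_measurable[OF assms], of B]) auto
qed

lemma integrable_mult_bounded:
  fixes u h :: "real \<Rightarrow> complex"
  assumes u: "integrable M u" and h: "h \<in> borel_measurable M"
    and B: "\<And>x. x \<in> {c<..<d} \<Longrightarrow> norm (h x) \<le> B"
  shows "integrable M (\<lambda>x. u x * h x)"
proof (rule Bochner_Integration.integrable_bound)
  show "integrable M (\<lambda>x. B * norm (u x))" using u by auto
  show "(\<lambda>x. u x * h x) \<in> borel_measurable M" using u h by auto
  show "AE x in M. norm (u x * h x) \<le> norm (B * norm (u x))"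
    using AE_M_in
  proof eventually_elim
    fix x assume "x \<in> {c<..<d}"
    with B have "norm (h x) \<le> B" by auto
    then have "norm (u x) * norm (h x) \<le> norm (u x) * \<bar>B\<bar>" by (intro mult_left_mono) auto
    then show "norm (u x * h x) \<le> norm (B * norm (u x))"
      by (simp add: norm_mult abs_mult mult.commute)
  qed
qed

lemma integrable_mult_continuous:
  fixes u h :: "real \<Rightarrow> complex"
  assumes "integrable M u" "continuous_on {c..d} h"
  shows "integrable M (\<lambda>x. u x * h x)" "integrable M (\<lambda>x. h x * u x)"
proof -
  show "integrable M (\<lambda>x. u x * h x)"
  proof -
    obtain B where "\<And>x. x \<in> {c..d} \<Longrightarrow> norm (h x) \<le> B" using continuous_bounded[OF assms(2)] by metis
    then show ?thesis
      by (intro integrable_mult_bounded[OF assms(1) continuous_measurable[OF assms(2)], of B]) auto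
  qed
  then show "integrable M (\<lambda>x. h x * u x)" by (simp add: mult.commute)
qed

section \<open>Indefinite integrals and absolute continuity\<close>

definition prim :: "(real \<Rightarrow> complex) \<Rightarrow> real \<Rightarrow> complex"
  where "prim u x = (\<integral>t. indicator {..x} t *\<^sub>R u t \<partial>M)"

lemma measurable_indicator:
  fixes u :: "real \<Rightarrow> 'b::{banach, second_countable_topology}"
  assumes "u \<in> borel_measurable M" "A \<in> sets borel"
  shows "(\<lambda>t. indicator A t *\<^sub>R u t) \<in> borel_measurable M"
  by (intro borel_measurable_scaleR measurable_M assms(1)) (use assms(2) in auto)

lemma integrable_indicator:
  fixes u :: "real \<Rightarrow> 'b::{banach, second_countable_topology}"
  assumes "integrable M u" "A \<in> sets borel"
  shows "integrable M (\<lambda>t. indicator A t *\<^sub>R u t)"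
  by (rule Bochner_Integration.integrable_bound[OF assms(1) measurable_indicator])
    (use assms in \<open>auto simp: indicator_def\<close>)

lemma prim_left [simp]: "x \<le> c \<Longrightarrow> prim u x = 0"
proof -
  assume "x \<le> c"
  then have "prim u x = (\<integral>t. 0 \<partial>M)"
    unfolding prim_def by (intro Bochner_Integration.integral_cong) auto
  then show ?thesis by simp
qed

lemma prim_right: "prim u d = (\<integral>t. u t \<partial>M)"
  unfolding prim_def by (intro Bochner_Integration.integral_cong) auto

lemma prim_add: "integrable M u \<Longrightarrow> integrable M v \<Longrightarrow> prim (\<lambda>t. u t + v t) x = prim u x + prim v x"
  unfolding prim_def
  by (subst Bochner_Integration.integral_add[symmetric]) (auto simp: algebra_simps intro!: integrable_indicator)

lemma prim_scale: "prim (\<lambda>t. a * u t) x = a * prim u x"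
  unfolding prim_def by (subst integral_mult_right_zero[symmetric]) (simp add: algebra_simps)

lemma prim_cnj: "integrable M u \<Longrightarrow> prim (\<lambda>t. cnj (u t)) x = cnj (prim u x)"
  unfolding prim_def by (subst Bochner_Integration.integral_cnj[symmetric]) simp

lemma prim_cong:
  assumes "integrable M u" "integrable M v" "AE t in M. t \<le> x \<longrightarrow> u t = v t" shows "prim u x = prim v x"
  unfolding prim_def
  using assms by (intro integral_cong_AE measurable_indicator) (auto simp: indicator_def elim!: eventually_mono)

lemma norm_prim_le:
  assumes "integrable M u" shows "norm (prim u x) \<le> (\<integral>t. norm (u t) \<partial>M)"
proof -
  have "norm (prim u x) \<le> (\<integral>t. norm (indicator {..x} t *\<^sub>R u t) \<partial>M)"
    unfolding prim_def by (rule integral_norm_bound)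
  also have "\<dots> \<le> (\<integral>t. norm (u t) \<partial>M)"
    using assms by (intro integral_mono integrable_norm integrable_indicator) (auto simp: indicator_def)
  finally show ?thesis .
qed

lemma norm_prim_le_mult:
  assumes "integrable M u" "h \<in> borel_measurable M" "integrable M h" "AE t in M. t \<le> x \<longrightarrow> norm (u t) \<le> h t"
  shows "norm (prim u x) \<le> (\<integral>t. indicator {..x} t *\<^sub>R h t \<partial>M)"
proof -
  have "norm (prim u x) \<le> (\<integral>t. norm (indicator {..x} t *\<^sub>R u t) \<partial>M)"
    unfolding prim_def by (rule integral_norm_bound)
  also have "\<dots> \<le> (\<integral>t. indicator {..x} t *\<^sub>R h t \<partial>M)"
  proof (rule integral_mono_AE)
    show "integrable M (\<lambda>t. indicator {..x} t *\<^sub>R h t)"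
      by (intro integrable_indicator assms(3)) simp
    show "AE t in M. norm (indicator {..x} t *\<^sub>R u t) \<le> indicator {..x} t *\<^sub>R h t"
      using assms(4) by eventually_elim (auto simp: indicator_def)
  qed (use assms(1) in \<open>intro integrable_norm integrable_indicator, auto\<close>)
  finally show ?thesis .
qed

lemma continuous_prim:
  assumes u: "integrable M u" shows "continuous_on A (prim u)"
  unfolding continuous_on_sequentially
proof (intro allI ballI impI)
  fix x :: "nat \<Rightarrow> real" and a
  assume "(\<forall>n. x n \<in> A) \<and> x \<longlonglongrightarrow> a"
  then have lim: "x \<longlonglongrightarrow> a" by simp
  show "(prim u \<circ> x) \<longlonglongrightarrow> prim u a"
    unfolding prim_def o_def
  proof (rule integral_dominated_convergence[where w = "\<lambda>t. norm (u t)"])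
    show "AE t in M. (\<lambda>i. indicator {..x i} t *\<^sub>R u t) \<longlonglongrightarrow> indicator {..a} t *\<^sub>R u t"
      using AE_M_neq[of a]
    proof eventually_elim
      fix t assume "t \<noteq> a"
      then consider "t < a" | "a < t" by linarith
      then show "(\<lambda>i. indicator {..x i} t *\<^sub>R u t) \<longlonglongrightarrow> indicator {..a} t *\<^sub>R u t"
      proof cases
        case 1
        have "\<forall>\<^sub>F i in sequentially. t < x i" using order_tendstoD(1)[OF lim 1] .
        then show ?thesis
          by (intro tendsto_eventually) (use 1 in \<open>auto elim!: eventually_mono\<close>)
      next
        case 2
        have "\<forall>\<^sub>F i in sequentially. x i < t" using order_tendstoD(2)[OF lim 2] .
        then show ?thesis
          by (intro tendsto_eventually) (use 2 in \<open>auto elim!: eventually_mono\<close>)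
      qed
    qed
    show "AE t in M. norm (indicator {..x i} t *\<^sub>R u t) \<le> norm (u t)" for i
      by (simp add: indicator_def)
    show "(\<lambda>t. indicator {..x i} t *\<^sub>R u t) \<in> borel_measurable M" for i
      using u by (intro measurable_indicator) auto
    show "(\<lambda>t. indicator {..a} t *\<^sub>R u t) \<in> borel_measurable M"
      using u by (intro measurable_indicator) auto
  qed (use u in auto)
qed

lemma prim_diff_le:
  assumes u: "integrable M u" and xy: "c \<le> x" "x \<le> y" "y \<le> d"
    and B: "AE t in M. norm (u t) \<le> B"
  shows "norm (prim u y - prim u x) \<le> B * (y - x)"
proof -
  have "prim u y - prim u x = (\<integral>t. indicator {..y} t *\<^sub>R u t - indicator {..x} t *\<^sub>R u t \<partial>M)"
    unfolding prim_def using u by (intro Bochner_Integration.integral_diff[symmetric] integrable_indicator) auto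
  also have "\<dots> = (\<integral>t. indicator {x<..y} t *\<^sub>R u t \<partial>M)"
    using xy by (intro Bochner_Integration.integral_cong) (auto simp: indicator_def)
  also have "norm \<dots> \<le> (\<integral>t. norm (indicator {x<..y} t *\<^sub>R u t) \<partial>M)"
    by (rule integral_norm_bound)
  also have "\<dots> \<le> (\<integral>t. B * indicator {x<..y} t \<partial>M)"
  proof (rule integral_mono_AE)
    show "integrable M (\<lambda>t. norm (indicator {x<..y} t *\<^sub>R u t))"
      by (intro integrable_norm integrable_indicator u) simp
    show "integrable M (\<lambda>t. B * indicator {x<..y} t)"
      by (intro integrable_bounded[of _ "\<bar>B\<bar>"] borel_measurable_times measurable_M) (auto simp: indicator_def)
    show "AE t in M. norm (indicator {x<..y} t *\<^sub>R u t) \<le> B * indicator {x<..y} t"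
      using B by eventually_elim (auto simp: indicator_def)
  qed
  also have "\<dots> = B * measure M ({x<..y} \<inter> space M)"
    using finite_measure.emeasure_finite[OF finite_measure_M] by simp
  also have "measure M ({x<..y} \<inter> space M) = measure lborel ({x<..y} - {d})"
  proof -
    have "{x<..y} \<inter> space M = {x<..y} - {d}" using xy by auto
    then show ?thesis using xy by (subst measure_restrict_space) auto
  qed
  also have "\<dots> = y - x"
    using xy by (subst measure_Diff_null_set) (auto simp: null_sets_def)
  finally show ?thesis .
qed

text \<open>
  Integration by parts for integrable functions.  The product of the two integrals is a double
  integral over a square, which Fubini's theorem evaluates over the two triangles on either side
  of the diagonal.
\<close>

lemma prim_mult:
  assumes u: "integrable M u" and v: "integrable M v"
  shows "prim u x * prim v x = prim (\<lambda>t. u t * prim v t + prim u t * v t) x"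
proof -
  interpret finite_measure M by (rule finite_measure_M)
  interpret pair_sigma_finite M M ..
  have um[measurable]: "u \<in> borel_measurable M" and vm[measurable]: "v \<in> borel_measurable M"
    using u v by auto
  have uv: "integrable (M \<Otimes>\<^sub>M M) (\<lambda>(s, t). u s * v t)"
  proof (rule Fubini_integrable)
    show "(\<lambda>(s, t). u s * v t) \<in> borel_measurable (M \<Otimes>\<^sub>M M)"
      using um vm by measurable
    show "integrable M (\<lambda>s. \<integral>t. norm (case (s, t) of (s, t) \<Rightarrow> u s * v t) \<partial>M)"
      using u by (simp add: norm_mult)
  qed (use v in auto)
  \<comment> \<open>\<open>h1\<close> and \<open>h2\<close> are the integrand on the triangles \<open>t \<le> s \<le> x\<close> and \<open>s < t \<le> x\<close>.\<close>
  define h1 where "h1 = (\<lambda>(s, t). (indicator {..x} s * indicator {..s} t) *\<^sub>R (u s * v t))"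
  define h2 where "h2 = (\<lambda>(s, t). (indicator {..x} t * indicator {..<t} s) *\<^sub>R (u s * v t))"
  have m1: "h1 \<in> borel_measurable (M \<Otimes>\<^sub>M M)" and m2: "h2 \<in> borel_measurable (M \<Otimes>\<^sub>M M)"
  proof -
    have [measurable]: "fst \<in> borel_measurable (M \<Otimes>\<^sub>M M)" "snd \<in> borel_measurable (M \<Otimes>\<^sub>M M)"
      using measurable_compose[OF measurable_fst measurable_M[of "\<lambda>x. x"]]
        measurable_compose[OF measurable_snd measurable_M[of "\<lambda>x. x"]] by simp_all
    have "h1 = (\<lambda>z. (if fst z \<le> x \<and> snd z \<le> fst z then u (fst z) * v (snd z) else 0))"
      by (auto simp: h1_def fun_eq_iff)
    moreover have "h2 = (\<lambda>z. (if snd z \<le> x \<and> fst z < snd z then u (fst z) * v (snd z) else 0))"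
      by (auto simp: h2_def fun_eq_iff)
    ultimately show "h1 \<in> borel_measurable (M \<Otimes>\<^sub>M M)" "h2 \<in> borel_measurable (M \<Otimes>\<^sub>M M)"
      by simp_all measurable
  qed
  have i1: "integrable (M \<Otimes>\<^sub>M M) h1"
    by (rule Bochner_Integration.integrable_bound[OF uv m1]) (auto simp: h1_def indicator_def)
  have i2: "integrable (M \<Otimes>\<^sub>M M) h2"
    by (rule Bochner_Integration.integrable_bound[OF uv m2]) (auto simp: h2_def indicator_def)
  have "prim u x * prim v x = (\<integral>s. (\<integral>t. (indicator {..x} s *\<^sub>R u s) * (indicator {..x} t *\<^sub>R v t) \<partial>M) \<partial>M)"
    unfolding prim_def Bochner_Integration.integral_mult_right_zero Bochner_Integration.integral_mult_left_zero ..
  also have "\<dots> = (\<integral>s. (\<integral>t. h1 (s, t) + h2 (s, t) \<partial>M) \<partial>M)"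
    by (intro Bochner_Integration.integral_cong refl) (auto simp: h1_def h2_def indicator_def)
  also have "\<dots> = (\<integral>z. h1 z + h2 z \<partial>(M \<Otimes>\<^sub>M M))"
    using integral_fst'[OF Bochner_Integration.integrable_add[OF i1 i2]] by simp
  also have "\<dots> = (\<integral>z. h1 z \<partial>(M \<Otimes>\<^sub>M M)) + (\<integral>z. h2 z \<partial>(M \<Otimes>\<^sub>M M))"
    using i1 i2 by simp
  also have "(\<integral>z. h1 z \<partial>(M \<Otimes>\<^sub>M M)) = (\<integral>s. indicator {..x} s *\<^sub>R (u s * prim v s) \<partial>M)"
    unfolding integral_fst'[OF i1, symmetric]
    by (intro Bochner_Integration.integral_cong refl)
      (simp add: h1_def prim_def flip: integral_mult_right_zero integral_scaleR_right)
  also have "(\<integral>z. h2 z \<partial>(M \<Otimes>\<^sub>M M)) = (\<integral>t. (\<integral>s. h2 (s, t) \<partial>M) \<partial>M)"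
    using integral_snd[of "\<lambda>s t. h2 (s, t)"] i2 by simp
  also have "\<dots> = (\<integral>t. indicator {..x} t *\<^sub>R (prim u t * v t) \<partial>M)"
  proof (intro Bochner_Integration.integral_cong refl)
    fix t
    have "(\<integral>s. indicator {..<t} s *\<^sub>R u s \<partial>M) = prim u t"
      unfolding prim_def
    proof (rule integral_cong_AE)
      show "AE s in M. indicator {..<t} s *\<^sub>R u s = indicator {..t} s *\<^sub>R u s"
        using AE_M_neq[of t] by eventually_elim (auto simp: indicator_def)
      show "(\<lambda>s. indicator {..<t} s *\<^sub>R u s) \<in> borel_measurable M"
        by (intro measurable_indicator um) auto
      show "(\<lambda>s. indicator {..t} s *\<^sub>R u s) \<in> borel_measurable M"
        by (intro measurable_indicator um) auto
    qed
    then show "(\<integral>s. h2 (s, t) \<partial>M) = indicator {..x} t *\<^sub>R (prim u t * v t)"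
      by (simp add: h2_def flip: scaleR_scaleR mult_scaleR_left)
  qed
  finally have "prim u x * prim v x = prim (\<lambda>t. u t * prim v t) x + prim (\<lambda>t. prim u t * v t) x"
    unfolding prim_def[of "\<lambda>t. u t * prim v t"] prim_def[of "\<lambda>t. prim u t * v t"] .
  then show ?thesis
    using u v by (simp add: prim_add integrable_mult_continuous continuous_prim)
qed

text \<open>
  \<open>AC U u\<close>: on the closed interval, \<open>U\<close> is absolutely continuous with derivative \<open>u\<close>.
\<close>

definition AC :: "(real \<Rightarrow> complex) \<Rightarrow> (real \<Rightarrow> complex) \<Rightarrow> bool"
  where "AC U u \<longleftrightarrow> integrable M u \<and> (\<forall>x\<in>{c..d}. U x - U c = prim u x)"

lemma AC_integrable: "AC U u \<Longrightarrow> integrable M u"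
  by (simp add: AC_def)

lemma AC_eq: "AC U u \<Longrightarrow> x \<in> {c..d} \<Longrightarrow> U x = U c + prim u x"
  unfolding AC_def by (metis add.commute diff_add_cancel)

lemma AC_continuous: "AC U u \<Longrightarrow> continuous_on {c..d} U"
proof -
  assume U: "AC U u"
  then have "continuous_on {c..d} (\<lambda>x. U c + prim u x)"
    by (intro continuous_intros continuous_prim) (simp add: AC_def)
  moreover have "x \<in> {c..d} \<Longrightarrow> U c + prim u x = U x" for x
    using AC_eq[OF U] by metis
  ultimately show ?thesis by (rule continuous_on_eq)
qed

lemma AC_prim: "integrable M u \<Longrightarrow> AC (\<lambda>x. C + prim u x) u"
  by (simp add: AC_def)

lemma AC_cong:
  assumes "AC U u" "\<And>x. x \<in> {c..d} \<Longrightarrow> V x = U x" "AE t in M. v t = u t" "v \<in> borel_measurable M"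
  shows "AC V v"
proof -
  have "integrable M v"
    using assms by (subst integrable_cong_AE[of v M u]) (auto simp: AC_def)
  moreover have "prim v x = prim u x" for x
    using assms calculation by (intro prim_cong) (auto simp: AC_def elim: eventually_mono)
  ultimately show ?thesis using assms(1,2) c_less_d by (auto simp: AC_def)
qed

lemma AC_const: "AC (\<lambda>x. a) (\<lambda>x. 0)"
  using prim_scale[of 0 "\<lambda>_. 0"] by (simp add: AC_def)

lemma AC_add: "AC U u \<Longrightarrow> AC V v \<Longrightarrow> AC (\<lambda>x. U x + V x) (\<lambda>x. u x + v x)"
  by (auto simp: AC_def prim_add add_diff_add)

lemma AC_scale: "AC U u \<Longrightarrow> AC (\<lambda>x. a * U x) (\<lambda>x. a * u x)"
  by (auto simp: AC_def prim_scale simp flip: right_diff_distrib)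

lemma AC_diff: "AC U u \<Longrightarrow> AC V v \<Longrightarrow> AC (\<lambda>x. U x - V x) (\<lambda>x. u x - v x)"
  using AC_add[OF _ AC_scale[of V v "-1"]] by simp

lemma AC_cnj: "AC U u \<Longrightarrow> AC (\<lambda>x. cnj (U x)) (\<lambda>x. cnj (u x))"
  by (auto simp: AC_def prim_cnj simp flip: complex_cnj_diff)

lemma AC_mult:
  assumes U: "AC U u" and V: "AC V v"
  shows "AC (\<lambda>x. U x * V x) (\<lambda>x. u x * V x + U x * v x)"
proof -
  have u: "integrable M u" and v: "integrable M v" using U V by (auto simp: AC_def)
  note cont = AC_continuous[OF U] AC_continuous[OF V]
  have i: "integrable M (\<lambda>x. u x * V x + U x * v x)"
    using u v cont by (intro Bochner_Integration.integrable_add integrable_mult_continuous)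
  moreover have "U x * V x - U c * V c = prim (\<lambda>x. u x * V x + U x * v x) x" if x: "x \<in> {c..d}" for x
  proof -
    have "prim (\<lambda>x. u x * V x + U x * v x) x
        = prim (\<lambda>t. V c * u t + (U c * v t + (u t * prim v t + prim u t * v t))) x"
    proof (rule prim_cong[OF i])
      show "AE t in M. t \<le> x \<longrightarrow> u t * V t + U t * v t
          = V c * u t + (U c * v t + (u t * prim v t + prim u t * v t))"
        using AE_M_in
      proof eventually_elim
        fix t assume "t \<in> {c<..<d}"
        then have "U t = U c + prim u t" "V t = V c + prim v t" using AC_eq[OF U, of t] AC_eq[OF V, of t] by auto
        then show "t \<le> x \<longrightarrow> u t * V t + U t * v t
          = V c * u t + (U c * v t + (u t * prim v t + prim u t * v t))"
          by (simp only:) (simp add: algebra_simps)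
      qed
    qed (intro Bochner_Integration.integrable_add integrable_mult_continuous continuous_prim
        integrable_mult_right u v)
    also have "\<dots> = V c * prim u x + (U c * prim v x + prim u x * prim v x)"
      using u v by (simp add: prim_mult prim_add prim_scale integrable_mult_continuous continuous_prim)
    finally have "prim (\<lambda>x. u x * V x + U x * v x) x
        = V c * prim u x + (U c * prim v x + prim u x * prim v x)" .
    then show ?thesis
      unfolding AC_eq[OF U x] AC_eq[OF V x] by (simp only:) (simp add: algebra_simps)
  qed
  ultimately show ?thesis by (auto simp: AC_def)
qed

lemma AC_right: "AC U u \<Longrightarrow> U d - U c = (\<integral>t. u t \<partial>M)"
  using c_less_d by (simp add: AC_def prim_right)

text \<open>
  The fundamental theorem of calculus: continuously differentiable functions, with one-sided
  derivatives at the end points, are the source of the absolutely continuous functions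
  that are given explicitly.
\<close>

lemma AC_deriv:
  assumes der: "\<And>x. x \<in> {c..d} \<Longrightarrow> (U has_vector_derivative u x) (at x within {c..d})"
    and cont: "continuous_on {c..d} u"
  shows "AC U u"
  unfolding AC_def
proof (intro conjI ballI)
  show "integrable M u" using cont by (rule continuous_integrable)
  fix x assume x: "x \<in> {c..d}"
  have "has_bochner_integral lborel (\<lambda>t. indicator {c..x} t *\<^sub>R u t) (U x - U c)"
    using x by (intro has_bochner_integral_FTC_Icc continuous_on_subset[OF cont]
        has_vector_derivative_within_subset[OF der]) auto
  then have int: "integrable lborel (\<lambda>t. indicator {c..x} t *\<^sub>R u t)"
    and "U x - U c = (\<integral>t. indicator {c..x} t *\<^sub>R u t \<partial>lborel)"
    unfolding has_bochner_integral_iff by auto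
  note this(2)
  also have "\<dots> = (\<integral>t. indicator {c<..<d} t *\<^sub>R (indicator {..x} t *\<^sub>R u t) \<partial>lborel)"
  proof (rule integral_cong_AE)
    show "AE t in lborel. indicator {c..x} t *\<^sub>R u t = indicator {c<..<d} t *\<^sub>R indicator {..x} t *\<^sub>R u t"
      using AE_lborel_singleton[of c] AE_lborel_singleton[of d]
      by eventually_elim (use x in \<open>auto simp: indicator_def\<close>)
    show "(\<lambda>t. indicator {c<..<d} t *\<^sub>R indicator {..x} t *\<^sub>R u t) \<in> borel_measurable lborel"
      using measurable_indicator[OF continuous_measurable[OF cont], of "{..x}"]
      by (subst borel_measurable_restrict_space_iff[symmetric]) (simp_all del: indicator_scaleR_eq_if)
  qed (use int in auto)
  also have "\<dots> = prim u x"
    unfolding prim_def by (subst integral_restrict_space) auto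
  finally show "U x - U c = prim u x" .
qed

section \<open>Square-integrable functions\<close>

definition sqi :: "(real \<Rightarrow> complex) \<Rightarrow> bool"
  where "sqi f \<longleftrightarrow> f \<in> borel_measurable M \<and> integrable M (\<lambda>x. (cmod (f x))\<^sup>2)"

lemma sqi_measurable: "sqi f \<Longrightarrow> f \<in> borel_measurable M"
  by (simp add: sqi_def)

lemma sqi_dominated:
  assumes f: "f \<in> borel_measurable M" and g: "integrable M g"
    and le: "AE x in M. (cmod (f x))\<^sup>2 \<le> g x"
  shows "sqi f"
  unfolding sqi_def
proof (intro conjI f Bochner_Integration.integrable_bound[OF g])
  show "AE x in M. norm ((cmod (f x))\<^sup>2) \<le> norm (g x)"
    using le by eventually_elim auto
qed (use f in measurable)

lemma sqi_bounded: "f \<in> borel_measurable M \<Longrightarrow> (\<And>x. x \<in> {c<..<d} \<Longrightarrow> cmod (f x) \<le> B) \<Longrightarrow> sqi f"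
  by (rule sqi_dominated[of _ "\<lambda>_. B\<^sup>2"])
    (auto simp: AE_M intro!: power_mono integrable_bounded[of _ "B\<^sup>2"])

lemma sqi_continuous: "continuous_on {c..d} f \<Longrightarrow> sqi f"
proof -
  assume f: "continuous_on {c..d} f"
  then obtain B where "\<And>x. x \<in> {c..d} \<Longrightarrow> norm (f x) \<le> B" using continuous_bounded by metis
  then show ?thesis by (intro sqi_bounded[OF continuous_measurable[OF f], of B]) auto
qed

lemma sqi_mult_integrable:
  assumes f: "sqi f" and g: "sqi g" shows "integrable M (\<lambda>x. f x * g x)"
proof (rule Bochner_Integration.integrable_bound)
  show "integrable M (\<lambda>x. (cmod (f x))\<^sup>2 + (cmod (g x))\<^sup>2)"
    using f g by (simp add: sqi_def)
  show "(\<lambda>x. f x * g x) \<in> borel_measurable M"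
    using f g by (auto simp: sqi_def)
  have "norm (f x * g x) \<le> (cmod (f x))\<^sup>2 + (cmod (g x))\<^sup>2" for x
  proof -
    have "2 * (cmod (f x) * cmod (g x)) \<le> (cmod (f x))\<^sup>2 + (cmod (g x))\<^sup>2"
      using sum_squares_bound[of "cmod (f x)" "cmod (g x)"] by simp
    moreover have "0 \<le> cmod (f x) * cmod (g x)" by simp
    ultimately show ?thesis unfolding norm_mult by linarith
  qed
  then show "AE x in M. norm (f x * g x) \<le> norm ((cmod (f x))\<^sup>2 + (cmod (g x))\<^sup>2)"
    by (intro AE_I2) (metis abs_ge_self order_trans real_norm_def)
qed

lemma sqi_integrable: "sqi f \<Longrightarrow> integrable M f"
  using sqi_mult_integrable[of f "\<lambda>_. 1"] sqi_continuous[of "\<lambda>_. 1"] by simp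

lemma sq_add_le: "(cmod (a + b))\<^sup>2 \<le> 2 * (cmod a)\<^sup>2 + 2 * (cmod b)\<^sup>2"
proof -
  have "(cmod (a + b))\<^sup>2 \<le> (cmod a + cmod b)\<^sup>2" by (intro power_mono norm_triangle_ineq) auto
  also have "\<dots> \<le> 2 * (cmod a)\<^sup>2 + 2 * (cmod b)\<^sup>2"
    using sum_squares_bound[of "cmod a" "cmod b"] by (simp add: power2_sum)
  finally show ?thesis .
qed

lemma sqi_add: "sqi f \<Longrightarrow> sqi g \<Longrightarrow> sqi (\<lambda>x. f x + g x)"
  by (rule sqi_dominated[of _ "\<lambda>x. 2 * (cmod (f x))\<^sup>2 + 2 * (cmod (g x))\<^sup>2"])
    (auto simp: sqi_def sq_add_le)

lemma sqi_mult_bounded: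
  assumes f: "sqi f" and h: "h \<in> borel_measurable M" and B: "\<And>x. x \<in> {c<..<d} \<Longrightarrow> cmod (h x) \<le> B"
  shows "sqi (\<lambda>x. h x * f x)"
proof (rule sqi_dominated[of _ "\<lambda>x. B\<^sup>2 * (cmod (f x))\<^sup>2"])
  show "AE x in M. (cmod (h x * f x))\<^sup>2 \<le> B\<^sup>2 * (cmod (f x))\<^sup>2"
    using AE_M_in by eventually_elim (auto simp: norm_mult power_mult_distrib intro!: mult_right_mono power_mono B)
qed (use f h in \<open>auto simp: sqi_def\<close>)

lemma sqi_mult_continuous: "sqi f \<Longrightarrow> continuous_on {c..d} h \<Longrightarrow> sqi (\<lambda>x. h x * f x)"
proof -
  assume f: "sqi f" and h: "continuous_on {c..d} h"
  then obtain B where "\<And>x. x \<in> {c..d} \<Longrightarrow> norm (h x) \<le> B" using continuous_bounded by metis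
  then show ?thesis by (intro sqi_mult_bounded[OF f continuous_measurable[OF h], of B]) auto
qed

lemma sqi_scale: "sqi f \<Longrightarrow> sqi (\<lambda>x. a * f x)"
  by (rule sqi_mult_continuous) auto

lemma sqi_diff: "sqi f \<Longrightarrow> sqi g \<Longrightarrow> sqi (\<lambda>x. f x - g x)"
  using sqi_add[OF _ sqi_scale[of g "-1"]] by simp

lemma sqi_cnj: "sqi f \<Longrightarrow> sqi (\<lambda>x. cnj (f x))"
  using borel_measurable_continuous_on[of cnj f M] by (auto simp: sqi_def continuous_on_cnj continuous_on_id)

lemma sqi_cong: "sqi f \<Longrightarrow> AE x in M. f x = g x \<Longrightarrow> g \<in> borel_measurable M \<Longrightarrow> sqi g"
  by (rule sqi_dominated[of _ "\<lambda>x. (cmod (f x))\<^sup>2"]) (auto simp: sqi_def elim!: eventually_mono)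

definition sqdist :: "(real \<Rightarrow> complex) \<Rightarrow> (real \<Rightarrow> complex) \<Rightarrow> real"
  where "sqdist f g = (\<integral>x. (cmod (f x - g x))\<^sup>2 \<partial>M)"

lemma sq_integrable: "sqi f \<Longrightarrow> integrable M (\<lambda>x. (cmod (f x))\<^sup>2)"
  by (simp add: sqi_def)

text \<open>
  Working with squared distances, the triangle inequality costs a factor of two; this is where the
  quarters of \<open>e\<close> come from in the approximation arguments.
\<close>

lemma sqdist_add_le:
  assumes "sqi f" "sqi g" "sqi h" "sqi k"
  shows "sqdist (\<lambda>x. f x + g x) (\<lambda>x. h x + k x) \<le> 2 * sqdist f h + 2 * sqdist g k"
proof -
  have "sqdist (\<lambda>x. f x + g x) (\<lambda>x. h x + k x)
      \<le> (\<integral>x. 2 * (cmod (f x - h x))\<^sup>2 + 2 * (cmod (g x - k x))\<^sup>2 \<partial>M)"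
    unfolding sqdist_def
    using assms sq_add_le[of "f x - h x" "g x - k x" for x]
    by (intro integral_mono sq_integrable Bochner_Integration.integrable_add integrable_mult_right sqi_diff sqi_add)
      (auto simp: add_diff_add)
  also have "\<dots> = 2 * sqdist f h + 2 * sqdist g k"
    unfolding sqdist_def using assms
    by (subst Bochner_Integration.integral_add) (auto intro!: integrable_mult_right sq_integrable sqi_diff)
  finally show ?thesis .
qed

lemma sqdist_triangle:
  assumes "sqi f" "sqi g" "sqi h"
  shows "sqdist f h \<le> 2 * sqdist f g + 2 * sqdist g h"
  using sqdist_add_le[of "\<lambda>x. f x - g x" g "\<lambda>x. 0" h] assms sqi_diff[of f g] sqi_continuous[of "\<lambda>_. 0"]
  by (simp add: sqdist_def)

section \<open>Density of continuous functions with compact support and of polynomials\<close>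

definition Cc :: "(real \<Rightarrow> complex) \<Rightarrow> bool"
  where "Cc h \<longleftrightarrow> continuous_on UNIV h \<and> (\<exists>K. compact K \<and> K \<subseteq> {c<..<d} \<and> (\<forall>x. x \<notin> K \<longrightarrow> h x = 0))"

lemma Cc_add: "Cc h \<Longrightarrow> Cc k \<Longrightarrow> Cc (\<lambda>x. h x + k x)"
  unfolding Cc_def
proof (elim conjE exE, intro conjI)
  fix K L assume "compact K" "K \<subseteq> {c<..<d}" "\<forall>x. x \<notin> K \<longrightarrow> h x = 0" "compact L" "L \<subseteq> {c<..<d}" "\<forall>x. x \<notin> L \<longrightarrow> k x = 0"
  then show "\<exists>K. compact K \<and> K \<subseteq> {c<..<d} \<and> (\<forall>x. x \<notin> K \<longrightarrow> h x + k x = 0)"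
    by (intro exI[of _ "K \<union> L"]) auto
qed (intro continuous_intros)

lemma Cc_map: "Cc h \<Longrightarrow> continuous_on UNIV g \<Longrightarrow> g 0 = 0 \<Longrightarrow> Cc (\<lambda>x. g (h x))"
  unfolding Cc_def by (auto intro: continuous_on_compose2[of UNIV g])

lemma Cc_sqi: "Cc h \<Longrightarrow> sqi h"
  by (rule sqi_continuous) (auto simp: Cc_def intro: continuous_on_subset)

text \<open>
  The closure in the mean-square sense of the continuous functions with compact support in
  the open interval.
\<close>

definition Cc_lim :: "(real \<Rightarrow> complex) \<Rightarrow> bool"
  where "Cc_lim f \<longleftrightarrow> sqi f \<and> (\<forall>e>0. \<exists>h. Cc h \<and> sqdist f h < e)"

lemma Cc_lim_add:
  assumes f: "Cc_lim f" and g: "Cc_lim g" shows "Cc_lim (\<lambda>x. f x + g x)"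
  unfolding Cc_lim_def
proof (intro conjI allI impI)
  show "sqi (\<lambda>x. f x + g x)" using f g by (auto simp: Cc_lim_def intro: sqi_add)
  fix e :: real assume e: "0 < e"
  obtain h where h: "Cc h" "sqdist f h < e / 4" using f e by (auto simp: Cc_lim_def dest!: spec[of _ "e / 4"])
  obtain k where k: "Cc k" "sqdist g k < e / 4" using g e by (auto simp: Cc_lim_def dest!: spec[of _ "e / 4"])
  have "sqdist (\<lambda>x. f x + g x) (\<lambda>x. h x + k x) < e"
    using sqdist_add_le[of f g h k] f g h k Cc_sqi by (auto simp: Cc_lim_def)
  with h k show "\<exists>h. Cc h \<and> sqdist (\<lambda>x. f x + g x) h < e" using Cc_add by blast
qed

lemma Cc_lim_scale:
  assumes f: "Cc_lim f" shows "Cc_lim (\<lambda>x. a * f x)"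
  unfolding Cc_lim_def
proof (intro conjI allI impI)
  show "sqi (\<lambda>x. a * f x)" using f by (auto simp: Cc_lim_def intro: sqi_scale)
  fix e :: real assume e: "0 < e"
  have p: "0 < (cmod a)\<^sup>2 + 1" by (simp add: add_nonneg_pos)
  obtain h where h: "Cc h" "sqdist f h < e / ((cmod a)\<^sup>2 + 1)"
    using f e p by (auto simp: Cc_lim_def dest!: spec[of _ "e / ((cmod a)\<^sup>2 + 1)"])
  have nn: "0 \<le> sqdist f h" by (simp add: sqdist_def)
  have "sqdist (\<lambda>x. a * f x) (\<lambda>x. a * h x) = (cmod a)\<^sup>2 * sqdist f h"
    by (simp add: sqdist_def norm_mult power_mult_distrib flip: right_diff_distrib)
  also have "\<dots> \<le> ((cmod a)\<^sup>2 + 1) * sqdist f h" using nn by (intro mult_right_mono) auto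
  also have "\<dots> < e" using h(2) p by (simp add: field_simps)
  finally show "\<exists>h. Cc h \<and> sqdist (\<lambda>x. a * f x) h < e"
    using Cc_map[OF h(1), of "\<lambda>z. a * z"] by (auto intro: continuous_intros)
qed

lemma Cc_lim_closed:
  assumes f: "sqi f" and lim: "\<And>e. 0 < e \<Longrightarrow> \<exists>g. Cc_lim g \<and> sqdist f g < e"
  shows "Cc_lim f"
  unfolding Cc_lim_def
proof (intro conjI allI impI f)
  fix e :: real assume e: "0 < e"
  obtain g where g: "Cc_lim g" "sqdist f g < e / 4" using lim[of "e / 4"] e by auto
  obtain h where h: "Cc h" "sqdist g h < e / 4" using g e by (auto simp: Cc_lim_def dest!: spec[of _ "e / 4"])
  have "sqdist f h < e"
    using sqdist_triangle[of f g h] f g h Cc_sqi by (auto simp: Cc_lim_def)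
  with h show "\<exists>h. Cc h \<and> sqdist f h < e" by blast
qed

lemma Cc_lim_cong:
  assumes f: "Cc_lim f" and "\<And>x. x \<in> {c<..<d} \<Longrightarrow> g x = f x" shows "Cc_lim g"
proof (rule Cc_lim_closed)
  have sf: "sqi f" using f by (simp add: Cc_lim_def)
  have gm: "g \<in> borel_measurable M"
    using sqi_measurable[OF sf] assms(2) by (subst measurable_cong[of M g f]) simp_all
  have "AE x in M. f x = g x" using AE_M_in by eventually_elim (simp add: assms(2))
  then show "sqi g" by (rule sqi_cong[OF sf _ gm])
  have "sqdist g f = (\<integral>x. 0 \<partial>M)" unfolding sqdist_def using assms(2)
    by (intro Bochner_Integration.integral_cong) auto
  then show "\<exists>h. Cc_lim h \<and> sqdist g h < e" if "0 < e" for e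
    using f that by (intro exI[of _ f]) auto
qed

text \<open>
  By regularity of Lebesgue measure \<open>A\<close> lies between a compact \<open>K\<close> and an open \<open>U\<close> that differ little
  in measure; a continuous function that drops from one on \<open>K\<close> to zero outside \<open>U\<close> differs from the
  indicator of \<open>A\<close> only on \<open>U - K\<close>.
\<close>

lemma Cc_lim_indicator:
  assumes A: "A \<in> sets borel" "A \<subseteq> {c<..<d}"
  shows "Cc_lim (\<lambda>x. indicator A x)"
  unfolding Cc_lim_def
proof (intro conjI allI impI)
  show sA: "sqi (\<lambda>x. indicator A x)"
    using A by (intro sqi_bounded[of _ 1] measurable_M) (auto simp: indicator_def)
  fix e :: real assume e: "0 < e"
  have AL: "A \<in> sets lebesgue" using A by auto
  obtain K where K: "closed K" "K \<subseteq> A" "A - K \<in> lmeasurable" "emeasure lebesgue (A - K) < ennreal (e / 2)"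
    using sets_lebesgue_inner_closed[OF AL, of "e / 2"] e by auto
  obtain U where U: "open U" "A \<subseteq> U" "U - A \<in> lmeasurable" "emeasure lebesgue (U - A) < ennreal (e / 2)"
    using sets_lebesgue_outer_open[OF AL, of "e / 2"] e by auto
  have small: "measure lebesgue B < t" if "emeasure lebesgue B < ennreal t" for B :: "real set" and t
    using that by (cases "emeasure lebesgue B") (auto simp: measure_def ennreal_less_iff)
  have "K \<subseteq> {c..d}" using K A by fastforce
  then have cK: "compact K" using K(1) by (meson bounded_closed_interval bounded_subset compact_eq_bounded_closed)
  show "\<exists>h. Cc h \<and> sqdist (\<lambda>x. indicator A x) h < e"
  proof (cases "K = {}")
    case True
    have "sqdist (\<lambda>x. indicator A x) (\<lambda>x. 0) = (\<integral>x. indicator A x \<partial>M)"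
      unfolding sqdist_def by (intro Bochner_Integration.integral_cong) (auto simp: indicator_def)
    also have "\<dots> = measure M (A \<inter> space M)"
      using finite_measure.emeasure_finite[OF finite_measure_M] by simp
    also have "\<dots> = measure lebesgue A" using A by (simp add: measure_restrict_space Int_absorb2)
    also have "\<dots> < e" using small[OF K(4)] True e by simp
    finally show ?thesis by (intro exI[of _ "\<lambda>_. 0"]) (auto simp: Cc_def)
  next
    case False
    have "K \<subseteq> U \<inter> {c<..<d}" using K U A by auto
    then obtain \<delta> where \<delta>: "0 < \<delta>" "{x. infdist x K \<le> \<delta>} \<subseteq> U \<inter> {c<..<d}"
      using compact_in_open_separated[OF False cK open_Int[OF U(1) open_greaterThanLessThan[of c d]]] by blast
    define h where "h = (\<lambda>x. complex_of_real (max 0 (1 - infdist x K / \<delta>)))"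
    have h: "Cc h"
      unfolding Cc_def
    proof (intro conjI exI[of _ "{x. infdist x K \<le> \<delta>}"])
      show "continuous_on UNIV h" unfolding h_def using \<delta> by (intro continuous_intros) auto
      show "compact {x. infdist x K \<le> \<delta>}" using compact_infdist_le[OF False cK \<delta>(1)] .
    qed (use \<delta> in \<open>auto simp: h_def field_simps\<close>)
    have sets: "A - K \<in> sets borel" "U - A \<in> sets borel" using A K U by auto
    have le: "(cmod (indicator A x - h x))\<^sup>2 \<le> indicator (A - K) x + indicator (U - A) x" for x
    proof -
      have h01: "0 \<le> max 0 (1 - infdist x K / \<delta>)" "max 0 (1 - infdist x K / \<delta>) \<le> 1"
        using \<delta> infdist_nonneg[of x K] by auto
      consider "x \<in> K" | "x \<in> A - K" | "x \<in> U - A" | "x \<notin> U" using K U by blast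
      then show ?thesis
      proof cases
        case 1
        then show ?thesis using K by (auto simp: h_def)
      next
        case 2
        have "cmod (1 - h x) = 1 - max 0 (1 - infdist x K / \<delta>)"
          using h01 unfolding h_def by (metis abs_of_nonneg diff_ge_0_iff_ge norm_of_real of_real_1 of_real_diff)
        then have "(cmod (1 - h x))\<^sup>2 \<le> 1" using h01 by (simp add: power_le_one)
        then show ?thesis using 2 by auto
      next
        case 3
        have "(cmod (h x))\<^sup>2 \<le> 1" using h01 by (simp add: h_def power_le_one)
        then show ?thesis using 3 by auto
      next
        case 4
        then have "\<not> infdist x K \<le> \<delta>" using \<delta> by auto
        then have "h x = 0" using \<delta> by (simp add: h_def field_simps)
        moreover have "x \<notin> A" using 4 U by auto
        ultimately show ?thesis by (simp add: indicator_def)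
      qed
    qed
    have meas: "measure M (B \<inter> space M) \<le> measure lebesgue B"
      if "B \<in> sets borel" "B \<in> lmeasurable" for B :: "real set"
    proof -
      have "measure M (B \<inter> space M) = measure lebesgue (B \<inter> {c<..<d})"
        using that by (simp add: measure_restrict_space)
      also have "\<dots> \<le> measure lebesgue B" using that by (intro measure_mono_fmeasurable) auto
      finally show ?thesis .
    qed
    have indi: "integrable M (indicator B :: real \<Rightarrow> real)" if "B \<in> sets borel" for B
      using that by (intro integrable_bounded[of _ 1] measurable_M) (auto simp: indicator_def)
    have "sqdist (\<lambda>x. indicator A x) h \<le> (\<integral>x. indicator (A - K) x + indicator (U - A) x \<partial>M)"
      unfolding sqdist_def
      by (intro integral_mono sq_integrable sqi_diff sA Cc_sqi[OF h] Bochner_Integration.integrable_add indi sets le)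
    also have "\<dots> = measure M ((A - K) \<inter> space M) + measure M ((U - A) \<inter> space M)"
      using sets by (subst Bochner_Integration.integral_add) (auto intro!: indi)
    also have "\<dots> < e"
      using meas[OF sets(1) K(3)] meas[OF sets(2) U(3)] small[OF K(4)] small[OF U(4)] by simp
    finally show ?thesis using h by blast
  qed
qed

text \<open>
  A square-integrable function is a pointwise limit of simple functions that are dominated by a
  multiple of it, and indicators are covered by \<open>Cc_lim_indicator\<close>.
\<close>

theorem Cc_dense:
  assumes f: "sqi f" shows "Cc_lim f"
proof -
  have "f \<in> borel_measurable M" using f by (simp add: sqi_def)
  from borel_measurable_implies_sequence_metric[OF this, of 0]
  obtain s where s: "\<And>i. simple_function M (s i)"
      "\<And>x. x \<in> space M \<Longrightarrow> (\<lambda>i. s i x) \<longlonglongrightarrow> f x"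
      "\<And>i x. x \<in> space M \<Longrightarrow> dist (s i x) 0 \<le> 2 * dist (f x) 0"
    by blast
  have sm: "s i \<in> borel_measurable M" for i using s(1) by (rule borel_measurable_simple_function)
  have simple: "Cc_lim (s i)" for i
  proof (rule Cc_lim_cong)
    have fin: "finite (s i ` space M)" using s(1) by (simp add: simple_function_def)
    have pre: "s i -` {y} \<inter> space M \<in> sets borel" for y
    proof -
      have "s i -` {y} \<inter> space M \<in> sets M" using s(1) sm by (intro measurable_sets[OF sm]) auto
      then show ?thesis by (auto simp: sets_restrict_space)
    qed
    have sum: "Cc_lim (\<lambda>x. \<Sum>y\<in>Y. y * indicator (s i -` {y} \<inter> space M) x)" if "finite Y" for Y
      using that
    proof induction
      case empty
      then show ?case using Cc_lim_scale[OF Cc_lim_indicator[of "{}"], of 0] by simp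
    next
      case (insert y Y)
      then show ?case
        using Cc_lim_add[OF Cc_lim_scale[OF Cc_lim_indicator[OF pre[of y]], of y] insert.IH]
        unfolding sum.insert[OF insert.hyps] by auto
    qed
    show "Cc_lim (\<lambda>x. \<Sum>y\<in>s i ` space M. y * indicator (s i -` {y} \<inter> space M) x)"
      using sum[OF fin] .
    fix x assume x: "x \<in> {c<..<d}"
    have "(\<Sum>y\<in>s i ` space M. y * indicator (s i -` {y} \<inter> space M) x)
        = (\<Sum>y\<in>s i ` space M. if y = s i x then y else 0)"
      using x by (intro sum.cong) auto
    also have "\<dots> = s i x" using fin x by (subst sum.delta) auto
    finally show "s i x = (\<Sum>y\<in>s i ` space M. y * indicator (s i -` {y} \<inter> space M) x)" ..
  qed
  have "(\<lambda>i. sqdist f (s i)) \<longlonglongrightarrow> (\<integral>x. 0 \<partial>M)"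
    unfolding sqdist_def
  proof (rule integral_dominated_convergence[where w = "\<lambda>x. 9 * (cmod (f x))\<^sup>2"])
    show "AE x in M. (\<lambda>i. (cmod (f x - s i x))\<^sup>2) \<longlonglongrightarrow> 0"
      using AE_M_in
    proof eventually_elim
      fix x assume "x \<in> {c<..<d}"
      then have "(\<lambda>i. s i x) \<longlonglongrightarrow> f x" using s by auto
      from tendsto_power[OF tendsto_norm[OF tendsto_diff[OF tendsto_const[of "f x"] this]], of 2]
      show "(\<lambda>i. (cmod (f x - s i x))\<^sup>2) \<longlonglongrightarrow> 0" by simp
    qed
    show "AE x in M. norm ((cmod (f x - s i x))\<^sup>2) \<le> 9 * (cmod (f x))\<^sup>2" for i
      using AE_M_in
    proof eventually_elim
      fix x assume "x \<in> {c<..<d}"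
      then have "cmod (s i x) \<le> 2 * cmod (f x)" using s(3)[of x i] by auto
      then have "cmod (f x - s i x) \<le> 3 * cmod (f x)" using norm_triangle_ineq4[of "f x" "s i x"] by linarith
      then have "(cmod (f x - s i x))\<^sup>2 \<le> (3 * cmod (f x))\<^sup>2" by (intro power_mono) auto
      then show "norm ((cmod (f x - s i x))\<^sup>2) \<le> 9 * (cmod (f x))\<^sup>2" by (simp add: power_mult_distrib)
    qed
  qed (use f sm in \<open>auto simp: sqi_def\<close>)
  then have lim: "(\<lambda>i. sqdist f (s i)) \<longlonglongrightarrow> 0" by simp
  show ?thesis
  proof (rule Cc_lim_closed[OF f])
    fix e :: real assume "0 < e"
    then have "\<forall>\<^sub>F i in sequentially. sqdist f (s i) < e" using order_tendstoD(2)[OF lim] by blast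
    then obtain i where "sqdist f (s i) < e" by (auto simp: eventually_sequentially)
    with simple show "\<exists>g. Cc_lim g \<and> sqdist f g < e" by blast
  qed
qed

text \<open>
  Approximating functions that satisfy every boundary condition at once: an element
  \<open>h\<close> of \<open>Cc\<close> divided by \<open>q = (x - c)\<^sup>2 (d - x)\<^sup>2\<close> is still continuous, so it is a uniform limit of
  polynomials \<open>P\<close> by the Weierstrass theorem, and \<open>q P\<close> is close to \<open>h\<close>.  Of the double zeros
  of \<open>q\<close>, the one at \<open>d\<close> also gives the vanishing derivative there.
\<close>

theorem polynomial_dense:
  assumes f: "sqi f" and e: "0 < e"
  obtains h h' where "polynomial_function h" "polynomial_function h'"
    "\<And>x. (h has_vector_derivative h' x) (at x)" "h c = 0" "h d = 0" "h' d = 0" "sqdist f h < e"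
proof -
  define q where "q = (\<lambda>x. (x - c)\<^sup>2 * (d - x)\<^sup>2)"
  obtain h where h: "Cc h" "sqdist f h < e / 4"
    using Cc_dense[OF f] e by (auto simp: Cc_lim_def dest!: spec[of _ "e / 4"])
  then obtain K where hc: "continuous_on UNIV h" and K: "compact K" "K \<subseteq> {c<..<d}" "\<And>x. x \<notin> K \<Longrightarrow> h x = 0"
    by (auto simp: Cc_def)
  have q0: "q x \<noteq> 0" if "x \<in> {c<..<d}" for x using that by (auto simp: q_def)
  have "continuous_on (- K \<union> {c<..<d}) (\<lambda>x. h x / of_real (q x))"
  proof (rule continuous_on_open_Un)
    show "continuous_on (- K) (\<lambda>x. h x / of_real (q x))"
      using K(3) by (subst continuous_on_cong[OF refl, of _ _ "\<lambda>_. 0"]) auto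
    show "continuous_on {c<..<d} (\<lambda>x. h x / of_real (q x))"
      by (intro continuous_intros continuous_on_subset[OF hc]) (use q0 in \<open>auto simp: q_def intro!: continuous_intros\<close>)
  qed (use K compact_imp_closed in \<open>auto simp: open_Compl\<close>)
  then have cont: "continuous_on {c..d} (\<lambda>x. h x / of_real (q x))"
    by (rule continuous_on_subset) (use K in auto)
  have qc: "continuous_on {c..d} q" unfolding q_def by (intro continuous_intros)
  then obtain Q where Q: "0 < Q" "\<And>x. x \<in> {c..d} \<Longrightarrow> \<bar>q x\<bar> \<le> Q"
    using continuous_bounded[of q] by auto
  define B where "B = Q\<^sup>2 * (d - c)"
  have B: "0 < B" using Q c_less_d by (simp add: B_def)
  \<comment> \<open>The uniform error \<open>e'\<close> costs at most \<open>B e'\<^sup>2\<close> in the mean square, and \<open>e'\<^sup>2 \<le> e'\<close>.\<close>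
  define e' where "e' = min 1 (e / (8 * B))"
  have e': "0 < e'" "e' \<le> 1" "B * e' < e / 4" using e B
    by (auto simp: e'_def min_def field_simps)
  obtain P where P: "polynomial_function P" "\<And>x. x \<in> {c..d} \<Longrightarrow> norm (h x / of_real (q x) - P x) < e'"
    using Stone_Weierstrass_polynomial_function[OF compact_Icc cont e'(1)] by blast
  have sP: "sqi (\<lambda>x. of_real (q x) * P x)"
    by (intro sqi_continuous continuous_on_mult continuous_on_of_real qc continuous_on_polymonial_function P)
  have "sqdist h (\<lambda>x. of_real (q x) * P x) \<le> (\<integral>x. Q\<^sup>2 * e' \<partial>M)"
    unfolding sqdist_def
  proof (rule integral_mono_AE)
    show "AE x in M. (cmod (h x - of_real (q x) * P x))\<^sup>2 \<le> Q\<^sup>2 * e'"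
      using AE_M_in
    proof eventually_elim
      fix x assume x: "x \<in> {c<..<d}"
      then have "h x - of_real (q x) * P x = of_real (q x) * (h x / of_real (q x) - P x)"
        using q0[OF x] by (simp add: field_simps)
      then have "cmod (h x - of_real (q x) * P x) = \<bar>q x\<bar> * cmod (h x / of_real (q x) - P x)"
        by (simp add: norm_mult)
      also have "\<dots> \<le> Q * e'" using x Q P(2)[of x] by (intro mult_mono) auto
      finally have "(cmod (h x - of_real (q x) * P x))\<^sup>2 \<le> (Q * e')\<^sup>2" by (intro power_mono) auto
      also have "\<dots> = Q\<^sup>2 * (e' * e')" by (simp add: power2_eq_square)
      also have "\<dots> \<le> Q\<^sup>2 * e'" using e' by (intro mult_left_mono mult_left_le) auto
      finally show "(cmod (h x - of_real (q x) * P x))\<^sup>2 \<le> Q\<^sup>2 * e'" .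
    qed
    show "integrable M (\<lambda>x. Q\<^sup>2 * e')" using continuous_integrable[of "\<lambda>_. Q\<^sup>2 * e'"] by simp
  qed (intro sq_integrable sqi_diff sP Cc_sqi[OF h(1)])
  also have "\<dots> = B * e'" using measure_M by (simp add: B_def)
  finally have "sqdist h (\<lambda>x. of_real (q x) * P x) < e / 4" using e' by simp
  then have "sqdist f (\<lambda>x. of_real (q x) * P x) < e"
    using sqdist_triangle[OF f Cc_sqi[OF h(1)] sP] h(2) by simp
  moreover define l where "l = (\<lambda>x. complex_of_real ((x - c)\<^sup>2 * (d - x)) * P x)"
  have qP: "(\<lambda>x. of_real (q x) * P x) = (\<lambda>x. of_real (d - x) * l x)"
    by (simp add: l_def q_def fun_eq_iff power2_eq_square)
  have lin: "real_polynomial_function (\<lambda>x::real. x - c)" "real_polynomial_function (\<lambda>x::real. d - x)"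
    by (intro real_polynomial_function_diff real_polynomial_function.intros(2) real_polynomial_function.intros(1) bounded_linear_ident)+
  have "real_polynomial_function (\<lambda>x::real. (x - c)\<^sup>2 * (d - x))"
    by (rule real_polynomial_function.intros(4) real_polynomial_function_power lin)+
  then have "polynomial_function (\<lambda>x::real. ((x - c)\<^sup>2 * (d - x)) *\<^sub>R P x)"
    using P(1) by (auto intro!: polynomial_function_mult simp: real_polynomial_function_eq)
  then have l: "polynomial_function l" by (simp add: l_def scaleR_conv_of_real)
  then have "polynomial_function (\<lambda>x. (d - x) *\<^sub>R l x)"
    using lin by (auto intro!: polynomial_function_mult simp: real_polynomial_function_eq)
  then have h: "polynomial_function (\<lambda>x. of_real (d - x) * l x)" by (simp add: scaleR_conv_of_real)
  obtain h' where h': "polynomial_function h'" "\<And>x. ((\<lambda>x. of_real (d - x) * l x) has_vector_derivative h' x) (at x)"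
    using has_vector_derivative_polynomial_function[OF h] by blast
  obtain l' where l': "\<And>x. (l has_vector_derivative l' x) (at x)"
    using has_vector_derivative_polynomial_function[OF l] by blast
  have "((\<lambda>x. complex_of_real (d - x)) has_vector_derivative complex_of_real (-1)) (at d)"
    by (intro has_vector_derivative_of_real) (auto intro!: derivative_eq_intros)
  from has_vector_derivative_mult[OF this l'[of d]]
  have "((\<lambda>x. of_real (d - x) * l x) has_vector_derivative 0) (at d)" by (simp add: l_def)
  then have "h' d = 0" using h'(2)[of d] vector_derivative_unique_at by metis
  ultimately show ?thesis using that[OF h h'] by (simp add: qP l_def)
qed

text \<open>
  The distance of \<open>cnj g\<close> to a function \<open>h\<close> with \<open>\<integral> g h = 0\<close> is at least the norm of \<open>g\<close>
  by Pythagoras, so \<open>g\<close> vanishes if \<open>cnj g\<close> can be approximated by such functions.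
\<close>

lemma orthogonal_dense_zero:
  assumes g: "sqi g" and orth: "\<And>e. 0 < e \<Longrightarrow> \<exists>h. sqi h \<and> (\<integral>x. g x * h x \<partial>M) = 0 \<and> sqdist (\<lambda>x. cnj (g x)) h < e"
  shows "AE x in M. g x = 0"
proof -
  have "(\<integral>x. (cmod (g x))\<^sup>2 \<partial>M) \<le> e" if e: "0 < e" for e
  proof -
    obtain h where h: "sqi h" "(\<integral>x. g x * h x \<partial>M) = 0" "sqdist (\<lambda>x. cnj (g x)) h < e" using orth[OF e] by blast
    have gh: "integrable M (\<lambda>x. g x * h x)" using g h by (intro sqi_mult_integrable)
    have "sqdist (\<lambda>x. cnj (g x)) h = (\<integral>x. (cmod (g x))\<^sup>2 + (cmod (h x))\<^sup>2 - 2 * Re (g x * h x) \<partial>M)"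
      unfolding sqdist_def
    proof (rule Bochner_Integration.integral_cong[OF refl])
      fix x
      show "(cmod (cnj (g x) - h x))\<^sup>2 = (cmod (g x))\<^sup>2 + (cmod (h x))\<^sup>2 - 2 * Re (g x * h x)"
        unfolding cmod_power2 by (simp add: power2_eq_square algebra_simps)
    qed
    also have "\<dots> = (\<integral>x. (cmod (g x))\<^sup>2 \<partial>M) + (\<integral>x. (cmod (h x))\<^sup>2 \<partial>M) - 2 * Re (\<integral>x. g x * h x \<partial>M)"
      using sq_integrable[OF g] sq_integrable[OF h(1)] gh by (simp add: integral_Re[OF gh] del: times_complex.sel)
    finally have "(\<integral>x. (cmod (g x))\<^sup>2 \<partial>M) + (\<integral>x. (cmod (h x))\<^sup>2 \<partial>M) < e" using h by simp
    moreover have "0 \<le> (\<integral>x. (cmod (h x))\<^sup>2 \<partial>M)" by simp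
    ultimately show ?thesis by linarith
  qed
  then have "(\<integral>x. (cmod (g x))\<^sup>2 \<partial>M) \<le> 0" by (meson dense_ge)
  moreover have "0 \<le> (\<integral>x. (cmod (g x))\<^sup>2 \<partial>M)" by simp
  ultimately have "(\<integral>x. (cmod (g x))\<^sup>2 \<partial>M) = 0" by linarith
  then have "AE x in M. (cmod (g x))\<^sup>2 = 0"
    using integral_nonneg_eq_0_iff_AE[OF sq_integrable[OF g]] by simp
  then show ?thesis by simp
qed

text \<open>
  The difference \<open>w\<close> of two derivatives of \<open>U\<close> is a derivative of the zero function, so by the
  product rule \<open>\<integral> w h = 0\<close> for every absolutely continuous \<open>h\<close> that vanishes at
  both ends, in particular for a dense set of polynomials.
\<close>

lemma AC_unique:
  assumes u: "AC U u" "sqi u" and v: "AC U v" "sqi v"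
  shows "AE x in M. u x = v x"
proof -
  define w where "w = (\<lambda>x. u x - v x)"
  have w: "sqi w" using u v by (auto simp: w_def intro: sqi_diff)
  have ACw: "AC (\<lambda>x. 0) w" using AC_diff[OF u(1) v(1)] by (simp add: w_def)
  have "AE x in M. w x = 0"
  proof (rule orthogonal_dense_zero[OF w])
    fix e :: real assume "0 < e"
    then obtain h h' where h: "polynomial_function h" "polynomial_function h'"
        "\<And>x. (h has_vector_derivative h' x) (at x)" "sqdist (\<lambda>x. cnj (w x)) h < e"
      using polynomial_dense[OF sqi_cnj[OF w]] by metis
    have "AC h h'"
      using h by (intro AC_deriv continuous_on_polymonial_function) (auto intro: has_vector_derivative_at_within)
    from AC_right[OF AC_mult[OF ACw this]] have "(\<integral>x. w x * h x \<partial>M) = 0" by simp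
    moreover have "sqi h" using h by (intro sqi_continuous continuous_on_polymonial_function)
    ultimately show "\<exists>h. sqi h \<and> (\<integral>x. w x * h x \<partial>M) = 0 \<and> sqdist (\<lambda>x. cnj (w x)) h < e"
      using h(4) by blast
  qed
  then show ?thesis by (simp add: w_def)
qed

text \<open>
  The set where \<open>W\<close> does not vanish is open, and a nonempty open set is not null.  This makes the
  continuous representative of a class unique.
\<close>

lemma AE_continuous_zero:
  fixes W :: "real \<Rightarrow> complex"
  assumes W: "continuous_on {c..d} W" and ae: "AE x in M. W x = 0" and x: "x \<in> {c..d}"
  shows "W x = 0"
proof -
  define S where "S = {c<..<d} \<inter> W -` (- {0})"
  have "open S" unfolding S_def
    by (intro continuous_open_preimage continuous_on_subset[OF W]) auto
  moreover have "AE x in lborel. x \<notin> S"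
    using ae unfolding AE_M by eventually_elim (auto simp: S_def)
  then have "S \<in> null_sets lborel" using \<open>open S\<close> by (simp add: AE_iff_null_sets)
  then have "negligible S"
    using \<open>open S\<close> by (auto simp: negligible_iff_null_sets null_sets_def)
  ultimately have "S = {}" using open_not_negligible by blast
  then have zero: "W y = 0" if "y \<in> {c<..<d}" for y
    using that unfolding S_def by blast
  have cl: "closure {c<..<d} = {c..d}" using c_less_d by simp
  show ?thesis
    by (rule continuous_constant_on_closure[where S = "{c<..<d}", OF _ zero]) (simp_all only: cl W x)
qed

lemma LBINT_M:
  fixes f :: "real \<Rightarrow> 'b::{banach, second_countable_topology}"
  shows "(LBINT x:{c<..<d}. f x) = (\<integral>x. f x \<partial>M)"
  unfolding set_lebesgue_integral_def by (subst integral_restrict_space) auto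

lemma set_integrable_M:
  fixes f :: "real \<Rightarrow> 'b::{banach, second_countable_topology}"
  shows "set_integrable lborel {c<..<d} f \<longleftrightarrow> integrable M f"
  unfolding set_integrable_def by (subst integrable_restrict_space) auto

section \<open>Weak derivatives of functions\<close>

text \<open>
  An antiderivative of \<open>k\<close> is constant to the left and to the right of the support of \<open>k\<close>; the
  two constants differ by the integral of \<open>k\<close>, which is zero.
\<close>

lemma test_function_antiderivative:
  fixes k :: "real \<Rightarrow> real"
  assumes k: "continuous_on UNIV k" and K: "compact K" "K \<subseteq> {c<..<d}" "\<And>x. x \<notin> K \<Longrightarrow> k x = 0"
    and int: "(\<integral>x. k x \<partial>M) = 0"
  shows "\<exists>\<phi>. test_function c d \<phi> k"
proof -
  obtain \<alpha> \<beta> where ab: "c < \<alpha>" "\<beta> < d" "K \<subseteq> {\<alpha>..\<beta>}"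
  proof (cases "K = {}")
    case True
    then show ?thesis using that[of "(c + d) / 2" "(c + d) / 2"] c_less_d by (auto simp: field_simps)
  next
    case False
    then obtain s t where "s \<in> K" "\<forall>x\<in>K. s \<le> x" "t \<in> K" "\<forall>x\<in>K. x \<le> t"
      using compact_attains_inf[OF K(1)] compact_attains_sup[OF K(1)] by metis
    moreover from this have "c < s" "t < d" using K(2) by auto
    ultimately show ?thesis by (intro that[of s t]) auto
  qed
  have "\<exists>F. \<forall>x::real. -\<infinity> < ereal x \<longrightarrow> ereal x < \<infinity> \<longrightarrow> (F has_vector_derivative k x) (at x)"
    using k by (intro einterval_antiderivative) (auto simp: continuous_on_eq_continuous_at)
  then obtain F where F: "\<And>x. (F has_vector_derivative k x) (at x)" by auto
  have Fr: "(F has_real_derivative k x) (at x)" for x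
    using F[of x] by (simp add: has_real_derivative_iff_has_vector_derivative)
  define \<phi> where "\<phi> x = F x - F c" for x
  have der: "(\<phi> has_real_derivative k x) (at x)" for x
    unfolding \<phi>_def using DERIV_diff[OF Fr[of x] DERIV_const[of "F c"]] by simp
  have left: "\<phi> x = 0" if "x < \<alpha>" for x
  proof -
    have "\<exists>C. \<forall>x\<in>{..<\<alpha>}. \<phi> x = C"
    proof (rule has_field_derivative_zero_constant)
      fix y assume "y \<in> {..<\<alpha>}"
      then have "k y = 0" using K(3) ab(3) by (meson atLeastAtMost_iff greaterThan_iff lessThan_iff not_less subsetD)
      then show "(\<phi> has_field_derivative 0) (at y within {..<\<alpha>})"
        using der[of y] by (simp add: has_field_derivative_at_within)
    qed simp
    then obtain C where C: "\<And>y. y \<in> {..<\<alpha>} \<Longrightarrow> \<phi> y = C" by blast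
    have "\<phi> c = 0" using \<phi>_def by simp
    then show ?thesis using C[of x] C[of c] that ab(1) by simp
  qed
  have "\<phi> d = 0"
  proof -
    have "AC (\<lambda>x. of_real (\<phi> x)) (\<lambda>x. of_real (k x))"
    proof (rule AC_deriv)
      show "((\<lambda>x. complex_of_real (\<phi> x)) has_vector_derivative complex_of_real (k x)) (at x within {c..d})" for x
        by (rule has_vector_derivative_at_within[OF has_vector_derivative_of_real]) (rule der)
    qed (intro continuous_intros continuous_on_subset[OF k], auto)
    from AC_right[OF this] int show ?thesis by (simp add: \<phi>_def)
  qed
  have right: "\<phi> x = 0" if "\<beta> < x" for x
  proof -
    have "\<exists>C. \<forall>x\<in>{\<beta><..}. \<phi> x = C"
    proof (rule has_field_derivative_zero_constant)
      fix y assume "y \<in> {\<beta><..}"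
      then have "k y = 0" using K(3) ab(3) by (meson atLeastAtMost_iff greaterThan_iff lessThan_iff not_less subsetD)
      then show "(\<phi> has_field_derivative 0) (at y within {\<beta><..})"
        using der[of y] by (simp add: has_field_derivative_at_within)
    qed simp
    then obtain C where C: "\<And>y. y \<in> {\<beta><..} \<Longrightarrow> \<phi> y = C" by blast
    have "\<phi> d = 0" using \<open>\<phi> d = 0\<close> by simp
    then show ?thesis using C[of x] C[of d] that ab(2) by simp
  qed
  have "test_function c d \<phi> k"
    unfolding test_function_def
    using der k left right ab by (auto intro!: exI[of _ "{\<alpha>..\<beta>}"])
  then show ?thesis by blast
qed

text \<open>
  Functions in \<open>Cc\<close> with mean zero are derivatives of test functions, so \<open>g\<close> is orthogonal to all of
  them.  Subtracting from an arbitrary \<open>h\<close> in \<open>Cc\<close> the multiple of a fixed \<open>\<eta>\<close> that has the same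
  mean shows that \<open>g - C\<close> is orthogonal to \<open>h\<close>, where \<open>C\<close> is the average of \<open>g\<close> with respect to
  \<open>\<eta>\<close>.
\<close>

lemma du_Bois_Reymond:
  assumes g: "sqi g" and test: "\<And>\<phi> \<phi>'. test_function c d \<phi> \<phi>' \<Longrightarrow> (\<integral>x. g x * of_real (\<phi>' x) \<partial>M) = 0"
  shows "\<exists>C. AE x in M. g x = C"
proof -
  have mean0: "(\<integral>x. g x * k x \<partial>M) = 0" if k: "Cc k" and int: "(\<integral>x. k x \<partial>M) = 0" for k
  proof -
    obtain K where kc: "continuous_on UNIV k" and K: "compact K" "K \<subseteq> {c<..<d}" "\<And>x. x \<notin> K \<Longrightarrow> k x = 0"
      using k by (auto simp: Cc_def)
    have ki: "integrable M k" using sqi_integrable[OF Cc_sqi[OF k]] .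
    have "(\<integral>x. Re (k x) \<partial>M) = 0" "(\<integral>x. Im (k x) \<partial>M) = 0"
      using ki int by simp_all
    then obtain \<phi> \<psi> where "test_function c d \<phi> (\<lambda>x. Re (k x))" "test_function c d \<psi> (\<lambda>x. Im (k x))"
      using test_function_antiderivative[OF _ K(1,2), of "\<lambda>x. Re (k x)"]
        test_function_antiderivative[OF _ K(1,2), of "\<lambda>x. Im (k x)"] kc K(3)
      by (auto intro: continuous_intros)
    then have z: "(\<integral>x. g x * of_real (Re (k x)) \<partial>M) = 0" "(\<integral>x. g x * of_real (Im (k x)) \<partial>M) = 0"
      using test by auto
    have sR: "sqi (\<lambda>x. of_real (Re (k x)))" and sI: "sqi (\<lambda>x. \<i> * of_real (Im (k x)))"
      by (intro sqi_continuous continuous_intros continuous_on_subset[OF kc]; simp)+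
    have "(\<integral>x. g x * k x \<partial>M) = (\<integral>x. g x * of_real (Re (k x)) + g x * (\<i> * of_real (Im (k x))) \<partial>M)"
      by (intro Bochner_Integration.integral_cong refl) (subst complex_eq, simp only: distrib_left)
    also have "\<dots> = (\<integral>x. g x * of_real (Re (k x)) \<partial>M) + (\<integral>x. g x * (\<i> * of_real (Im (k x))) \<partial>M)"
      by (intro Bochner_Integration.integral_add sqi_mult_integrable g sR sI)
    also have "(\<integral>x. g x * (\<i> * of_real (Im (k x))) \<partial>M) = \<i> * (\<integral>x. g x * of_real (Im (k x)) \<partial>M)"
      by (simp add: mult.left_commute)
    finally show ?thesis using z by simp
  qed
  \<comment> \<open>If every function in \<open>Cc\<close> had mean zero, the constant \<open>1\<close> would be orthogonal to a dense set.\<close>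
  have "\<exists>\<eta>. Cc \<eta> \<and> (\<integral>x. \<eta> x \<partial>M) \<noteq> 0"
  proof (rule ccontr)
    assume "\<not> ?thesis"
    then have "AE x in M. (1::complex) = 0"
      using Cc_dense[of "\<lambda>_. cnj 1"] sqi_continuous[of "\<lambda>_. 1"] Cc_sqi
      by (intro orthogonal_dense_zero) (auto simp: Cc_lim_def, blast)
    then have "AE x in M. False" by simp
    then have "emeasure M (space M) = 0" by (simp add: eventually_False ae_filter_eq_bot_iff)
    then show False using c_less_d by (simp add: emeasure_restrict_space)
  qed
  then obtain \<eta> where eta: "Cc \<eta>" "(\<integral>x. \<eta> x \<partial>M) \<noteq> 0" by blast
  define C where "C = (\<integral>x. g x * \<eta> x \<partial>M) / (\<integral>x. \<eta> x \<partial>M)"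
  have gC: "sqi (\<lambda>x. g x - C)" using g by (intro sqi_diff sqi_continuous[of "\<lambda>_. C"]) auto
  have orth: "(\<integral>x. (g x - C) * h x \<partial>M) = 0" if h: "Cc h" for h
  proof -
    define t where "t = (\<integral>x. h x \<partial>M) / (\<integral>x. \<eta> x \<partial>M)"
    have i: "integrable M h" "integrable M \<eta>" using h eta by (auto intro: sqi_integrable Cc_sqi)
    have gi: "integrable M (\<lambda>x. g x * h x)" "integrable M (\<lambda>x. g x * \<eta> x)"
      using h eta g by (auto intro: sqi_mult_integrable Cc_sqi)
    have "Cc (\<lambda>x. h x + (- t) * \<eta> x)"
      by (rule Cc_add[OF h Cc_map[OF eta(1)]]) (auto intro: continuous_intros)
    moreover have "(\<integral>x. h x + (- t) * \<eta> x \<partial>M) = 0"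
      using i eta by (simp add: t_def)
    ultimately have "(\<integral>x. g x * (h x + (- t) * \<eta> x) \<partial>M) = 0" by (rule mean0)
    also have "(\<lambda>x. g x * (h x + (- t) * \<eta> x)) = (\<lambda>x. g x * h x - t * (g x * \<eta> x))"
      by (simp add: fun_eq_iff algebra_simps)
    finally have "(\<integral>x. g x * h x \<partial>M) = t * (\<integral>x. g x * \<eta> x \<partial>M)"
      using gi by simp
    then have "(\<integral>x. g x * h x \<partial>M) = C * (\<integral>x. h x \<partial>M)" by (simp add: C_def t_def)
    then show ?thesis using gi i by (simp add: algebra_simps)
  qed
  have "AE x in M. g x - C = 0"
  proof (rule orthogonal_dense_zero[OF gC])
    fix e :: real assume "0 < e"
    then obtain h where "Cc h" "sqdist (\<lambda>x. cnj (g x - C)) h < e"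
      using Cc_dense[OF sqi_cnj[OF gC]] by (auto simp: Cc_lim_def)
    then show "\<exists>h. sqi h \<and> (\<integral>x. (g x - C) * h x \<partial>M) = 0 \<and> sqdist (\<lambda>x. cnj (g x - C)) h < e"
      using orth Cc_sqi by blast
  qed
  then show ?thesis by auto
qed

definition wderiv :: "(real \<Rightarrow> complex) \<Rightarrow> (real \<Rightarrow> complex) \<Rightarrow> bool"
  where "wderiv u v \<longleftrightarrow> (\<forall>\<phi> \<phi>'. test_function c d \<phi> \<phi>' \<longrightarrow>
    (\<integral>x. u x * of_real (\<phi>' x) \<partial>M) = - (\<integral>x. v x * of_real (\<phi> x) \<partial>M))"

lemma AC_imp_wderiv:
  assumes U: "AC U u" shows "wderiv U u"
  unfolding wderiv_def
proof (intro allI impI)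
  fix \<phi> \<phi>' assume t: "test_function c d \<phi> \<phi>'"
  then obtain K where K: "K \<subseteq> {c<..<d}" "\<And>x. x \<notin> K \<Longrightarrow> \<phi> x = 0"
    and der: "\<And>x. (\<phi> has_real_derivative \<phi>' x) (at x)" and cont: "continuous_on UNIV \<phi>'"
    by (auto simp: test_function_def)
  have A: "AC (\<lambda>x. of_real (\<phi> x)) (\<lambda>x. of_real (\<phi>' x))"
  proof (rule AC_deriv)
    show "((\<lambda>x. complex_of_real (\<phi> x)) has_vector_derivative complex_of_real (\<phi>' x)) (at x within {c..d})" for x
      by (rule has_vector_derivative_at_within[OF has_vector_derivative_of_real]) (rule der)
  qed (intro continuous_intros continuous_on_subset[OF cont], auto)
  have "\<phi> c = 0" "\<phi> d = 0" using K by (metis greaterThanLessThan_iff less_irrefl subsetD)+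
  with AC_right[OF AC_mult[OF U A]]
  have "(\<integral>x. u x * of_real (\<phi> x) + U x * of_real (\<phi>' x) \<partial>M) = 0" by simp
  moreover have "integrable M (\<lambda>x. u x * of_real (\<phi> x))" "integrable M (\<lambda>x. U x * of_real (\<phi>' x))"
    by (intro integrable_mult_continuous AC_integrable[OF U] AC_integrable[OF A] AC_continuous[OF U] AC_continuous[OF A])+
  ultimately show "(\<integral>x. U x * of_real (\<phi>' x) \<partial>M) = - (\<integral>x. u x * of_real (\<phi> x) \<partial>M)"
    by (simp add: eq_neg_iff_add_eq_0 add.commute)
qed

text \<open>
  The indefinite integral \<open>V\<close> of the weak derivative \<open>v\<close> has the same weak derivative as \<open>u\<close>, so
  \<open>u - V\<close> is constant.
\<close>

lemma wderiv_imp_AC: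
  assumes u: "sqi u" and v: "sqi v" and w: "wderiv u v"
  shows "\<exists>U. AC U v \<and> (AE x in M. u x = U x)"
proof -
  have vi: "integrable M v" using sqi_integrable[OF v] .
  define V where "V = prim v"
  have V: "AC V v" using AC_prim[OF vi, of 0] by (simp add: V_def)
  have sV: "sqi V" using sqi_continuous[OF AC_continuous[OF V]] .
  have "\<exists>C. AE x in M. u x - V x = C"
  proof (rule du_Bois_Reymond[OF sqi_diff[OF u sV]])
    fix \<phi> \<phi>' assume t: "test_function c d \<phi> \<phi>'"
    then have "continuous_on {c..d} \<phi>'" by (auto simp: test_function_def intro: continuous_on_subset)
    then have s: "sqi (\<lambda>x. of_real (\<phi>' x))" by (intro sqi_continuous continuous_intros)
    have "(\<integral>x. u x * of_real (\<phi>' x) \<partial>M) = (\<integral>x. V x * of_real (\<phi>' x) \<partial>M)"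
      using w AC_imp_wderiv[OF V] t by (simp add: wderiv_def)
    then show "(\<integral>x. (u x - V x) * of_real (\<phi>' x) \<partial>M) = 0"
      using sqi_mult_integrable[OF u s] sqi_mult_integrable[OF sV s] by (simp add: algebra_simps)
  qed
  then obtain C where C: "AE x in M. u x - V x = C" by blast
  have "AC (\<lambda>x. C + V x) v" using AC_prim[OF vi, of C] by (simp add: V_def)
  moreover have "AE x in M. u x = C + V x" using C by eventually_elim (auto simp: algebra_simps)
  ultimately show ?thesis by blast
qed

section \<open>Classes of functions on the interval\<close>

text \<open>
  Every class that occurs below is represented as \<open>cls f\<close>; the values of \<open>f\<close> outside the
  interval do not matter, and on the interval \<open>f\<close> matters up to a null set (\<open>cls_eq_iff\<close>).
\<close>

definition cls :: "(real \<Rightarrow> complex) \<Rightarrow> aefun"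
  where "cls f = abs_aefun (\<lambda>x. if x \<in> {c<..<d} then f x else 0)"

lemma restr_measurable: "f \<in> borel_measurable M \<longleftrightarrow> (\<lambda>x. if x \<in> {c<..<d} then f x else (0::complex)) \<in> borel_measurable lborel"
proof -
  have "(\<lambda>x. if x \<in> {c<..<d} then f x else 0) = (\<lambda>x. indicator {c<..<d} x *\<^sub>R f x)"
    by (auto simp: fun_eq_iff indicator_def)
  then show ?thesis by (simp add: borel_measurable_restrict_space_iff)
qed

lemma rep_measurable: "rep_aefun u \<in> borel_measurable lborel"
  using Quotient3_rep_reflp[OF Quotient3_aefun, of u] by simp

lemma rep_measurable_M: "rep_aefun u \<in> borel_measurable M"
  using rep_measurable[of u] by (intro measurable_restrict_space1)

lemma rep_cls':
  assumes "f \<in> borel_measurable M"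
  shows "AE x in lborel. rep_aefun (cls f) x = (if x \<in> {c<..<d} then f x else 0)"
  using rep_abs_rsp_left[OF Quotient3_aefun, of "\<lambda>x. if x \<in> {c<..<d} then f x else 0" "\<lambda>x. if x \<in> {c<..<d} then f x else 0"] assms
  unfolding restr_measurable cls_def by simp

lemma rep_cls: "f \<in> borel_measurable M \<Longrightarrow> AE x in M. rep_aefun (cls f) x = f x"
  unfolding AE_M using rep_cls'[of f] by (auto elim!: eventually_mono)

lemma cls_cong:
  assumes "f \<in> borel_measurable M" "g \<in> borel_measurable M" "AE x in M. f x = g x" shows "cls f = cls g"
  unfolding cls_def
proof (rule Quotient3_rel_abs[OF Quotient3_aefun], intro conjI)
  show "AE x in lborel. (if x \<in> {c<..<d} then f x else 0) = (if x \<in> {c<..<d} then g x else 0)"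
    using assms(3) unfolding AE_M by (auto elim!: eventually_mono)
qed (use assms in \<open>simp_all add: restr_measurable\<close>)

lemma cls_eqD: "cls f = cls g \<Longrightarrow> f \<in> borel_measurable M \<Longrightarrow> g \<in> borel_measurable M \<Longrightarrow> AE x in M. f x = g x"
  using rep_cls[of f] rep_cls[of g] by (auto elim: AE_mp)

lemma cls_eq_iff: "f \<in> borel_measurable M \<Longrightarrow> g \<in> borel_measurable M \<Longrightarrow> cls f = cls g \<longleftrightarrow> (AE x in M. f x = g x)"
  using cls_cong cls_eqD by blast

lemma aefun_eqI:
  assumes "AE x in lborel. rep_aefun u x = rep_aefun v x" shows "u = v"
proof -
  have "abs_aefun (rep_aefun u) = abs_aefun (rep_aefun v)"
    using assms rep_measurable by (intro Quotient3_rel_abs[OF Quotient3_aefun]) auto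
  then show ?thesis by (simp add: Quotient3_abs_rep[OF Quotient3_aefun])
qed

lemma cls_rep:
  assumes "AE x in lborel. x \<notin> {c<..<d} \<longrightarrow> rep_aefun u x = 0" shows "cls (rep_aefun u) = u"
  using rep_cls'[OF rep_measurable_M[of u]] assms by (intro aefun_eqI) (auto elim: AE_mp)

lemma rep_plus: "AE x in lborel. rep_aefun (u + v) x = rep_aefun u x + rep_aefun v x"
  using rep_abs_rsp_left[OF Quotient3_aefun, of "\<lambda>x. rep_aefun u x + rep_aefun v x" "\<lambda>x. rep_aefun u x + rep_aefun v x"]
    rep_measurable by (simp add: plus_aefun_def)

lemma rep_minus: "AE x in lborel. rep_aefun (u - v) x = rep_aefun u x - rep_aefun v x"
  using rep_abs_rsp_left[OF Quotient3_aefun, of "\<lambda>x. rep_aefun u x - rep_aefun v x" "\<lambda>x. rep_aefun u x - rep_aefun v x"]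
    rep_measurable by (simp add: minus_aefun_def)

lemma rep_scale: "AE x in lborel. rep_aefun (a *\<^sub>C u) x = a * rep_aefun u x"
  using rep_abs_rsp_left[OF Quotient3_aefun, of "\<lambda>x. a * rep_aefun u x" "\<lambda>x. a * rep_aefun u x"]
    rep_measurable by (simp add: scaleC_aefun_def)

lemma cls_add:
  assumes "f \<in> borel_measurable M" "g \<in> borel_measurable M"
  shows "cls f + cls g = cls (\<lambda>x. f x + g x)"
proof (rule aefun_eqI)
  have "(\<lambda>x. f x + g x) \<in> borel_measurable M" using assms by measurable
  from rep_cls'[OF this] rep_cls'[OF assms(1)] rep_cls'[OF assms(2)] rep_plus[of "cls f" "cls g"]
  show "AE x in lborel. rep_aefun (cls f + cls g) x = rep_aefun (cls (\<lambda>x. f x + g x)) x"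
    by eventually_elim auto
qed

lemma cls_diff:
  assumes "f \<in> borel_measurable M" "g \<in> borel_measurable M"
  shows "cls f - cls g = cls (\<lambda>x. f x - g x)"
proof (rule aefun_eqI)
  have "(\<lambda>x. f x - g x) \<in> borel_measurable M" using assms by measurable
  from rep_cls'[OF this] rep_cls'[OF assms(1)] rep_cls'[OF assms(2)] rep_minus[of "cls f" "cls g"]
  show "AE x in lborel. rep_aefun (cls f - cls g) x = rep_aefun (cls (\<lambda>x. f x - g x)) x"
    by eventually_elim auto
qed

lemma cls_scale:
  assumes "f \<in> borel_measurable M" shows "a *\<^sub>C cls f = cls (\<lambda>x. a * f x)"
proof (rule aefun_eqI)
  have "(\<lambda>x. a * f x) \<in> borel_measurable M" using assms by measurable
  from rep_cls'[OF this] rep_cls'[OF assms(1)] rep_scale[of a "cls f"]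
  show "AE x in lborel. rep_aefun (a *\<^sub>C cls f) x = rep_aefun (cls (\<lambda>x. a * f x)) x"
    by eventually_elim auto
qed

lemma cls_zero: "cls (\<lambda>x. 0) = 0"
  by (simp add: cls_def zero_aefun_def)

lemma cls_mult_on:
  assumes "f \<in> borel_measurable M" "g \<in> borel_measurable M"
  shows "mult_on {c<..<d} g (cls f) = cls (\<lambda>x. of_real (g x) * f x)"
proof -
  have "mult_on {c<..<d} g (cls f) = cls (\<lambda>x. of_real (g x) * rep_aefun (cls f) x)"
    by (simp add: mult_on_def cls_def)
  also have "\<dots> = cls (\<lambda>x. of_real (g x) * f x)"
    using rep_cls[OF assms(1)] assms rep_measurable_M by (intro cls_cong) auto
  finally show ?thesis .
qed

definition sq_cls :: "aefun set"
  where "sq_cls = {cls f | f. sqi f}"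

text \<open>
  A continuous positive weight on a closed interval is bounded above and bounded away from
  zero, so all the weighted spaces have the same elements.
\<close>

lemma L2_vecs:
  assumes g: "continuous_on {c..d} g" "\<And>x. x \<in> {c..d} \<Longrightarrow> 0 < g x"
  shows "vecs (L2 g {c<..<d}) = sq_cls"
proof -
  have gm: "g \<in> borel_measurable M" using g(1) by (rule continuous_measurable)
  obtain B where B: "0 < B" "\<And>x. x \<in> {c..d} \<Longrightarrow> norm (g x) \<le> B" using continuous_bounded[OF g(1)] by metis
  obtain m where m: "0 < m" "\<And>x. x \<in> {c..d} \<Longrightarrow> m \<le> g x"
    using continuous_attains_inf[OF compact_Icc _ g(1)] c_less_d g(2) by (metis atLeastatMost_empty_iff2 less_imp_le not_le)
  have eq: "integrable M (\<lambda>x. g x * (cmod (f x))\<^sup>2) \<longleftrightarrow> sqi f" if f: "f \<in> borel_measurable M" for f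
  proof
    assume i: "integrable M (\<lambda>x. g x * (cmod (f x))\<^sup>2)"
    show "sqi f"
    proof (rule sqi_dominated[OF f])
      show "integrable M (\<lambda>x. (1 / m) * (g x * (cmod (f x))\<^sup>2))" using i by (rule integrable_mult_right)
      show "AE x in M. (cmod (f x))\<^sup>2 \<le> (1 / m) * (g x * (cmod (f x))\<^sup>2)"
        using AE_M_in
      proof eventually_elim
        fix x assume "x \<in> {c<..<d}"
        then have "m * (cmod (f x))\<^sup>2 \<le> g x * (cmod (f x))\<^sup>2" using m by (intro mult_right_mono) auto
        then show "(cmod (f x))\<^sup>2 \<le> (1 / m) * (g x * (cmod (f x))\<^sup>2)" using m(1) by (simp add: field_simps)
      qed
    qed
  next
    assume "sqi f"
    then have i: "integrable M (\<lambda>x. B * (cmod (f x))\<^sup>2)" by (auto simp: sqi_def)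
    show "integrable M (\<lambda>x. g x * (cmod (f x))\<^sup>2)"
    proof (rule Bochner_Integration.integrable_bound[OF i])
      show "AE x in M. norm (g x * (cmod (f x))\<^sup>2) \<le> norm (B * (cmod (f x))\<^sup>2)"
        using AE_M_in
      proof eventually_elim
        fix x assume "x \<in> {c<..<d}"
        then have "\<bar>g x\<bar> \<le> \<bar>B\<bar>" using B(2)[of x] by auto
        then show "norm (g x * (cmod (f x))\<^sup>2) \<le> norm (B * (cmod (f x))\<^sup>2)"
          by (simp add: abs_mult mult_right_mono)
      qed
    qed (use gm f in measurable)
  qed
  show ?thesis
  proof (intro set_eqI iffI)
    fix u assume "u \<in> vecs (L2 g {c<..<d})"
    then have "AE x in lborel. x \<notin> {c<..<d} \<longrightarrow> rep_aefun u x = 0" "integrable M (\<lambda>x. g x * (cmod (rep_aefun u x))\<^sup>2)"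
      by (auto simp: L2_def set_integrable_M)
    then show "u \<in> sq_cls"
      using eq[OF rep_measurable_M] cls_rep[of u] by (auto simp: sq_cls_def intro!: exI[of _ "rep_aefun u"])
  next
    fix u assume "u \<in> sq_cls"
    then obtain f where f: "sqi f" "u = cls f" by (auto simp: sq_cls_def)
    have fm: "f \<in> borel_measurable M" using f by (simp add: sqi_measurable)
    have "AE x in M. f x = rep_aefun u x" using rep_cls[OF fm] unfolding f(2) by eventually_elim simp
    then have "sqi (rep_aefun u)" by (rule sqi_cong[OF f(1) _ rep_measurable_M])
    then have "integrable M (\<lambda>x. g x * (cmod (rep_aefun u x))\<^sup>2)" using eq[OF rep_measurable_M] by blast
    moreover have "AE x in lborel. x \<notin> {c<..<d} \<longrightarrow> rep_aefun u x = 0"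
      using rep_cls'[OF fm] f by (auto elim!: eventually_mono)
    ultimately show "u \<in> vecs (L2 g {c<..<d})" by (auto simp: L2_def set_integrable_M)
  qed
qed

lemma L2_nrm:
  assumes "sqi f" "g \<in> borel_measurable M"
  shows "nrm (L2 g {c<..<d}) (cls f) = sqrt (\<integral>x. g x * (cmod (f x))\<^sup>2 \<partial>M)"
proof -
  have "(\<integral>x. g x * (cmod (rep_aefun (cls f) x))\<^sup>2 \<partial>M) = (\<integral>x. g x * (cmod (f x))\<^sup>2 \<partial>M)"
  proof (rule integral_cong_AE)
    have [measurable]: "f \<in> borel_measurable M" using assms(1) by (rule sqi_measurable)
    have [measurable]: "rep_aefun (cls f) \<in> borel_measurable M" by (rule rep_measurable_M)
    note assms(2)[measurable]
    show "(\<lambda>x. g x * (cmod (rep_aefun (cls f) x))\<^sup>2) \<in> borel_measurable M"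
      "(\<lambda>x. g x * (cmod (f x))\<^sup>2) \<in> borel_measurable M" by measurable
    show "AE x in M. g x * (cmod (rep_aefun (cls f) x))\<^sup>2 = g x * (cmod (f x))\<^sup>2"
      using rep_cls[OF sqi_measurable[OF assms(1)]] by eventually_elim simp
  qed
  then show ?thesis by (simp add: L2_def LBINT_M)
qed

lemma L2_1_vecs: "vecs (L2 (\<lambda>_. 1) {c<..<d}) = sq_cls"
  by (rule L2_vecs) auto

lemma weak_deriv_iff:
  assumes "f \<in> borel_measurable M" "g \<in> borel_measurable M"
  shows "is_weak_deriv c d (cls f) (cls g) \<longleftrightarrow> wderiv f g"
proof -
  have "(\<integral>x. rep_aefun (cls h) x * complex_of_real (\<psi> x) \<partial>M) = (\<integral>x. h x * complex_of_real (\<psi> x) \<partial>M)"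
    if h: "h \<in> borel_measurable M" and \<psi>: "continuous_on UNIV \<psi>" for h \<psi>
  proof (rule integral_cong_AE)
    have "(\<lambda>x. complex_of_real (\<psi> x)) \<in> borel_measurable M"
      by (intro continuous_measurable continuous_intros continuous_on_subset[OF \<psi>]) auto
    then show "(\<lambda>x. rep_aefun (cls h) x * complex_of_real (\<psi> x)) \<in> borel_measurable M"
        "(\<lambda>x. h x * complex_of_real (\<psi> x)) \<in> borel_measurable M"
      using h rep_measurable_M by (auto intro: borel_measurable_times)
    show "AE x in M. rep_aefun (cls h) x * complex_of_real (\<psi> x) = h x * complex_of_real (\<psi> x)"
      using rep_cls[OF h] by (auto elim: eventually_mono)
  qed
  moreover have "continuous_on UNIV \<phi> \<and> continuous_on UNIV \<phi>'" if "test_function c d \<phi> \<phi>'" for \<phi> \<phi>'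
    using that unfolding test_function_def
    by (auto intro!: continuous_at_imp_continuous_on DERIV_isCont)
  ultimately show ?thesis
    using assms unfolding is_weak_deriv_def wderiv_def LBINT_M by (metis (no_types, lifting))
qed

text \<open>
  Uniqueness of the weak derivative: the difference of two candidates is a weak derivative of zero,
  hence by \<open>wderiv_imp_AC\<close> the derivative of an absolutely continuous function that is zero almost
  everywhere and thus everywhere, and \<open>AC_unique\<close> applies.
\<close>

lemma weak_deriv_cls:
  assumes U: "AC U u" and u: "sqi u"
  shows "cls U \<in> H1 c d" "weak_deriv c d (cls U) = cls u"
proof -
  have sU: "sqi U" using sqi_continuous[OF AC_continuous[OF U]] .
  have w: "is_weak_deriv c d (cls U) (cls u)"
    using weak_deriv_iff AC_imp_wderiv[OF U] sU u sqi_measurable by blast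
  then show "cls U \<in> H1 c d"
    using sU u by (auto simp: H1_def L2_1_vecs sq_cls_def)
  show "weak_deriv c d (cls U) = cls u"
    unfolding weak_deriv_def L2_1_vecs
  proof (rule the_equality)
    show "cls u \<in> sq_cls \<and> is_weak_deriv c d (cls U) (cls u)" using w u by (auto simp: sq_cls_def)
    fix v assume v: "v \<in> sq_cls \<and> is_weak_deriv c d (cls U) v"
    then obtain g where g: "sqi g" "v = cls g" by (auto simp: sq_cls_def)
    then have "wderiv U g" using v weak_deriv_iff sU sqi_measurable by blast
    then obtain V where V: "AC V g" "AE x in M. U x = V x" using wderiv_imp_AC[OF sU g(1)] by blast
    have "wderiv (\<lambda>x. 0) (\<lambda>x. g x - u x)"
      unfolding wderiv_def
    proof (intro allI impI)
      fix \<phi> \<phi>' assume t: "test_function c d \<phi> \<phi>'"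
      then have "continuous_on {c..d} \<phi>" unfolding test_function_def
        by (auto intro!: continuous_at_imp_continuous_on DERIV_isCont)
      then have s: "sqi (\<lambda>x. of_real (\<phi> x))" by (intro sqi_continuous continuous_intros)
      have "(\<integral>x. g x * of_real (\<phi> x) \<partial>M) = (\<integral>x. u x * of_real (\<phi> x) \<partial>M)"
      proof -
        have "(\<integral>x. U x * of_real (\<phi>' x) \<partial>M) = - (\<integral>x. g x * of_real (\<phi> x) \<partial>M)"
          using \<open>wderiv U g\<close> t unfolding wderiv_def by blast
        moreover have "(\<integral>x. U x * of_real (\<phi>' x) \<partial>M) = - (\<integral>x. u x * of_real (\<phi> x) \<partial>M)"
          using AC_imp_wderiv[OF U] t unfolding wderiv_def by blast
        ultimately show ?thesis by simp
      qed
      then show "(\<integral>x. 0 * of_real (\<phi>' x) \<partial>M) = - (\<integral>x. (g x - u x) * of_real (\<phi> x) \<partial>M)"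
        using sqi_mult_integrable[OF g(1) s] sqi_mult_integrable[OF u s] by (simp add: left_diff_distrib)
    qed
    then obtain W where W: "AC W (\<lambda>x. g x - u x)" "AE x in M. 0 = W x"
      using wderiv_imp_AC[of "\<lambda>x. 0" "\<lambda>x. g x - u x"] sqi_diff[OF g(1) u] sqi_continuous[of "\<lambda>_. 0"] by auto
    have "W x = 0" if "x \<in> {c..d}" for x
      using AE_continuous_zero[OF AC_continuous[OF W(1)] _ that] W(2) by (auto elim: eventually_mono)
    then have "AC (\<lambda>x. 0) (\<lambda>x. g x - u x)"
      using W(1) sqi_diff[OF g(1) u] sqi_measurable by (intro AC_cong[OF W(1)]) auto
    then have "AE x in M. g x - u x = 0"
      using AC_unique[OF _ sqi_diff[OF g(1) u] AC_const[of 0]] sqi_continuous[of "\<lambda>_. 0"] by auto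
    then show "v = cls u" using g u sqi_measurable by (auto intro!: cls_cong)
  qed
qed

end

section \<open>The Sturm-Liouville equation\<close>

text \<open>
  The differential expression \<open>- (1 / w) (p u')'\<close> on one interval.  It is used with \<open>p = k\<close>, \<open>w = r\<close> on
  the left and \<open>p = \<kappa>\<close>, \<open>w = \<rho>\<close> on the right.
\<close>

locale sturm = bounded_interval +
  fixes p w :: "real \<Rightarrow> real"
  assumes p_smooth: "smooth_on_Icc c d p" and p_pos: "\<And>x. x \<in> {c..d} \<Longrightarrow> 0 < p x"
    and w_smooth: "smooth_on_Icc c d w" and w_pos: "\<And>x. x \<in> {c..d} \<Longrightarrow> 0 < w x"
begin

lemma smooth_C1:
  assumes "smooth_on_Icc c d f"
  obtains f' where "\<And>x. x \<in> {c..d} \<Longrightarrow> (f has_real_derivative f' x) (at x within {c..d})"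
    "continuous_on {c..d} f'" "continuous_on {c..d} f"
proof -
  obtain D where D: "D 0 = f" "\<And>n x. x \<in> {c..d} \<Longrightarrow> (D n has_real_derivative D (Suc n) x) (at x within {c..d})"
    using assms unfolding smooth_on_Icc_def by metis
  have "continuous_on {c..d} (D n)" for n
    using D(2) by (intro DERIV_continuous_on) auto
  then show ?thesis using that[of "D (Suc 0)"] D by metis
qed

lemma p_cont: "continuous_on {c..d} p" and w_cont: "continuous_on {c..d} w"
  using smooth_C1[OF p_smooth] smooth_C1[OF w_smooth] by metis+

lemma p_inv_cont: "continuous_on {c..d} (\<lambda>x. 1 / complex_of_real (p x))"
  using p_pos by (intro continuous_intros p_cont) (metis less_irrefl of_real_eq_0_iff)

lemma w_of_real_cont: "continuous_on {c..d} (\<lambda>x. complex_of_real (w x))"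
  by (intro continuous_intros w_cont)

lemma AC_p: obtains p' where "AC (\<lambda>x. of_real (p x)) p'" "continuous_on {c..d} p'"
proof -
  obtain p' where p': "\<And>x. x \<in> {c..d} \<Longrightarrow> (p has_real_derivative p' x) (at x within {c..d})"
      "continuous_on {c..d} p'"
    using smooth_C1[OF p_smooth] by metis
  have "AC (\<lambda>x. of_real (p x)) (\<lambda>x. of_real (p' x))"
  proof (rule AC_deriv)
    show "((\<lambda>x. complex_of_real (p x)) has_vector_derivative complex_of_real (p' x)) (at x within {c..d})"
      if "x \<in> {c..d}" for x
      by (rule has_vector_derivative_of_real) (rule p'(1)[OF that])
  qed (intro continuous_intros p')
  then show ?thesis using that p'(2) by (auto intro: continuous_intros)
qed

lemma AC_p_inv: obtains q' where "AC (\<lambda>x. 1 / of_real (p x)) q'" "continuous_on {c..d} q'"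
proof -
  obtain p' where p': "\<And>x. x \<in> {c..d} \<Longrightarrow> (p has_real_derivative p' x) (at x within {c..d})"
      "continuous_on {c..d} p'"
    using smooth_C1[OF p_smooth] by metis
  define q' where "q' = (\<lambda>x. complex_of_real (- p' x / (p x * p x)))"
  have q'c: "continuous_on {c..d} q'" unfolding q'_def
    using p_pos by (intro continuous_intros p' p_cont) force
  have "AC (\<lambda>x. of_real (1 / p x)) q'"
  proof (rule AC_deriv)
    show "((\<lambda>x. complex_of_real (1 / p x)) has_vector_derivative q' x) (at x within {c..d})"
      if x: "x \<in> {c..d}" for x
      unfolding q'_def
    proof (rule has_vector_derivative_of_real)
      show "((\<lambda>x. 1 / p x) has_real_derivative - p' x / (p x * p x)) (at x within {c..d})"
        using p_pos[OF x] by (auto intro!: derivative_eq_intros p'(1)[OF x])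
    qed
  qed (rule q'c)
  then show ?thesis using that q'c by auto
qed

definition p_bd :: real
  where "p_bd = (SOME P. 0 < P \<and> (\<forall>x\<in>{c..d}. cmod (1 / of_real (p x)) \<le> P))"

definition w_bd :: real
  where "w_bd = (SOME Q. 0 < Q \<and> (\<forall>x\<in>{c..d}. cmod (of_real (w x)) \<le> Q))"

lemma p_bd: "0 < p_bd" "x \<in> {c..d} \<Longrightarrow> cmod (1 / of_real (p x)) \<le> p_bd"
  and w_bd: "0 < w_bd" "x \<in> {c..d} \<Longrightarrow> cmod (of_real (w x)) \<le> w_bd"
proof -
  have "\<exists>P>0. \<forall>x\<in>{c..d}. cmod (1 / of_real (p x)) \<le> P" "\<exists>Q>0. \<forall>x\<in>{c..d}. cmod (of_real (w x)) \<le> Q"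
    using continuous_bounded[OF p_inv_cont] continuous_bounded[OF w_of_real_cont] by metis+
  from someI_ex[OF this(1)] someI_ex[OF this(2)]
  show "0 < p_bd" "x \<in> {c..d} \<Longrightarrow> cmod (1 / of_real (p x)) \<le> p_bd"
    "0 < w_bd" "x \<in> {c..d} \<Longrightarrow> cmod (of_real (w x)) \<le> w_bd"
    unfolding p_bd_def w_bd_def by blast+
qed

text \<open>
  The equation \<open>- (p U')' = w F\<close> as a first-order system \<open>U' = V / p\<close>, \<open>V' = - w F\<close> in integrated form.
  The flux \<open>V = p U'\<close> is continuous although \<open>F\<close> is only square-integrable, so \<open>V\<close> has boundary values.
\<close>

definition sol :: "(real \<Rightarrow> complex) \<Rightarrow> (real \<Rightarrow> complex) \<Rightarrow> (real \<Rightarrow> complex) \<Rightarrow> bool"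
  where "sol U V F \<longleftrightarrow> AC U (\<lambda>x. V x / of_real (p x)) \<and> AC V (\<lambda>x. - of_real (w x) * F x) \<and> sqi F"

lemma solD: "sol U V F \<Longrightarrow> AC U (\<lambda>x. V x / of_real (p x))" "sol U V F \<Longrightarrow> AC V (\<lambda>x. - of_real (w x) * F x)"
  "sol U V F \<Longrightarrow> sqi F"
  by (simp_all add: sol_def)

lemma sol_cont: "sol U V F \<Longrightarrow> continuous_on {c..d} U" "sol U V F \<Longrightarrow> continuous_on {c..d} V"
  by (auto simp: sol_def intro: AC_continuous)

lemma sol_lin:
  assumes s: "sol U V F" and t: "sol X Y H"
  shows "sol (\<lambda>x. s * U x + X x) (\<lambda>x. s * V x + Y x) (\<lambda>x. s * F x + H x)"
proof -
  have "(\<lambda>x. - of_real (w x) * (s * F x + H x)) = (\<lambda>x. s * (- of_real (w x) * F x) + - of_real (w x) * H x)"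
    by (simp add: fun_eq_iff algebra_simps)
  then show ?thesis
    using AC_add[OF AC_scale[OF solD(1)[OF s], of s] solD(1)[OF t]]
      AC_add[OF AC_scale[OF solD(2)[OF s], of s] solD(2)[OF t]]
      sqi_add[OF sqi_scale[OF solD(3)[OF s], of s] solD(3)[OF t]]
    unfolding sol_def add_divide_distrib by simp
qed

lemma sol_cnj:
  assumes s: "sol U V F" shows "sol (\<lambda>x. cnj (U x)) (\<lambda>x. cnj (V x)) (\<lambda>x. cnj (F x))"
  using AC_cnj[OF solD(1)[OF s]] AC_cnj[OF solD(2)[OF s]] sqi_cnj[OF solD(3)[OF s]] by (simp add: sol_def)

lemma sol_cong:
  assumes s: "sol U V F" and ae: "AE x in M. H x = F x" and m: "H \<in> borel_measurable M"
  shows "sol U V H"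
proof -
  have wm: "(\<lambda>x. complex_of_real (w x)) \<in> borel_measurable M" by (rule continuous_measurable[OF w_of_real_cont])
  have "AE x in M. F x = H x" using ae by eventually_elim simp
  then have "sqi H" by (rule sqi_cong[OF solD(3)[OF s] _ m])
  moreover have "AC V (\<lambda>x. - of_real (w x) * H x)"
  proof (rule AC_cong[OF solD(2)[OF s]])
    show "AE x in M. - of_real (w x) * H x = - of_real (w x) * F x" using ae by eventually_elim simp
    show "(\<lambda>x. - of_real (w x) * H x) \<in> borel_measurable M"
      by (intro borel_measurable_times borel_measurable_uminus wm m)
  qed simp
  ultimately show ?thesis using s by (simp add: sol_def)
qed

lemma w_sqi: "sqi F \<Longrightarrow> sqi (\<lambda>x. - of_real (w x) * F x)"
  by (intro sqi_mult_continuous continuous_intros w_cont)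

text \<open>
  This lemma and \<open>H2_sol\<close> identify the Sobolev space of order two, and the operators on it, with the
  solutions in the sense of \<open>sol\<close>.  Smoothness of \<open>p\<close> is what makes \<open>V / p\<close> absolutely continuous here and
  \<open>p U'\<close> in \<open>H2_sol\<close>.
\<close>

lemma sol_H2:
  assumes s: "sol U V F"
  shows "cls U \<in> H2 c d" "weak_deriv c d (cls U) = cls (\<lambda>x. V x / of_real (p x))"
    "sturm_expr c d p w (cls U) = cls F"
proof -
  define W where "W = (\<lambda>x. V x / of_real (p x))"
  have Wc: "continuous_on {c..d} W"
    using continuous_on_mult[OF sol_cont(2)[OF s] p_inv_cont] by (simp add: W_def)
  have sW: "sqi W" using Wc by (rule sqi_continuous)
  note 1 = weak_deriv_cls[OF solD(1)[OF s, folded W_def] sW]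
  show wd: "weak_deriv c d (cls U) = cls (\<lambda>x. V x / of_real (p x))" using 1 by (simp add: W_def)
  obtain q' where q: "AC (\<lambda>x. 1 / of_real (p x)) q'" "continuous_on {c..d} q'" by (rule AC_p_inv)
  have "AC W (\<lambda>x. - of_real (w x) * F x * (1 / of_real (p x)) + V x * q' x)"
    using AC_mult[OF solD(2)[OF s] q(1)] by (simp add: W_def)
  moreover have "sqi (\<lambda>x. - of_real (w x) * F x * (1 / of_real (p x)) + V x * q' x)"
  proof (rule sqi_add)
    show "sqi (\<lambda>x. - of_real (w x) * F x * (1 / of_real (p x)))"
      using sqi_mult_continuous[OF w_sqi[OF solD(3)[OF s]] p_inv_cont] by (simp add: mult.commute)
    show "sqi (\<lambda>x. V x * q' x)" by (intro sqi_continuous continuous_intros sol_cont[OF s] q(2))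
  qed
  ultimately have "cls W \<in> H1 c d" by (rule weak_deriv_cls)
  then show "cls U \<in> H2 c d" using 1 by (simp add: H2_def)
  have pm: "p \<in> borel_measurable M" and wm: "w \<in> borel_measurable M" and Fm: "F \<in> borel_measurable M"
    and Wm: "W \<in> borel_measurable M" and Vm: "V \<in> borel_measurable M"
    using continuous_measurable[OF p_cont] continuous_measurable[OF w_cont] sqi_measurable[OF solD(3)[OF s]]
      sqi_measurable[OF sW] continuous_measurable[OF sol_cont(2)[OF s]] by auto
  have "mult_on {c<..<d} p (weak_deriv c d (cls U)) = cls (\<lambda>x. of_real (p x) * W x)"
    using 1 Wm pm by (simp add: cls_mult_on)
  also have "\<dots> = cls V"
  proof (rule cls_cong)
    show "(\<lambda>x. of_real (p x) * W x) \<in> borel_measurable M" using pm Wm by measurable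
    show "AE x in M. of_real (p x) * W x = V x" using AE_M_in
    proof eventually_elim
      fix x assume "x \<in> {c<..<d}"
      then have "p x \<noteq> 0" using p_pos[of x] by auto
      then show "of_real (p x) * W x = V x" by (simp add: W_def)
    qed
  qed (rule Vm)
  finally have "weak_deriv c d (mult_on {c<..<d} p (weak_deriv c d (cls U))) = cls (\<lambda>x. - of_real (w x) * F x)"
    using weak_deriv_cls(2)[OF solD(2)[OF s] w_sqi[OF solD(3)[OF s]]] by simp
  then have "sturm_expr c d p w (cls U) = cls (\<lambda>x. of_real (- 1 / w x) * (- of_real (w x) * F x))"
    unfolding sturm_expr_def using wm Fm by (simp add: cls_mult_on)
  also have "\<dots> = cls F"
  proof (rule cls_cong)
    show "(\<lambda>x. of_real (- 1 / w x) * (- of_real (w x) * F x)) \<in> borel_measurable M" using wm Fm by measurable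
    show "AE x in M. of_real (- 1 / w x) * (- of_real (w x) * F x) = F x" using AE_M_in
    proof eventually_elim
      fix x assume "x \<in> {c<..<d}"
      then have "w x \<noteq> 0" using w_pos[of x] by auto
      then show "of_real (- 1 / w x) * (- of_real (w x) * F x) = F x" by simp
    qed
  qed (rule Fm)
  finally show "sturm_expr c d p w (cls U) = cls F" .
qed

lemma H1_AC:
  assumes "u \<in> H1 c d"
  obtains U v where "AC U v" "sqi v" "u = cls U" "weak_deriv c d u = cls v"
proof -
  obtain f v where f: "sqi f" "sqi v" "u = cls f" "is_weak_deriv c d (cls f) (cls v)"
    using assms by (auto simp: H1_def L2_1_vecs sq_cls_def)
  then have "wderiv f v" using weak_deriv_iff sqi_measurable by blast
  then obtain U where U: "AC U v" "AE x in M. f x = U x" using wderiv_imp_AC f by blast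
  have "u = cls U" unfolding f(3)
    using U f sqi_measurable continuous_measurable[OF AC_continuous[OF U(1)]] by (intro cls_cong) auto
  then show ?thesis using weak_deriv_cls(2)[OF U(1) f(2)] by (intro that[OF U(1) f(2)]) simp_all
qed

lemma H2_sol:
  assumes "u \<in> H2 c d"
  obtains U V F where "sol U V F" "u = cls U"
proof -
  have u: "u \<in> H1 c d" and u': "weak_deriv c d u \<in> H1 c d" using assms by (auto simp: H2_def)
  obtain U v where U: "AC U v" "sqi v" "u = cls U" "weak_deriv c d u = cls v" using H1_AC[OF u] .
  obtain W h where W: "AC W h" "sqi h" "weak_deriv c d u = cls W" using H1_AC[OF u'] .
  have Wc: "continuous_on {c..d} W" using AC_continuous[OF W(1)] .
  have vW: "AE x in M. v x = W x"
    using cls_eqD[of v W] U W sqi_measurable continuous_measurable[OF Wc] by simp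
  obtain p' where p': "AC (\<lambda>x. of_real (p x)) p'" "continuous_on {c..d} p'" by (rule AC_p)
  define V where "V = (\<lambda>x. of_real (p x) * W x)"
  have V: "AC V (\<lambda>x. p' x * W x + of_real (p x) * h x)"
    using AC_mult[OF p'(1) W(1)] by (simp add: V_def)
  have sV: "sqi (\<lambda>x. p' x * W x + of_real (p x) * h x)"
    by (intro sqi_add sqi_mult_continuous sqi_continuous[OF Wc] p' W continuous_intros p_cont)
  define F where "F = (\<lambda>x. (- 1 / of_real (w x)) * (p' x * W x + of_real (p x) * h x))"
  have "continuous_on {c..d} (\<lambda>x. - 1 / complex_of_real (w x))"
    using w_pos by (intro continuous_intros w_cont) (metis less_irrefl of_real_eq_0_iff)
  then have sF: "sqi F" unfolding F_def by (intro sqi_mult_continuous sV)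
  have "sol U V F"
    unfolding sol_def
  proof (intro conjI sF)
    have pw: "V x / of_real (p x) = W x" if "x \<in> {c<..<d}" for x
      using p_pos[of x] that by (simp add: V_def)
    show "AC U (\<lambda>x. V x / of_real (p x))"
    proof (rule AC_cong[OF U(1)])
      show "AE x in M. V x / of_real (p x) = v x"
        using vW AE_M_in by eventually_elim (simp add: pw)
      show "(\<lambda>x. V x / of_real (p x)) \<in> borel_measurable M"
        using continuous_on_mult[OF AC_continuous[OF V] p_inv_cont] by (intro continuous_measurable) simp
    qed simp
    show "AC V (\<lambda>x. - of_real (w x) * F x)"
    proof (rule AC_cong[OF V])
      show "AE x in M. - of_real (w x) * F x = p' x * W x + of_real (p x) * h x"
        using AE_M_in
      proof eventually_elim
        fix x assume "x \<in> {c<..<d}"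
        then have "w x \<noteq> 0" using w_pos[of x] by auto
        then show "- of_real (w x) * F x = p' x * W x + of_real (p x) * h x" by (simp add: F_def)
      qed
      show "(\<lambda>x. - of_real (w x) * F x) \<in> borel_measurable M" using sqi_measurable[OF w_sqi[OF sF]] .
    qed simp
  qed
  then show ?thesis using that U by blast
qed

lemma value_at_cls:
  assumes U: "continuous_on {c..d} U" and x: "x \<in> {c..d}"
  shows "value_at c d (cls U) x = U x"
  unfolding value_at_def
proof (rule the_equality)
  have "AE t in lborel. t \<in> {c<..<d} \<longrightarrow> rep_aefun (cls U) t = U t"
    using rep_cls[OF continuous_measurable[OF U]] by (simp add: AE_M)
  then show "\<exists>w. continuous_on {c..d} w \<and> (AE t in lborel. t \<in> {c<..<d} \<longrightarrow> rep_aefun (cls U) t = w t) \<and> U x = w x"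
    using U by blast
  fix y assume "\<exists>w. continuous_on {c..d} w \<and> (AE t in lborel. t \<in> {c<..<d} \<longrightarrow> rep_aefun (cls U) t = w t) \<and> y = w x"
  then obtain W where W: "continuous_on {c..d} W" "AE t in M. rep_aefun (cls U) t = W t" "y = W x"
    by (auto simp: AE_M)
  have "AE t in M. W t - U t = 0"
    using W(2) rep_cls[OF continuous_measurable[OF U]] by eventually_elim simp
  then have "W x - U x = 0"
    using AE_continuous_zero[OF continuous_on_diff[OF W(1) U] _ x] by simp
  then show "y = U x" using W by simp
qed

lemma sol_eq:
  assumes s: "sol U V F" and t: "sol X Y H" and eq: "cls U = cls X"
  shows "x \<in> {c..d} \<Longrightarrow> U x = X x" "x \<in> {c..d} \<Longrightarrow> V x = Y x" "AE x in M. F x = H x"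
proof -
  show "x \<in> {c..d} \<Longrightarrow> U x = X x"
    using value_at_cls[OF sol_cont(1)[OF s]] value_at_cls[OF sol_cont(1)[OF t]] eq by metis
  have c: "continuous_on {c..d} (\<lambda>x. V x / of_real (p x))" "continuous_on {c..d} (\<lambda>x. Y x / of_real (p x))"
    using continuous_on_mult[OF sol_cont(2)[OF s] p_inv_cont] continuous_on_mult[OF sol_cont(2)[OF t] p_inv_cont]
    by simp_all
  have "cls (\<lambda>x. V x / of_real (p x)) = cls (\<lambda>x. Y x / of_real (p x))"
    using sol_H2(2)[OF s] sol_H2(2)[OF t] eq by simp
  then show "x \<in> {c..d} \<Longrightarrow> V x = Y x"
    using value_at_cls[OF c(1), of x] value_at_cls[OF c(2), of x] p_pos[of x] by auto
  show "AE x in M. F x = H x"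
    using sol_H2(3)[OF s] sol_H2(3)[OF t] eq sol_def s t by (intro cls_eqD) (auto intro: sqi_measurable)
qed

text \<open>
  The derivative of the bilinear Wronskian \<open>U Y - V X\<close> is \<open>w (F X - U H)\<close>, because the terms \<open>V Y / p\<close>
  cancel.
\<close>

lemma lagrange_identity:
  assumes s: "sol U V F" and t: "sol X Y H"
  shows "(U d * Y d - V d * X d) - (U c * Y c - V c * X c)
    = (\<integral>x. of_real (w x) * (F x * X x - U x * H x) \<partial>M)"
proof -
  have A: "AC (\<lambda>x. U x * Y x - V x * X x)
      (\<lambda>x. (V x / of_real (p x) * Y x + U x * (- of_real (w x) * H x))
        - (- of_real (w x) * F x * X x + V x * (Y x / of_real (p x))))"
    by (intro AC_diff AC_mult solD[OF s] solD[OF t])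
  have "(\<lambda>x. (V x / of_real (p x) * Y x + U x * (- of_real (w x) * H x))
        - (- of_real (w x) * F x * X x + V x * (Y x / of_real (p x))))
      = (\<lambda>x. of_real (w x) * (F x * X x - U x * H x))"
    by (simp add: fun_eq_iff algebra_simps)
  with AC_right[OF A] show ?thesis by simp
qed

section \<open>Initial value problems\<close>

text \<open>
  The twice integrated operator: \<open>u = \<alpha> + \<integral> V / p\<close> and \<open>V = \<beta> - \<integral> w (\<mu> u + F)\<close> combine
  to \<open>u = g - \<mu> volterra u\<close>.
\<close>

definition volterra :: "(real \<Rightarrow> complex) \<Rightarrow> real \<Rightarrow> complex"
  where "volterra u = prim (\<lambda>s. prim (\<lambda>t. of_real (w t) * u t) s / of_real (p s))"

lemma volterra_inner:
  assumes "integrable M u"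
  shows "integrable M (\<lambda>t. of_real (w t) * u t)" "integrable M (\<lambda>s. prim (\<lambda>t. of_real (w t) * u t) s / of_real (p s))"
proof -
  show i: "integrable M (\<lambda>t. of_real (w t) * u t)"
    by (intro integrable_mult_continuous assms w_of_real_cont)
  show "integrable M (\<lambda>s. prim (\<lambda>t. of_real (w t) * u t) s / of_real (p s))"
    using continuous_on_mult[OF continuous_prim[OF i] p_inv_cont] by (intro continuous_integrable) simp
qed

lemma volterra_cont: "integrable M u \<Longrightarrow> continuous_on {c..d} (volterra u)"
  unfolding volterra_def by (intro continuous_prim volterra_inner)

lemma volterra_add:
  "integrable M u \<Longrightarrow> integrable M v \<Longrightarrow> volterra (\<lambda>x. u x + v x) x = volterra u x + volterra v x"
  unfolding volterra_def by (simp add: ring_distribs add_divide_distrib prim_add volterra_inner)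

lemma volterra_scale: "volterra (\<lambda>x. a * u x) x = a * volterra u x"
  unfolding volterra_def
  by (simp add: mult.left_commute[of _ a] prim_scale flip: times_divide_eq_right)

lemma volterra_diff:
  "integrable M u \<Longrightarrow> integrable M v \<Longrightarrow> volterra (\<lambda>x. u x - v x) x = volterra u x - volterra v x"
  using volterra_add[of u "\<lambda>x. -1 * v x"] volterra_scale[of "-1" v] by simp

text \<open>
  Bounds of the form \<open>B exp (L (x - c))\<close> gain a factor \<open>1 / L\<close> under integration from \<open>c\<close>; a large
  \<open>L\<close> therefore makes a Volterra operator contractive in the corresponding weighted
  supremum norm.
\<close>

lemma prim_exp_bound:
  assumes u: "integrable M u" and L: "0 < L" and B: "0 \<le> B"
    and le: "\<And>t. t \<in> {c<..<d} \<Longrightarrow> cmod (u t) \<le> B * exp (L * (t - c))" and x: "x \<in> {c..d}"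
  shows "cmod (prim u x) \<le> B / L * exp (L * (x - c))"
proof -
  define h where "h = (\<lambda>t. B * exp (L * (t - c)))"
  have hc: "continuous_on A h" for A unfolding h_def by (intro continuous_intros)
  have "cmod (prim u x) \<le> (\<integral>t. indicator {..x} t *\<^sub>R h t \<partial>M)"
  proof (rule norm_prim_le_mult[OF u])
    show "h \<in> borel_measurable M" "integrable M h"
      using continuous_measurable[OF hc] continuous_integrable[OF hc] by auto
    show "AE t in M. t \<le> x \<longrightarrow> cmod (u t) \<le> h t"
      using AE_M_in by eventually_elim (use le in \<open>auto simp: h_def\<close>)
  qed
  also have "complex_of_real \<dots> = prim (\<lambda>t. of_real (h t)) x"
    unfolding prim_def integral_complex_of_real[symmetric] by (simp add: scaleR_conv_of_real)
  then have "(\<integral>t. indicator {..x} t *\<^sub>R h t \<partial>M) = Re (prim (\<lambda>t. of_real (h t)) x)"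
    by (metis Re_complex_of_real)
  also have "prim (\<lambda>t. of_real (h t)) x = of_real (B / L * exp (L * (x - c))) - of_real (B / L * exp (L * (c - c)))"
  proof -
    have "AC (\<lambda>x. of_real (B / L * exp (L * (x - c)))) (\<lambda>x. complex_of_real (h x))"
    proof (rule AC_deriv)
      fix x
      show "((\<lambda>x. complex_of_real (B / L * exp (L * (x - c)))) has_vector_derivative complex_of_real (h x)) (at x within {c..d})"
        by (rule has_vector_derivative_of_real) (use L in \<open>auto simp: h_def intro!: derivative_eq_intros\<close>)
    qed (intro continuous_intros hc)
    from AC_eq[OF this x] show ?thesis by simp
  qed
  also have "Re \<dots> \<le> B / L * exp (L * (x - c))" using B L by simp
  finally show ?thesis .
qed

lemma volterra_exp_bound:
  assumes u: "integrable M u" and L: "0 < L" and B: "0 \<le> B"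
    and le: "\<And>t. t \<in> {c<..<d} \<Longrightarrow> cmod (u t) \<le> B * exp (L * (t - c))" and x: "x \<in> {c..d}"
  shows "cmod (volterra u x) \<le> p_bd * w_bd * B / (L * L) * exp (L * (x - c))"
proof -
  have 1: "cmod (prim (\<lambda>t. of_real (w t) * u t) s) \<le> w_bd * B / L * exp (L * (s - c))" if s: "s \<in> {c..d}" for s
  proof (rule prim_exp_bound[OF volterra_inner(1)[OF u] L _ _ s])
    show "0 \<le> w_bd * B" using w_bd(1) B by simp
    fix t assume t: "t \<in> {c<..<d}"
    have "cmod (of_real (w t)) * cmod (u t) \<le> w_bd * (B * exp (L * (t - c)))"
      using t le[OF t] w_bd(1) by (intro mult_mono w_bd(2)) auto
    then show "cmod (of_real (w t) * u t) \<le> w_bd * B * exp (L * (t - c))" by (simp add: norm_mult)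
  qed
  have "cmod (volterra u x) \<le> (p_bd * (w_bd * B / L)) / L * exp (L * (x - c))"
    unfolding volterra_def
  proof (rule prim_exp_bound[OF volterra_inner(2)[OF u] L _ _ x])
    show "0 \<le> p_bd * (w_bd * B / L)" using p_bd(1) w_bd(1) B L by simp
    fix t assume t: "t \<in> {c<..<d}"
    have "cmod (1 / of_real (p t)) * cmod (prim (\<lambda>t. of_real (w t) * u t) t) \<le> p_bd * (w_bd * B / L * exp (L * (t - c)))"
      using t 1[of t] p_bd(1) by (intro mult_mono p_bd(2)) auto
    then show "cmod (prim (\<lambda>t. of_real (w t) * u t) t / of_real (p t)) \<le> p_bd * (w_bd * B / L) * exp (L * (t - c))"
      by (simp add: norm_divide)
  qed
  then show ?thesis by (simp add: mult.assoc)
qed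

text \<open>
  Large enough that \<open>\<mu> volterra\<close> halves bounds of the form \<open>B exp (rate \<mu> (x - c))\<close>.
\<close>

definition rate :: "complex \<Rightarrow> real"
  where "rate \<mu> = 1 + 2 * cmod \<mu> * (p_bd * w_bd)"

lemma rate_ge_1: "1 \<le> rate \<mu>" "0 < rate \<mu>"
  using p_bd(1) w_bd(1) by (auto simp: rate_def intro: add_pos_nonneg)

lemma volterra_contraction:
  assumes u: "integrable M u" and B: "0 \<le> B"
    and le: "\<And>t. t \<in> {c<..<d} \<Longrightarrow> cmod (u t) \<le> B * exp (rate \<mu> * (t - c))" and x: "x \<in> {c..d}"
  shows "cmod (\<mu> * volterra u x) \<le> B / 2 * exp (rate \<mu> * (x - c))"
proof -
  let ?L = "rate \<mu>"
  have "2 * cmod \<mu> * (p_bd * w_bd) \<le> ?L" by (simp add: rate_def)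
  also have "\<dots> \<le> ?L * ?L" using rate_ge_1[of \<mu>] by simp
  finally have LL: "2 * (cmod \<mu> * (p_bd * w_bd)) \<le> ?L * ?L" by simp
  have "cmod (\<mu> * volterra u x) \<le> cmod \<mu> * (p_bd * w_bd * B / (?L * ?L) * exp (?L * (x - c)))"
    unfolding norm_mult using volterra_exp_bound[OF u rate_ge_1(2) B le x] by (intro mult_left_mono) auto
  also have "\<dots> = (cmod \<mu> * (p_bd * w_bd) / (?L * ?L)) * (B * exp (?L * (x - c)))" by simp
  also have "\<dots> \<le> (1 / 2) * (B * exp (?L * (x - c)))"
    using LL rate_ge_1[of \<mu>] B by (intro mult_right_mono) (auto simp: divide_le_eq)
  finally show ?thesis by simp
qed

lemma volterra_bound:
  assumes u: "integrable M u" and B: "0 \<le> B" and le: "\<And>t. t \<in> {c<..<d} \<Longrightarrow> cmod (u t) \<le> B" and x: "x \<in> {c..d}"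
  shows "cmod (volterra u x) \<le> p_bd * w_bd * exp (d - c) * B"
proof -
  have "cmod (volterra u x) \<le> p_bd * w_bd * B / (1 * 1) * exp (1 * (x - c))"
  proof (rule volterra_exp_bound[OF u _ B _ x])
    fix t assume t: "t \<in> {c<..<d}"
    have "B * 1 \<le> B * exp (1 * (t - c))" using B t by (intro mult_left_mono) auto
    with le[OF t] show "cmod (u t) \<le> B * exp (1 * (t - c))" by simp
  qed simp
  also have "\<dots> \<le> p_bd * w_bd * B * exp (d - c)" using p_bd(1) w_bd(1) B x by (simp add: mult_left_mono)
  finally show ?thesis by (simp add: mult_ac)
qed

text \<open>
  The solution is the Neumann series, whose terms \<open>un n\<close> are bounded by \<open>E / 2\<^sup>n\<close> by
  \<open>volterra_contraction\<close>.
\<close>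

theorem volterra_solve:
  assumes g: "continuous_on {c..d} g"
  shows "\<exists>u. continuous_on {c..d} u \<and> (\<forall>x\<in>{c..d}. u x = g x - \<mu> * volterra u x)"
proof -
  define L where "L = rate (- \<mu>)"
  have L: "0 < L" using rate_ge_1 by (simp add: L_def)
  obtain B where B: "0 < B" "\<And>x. x \<in> {c..d} \<Longrightarrow> cmod (g x) \<le> B" using continuous_bounded[OF g] by metis
  define un where "un n = rec_nat g (\<lambda>_ u x. - \<mu> * volterra u x) n" for n :: nat
  have un0: "un 0 = g" and unS: "un (Suc n) = (\<lambda>x. - \<mu> * volterra (un n) x)" for n
    by (simp_all add: un_def)
  have unc: "continuous_on {c..d} (un n)" for n
  proof (induction n)
    case (Suc n)
    then show ?case unfolding unS by (intro continuous_intros volterra_cont continuous_integrable)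
  qed (simp add: un0 g)
  have uni: "integrable M (un n)" for n using continuous_integrable[OF unc] .
  have bound: "cmod (un n x) \<le> B * (1 / 2) ^ n * exp (L * (x - c))" if "x \<in> {c..d}" for n x
    using that
  proof (induction n arbitrary: x)
    case 0
    have "B * 1 \<le> B * exp (L * (x - c))" using B(1) L 0 by (intro mult_left_mono) auto
    then show ?case using B(2)[OF 0] by (simp add: un0)
  next
    case (Suc n)
    have "cmod (- \<mu> * volterra (un n) x) \<le> B * (1 / 2) ^ n / 2 * exp (L * (x - c))"
      using B(1) Suc unfolding L_def by (intro volterra_contraction uni) auto
    then show ?case by (simp add: unS)
  qed
  define E where "E = B * exp (L * (d - c))"
  have bound': "cmod (un n x) \<le> E * (1 / 2) ^ n" if x: "x \<in> {c..d}" for n x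
  proof -
    have "B * (1 / 2) ^ n * exp (L * (x - c)) \<le> B * (1 / 2) ^ n * exp (L * (d - c))"
      using B(1) L x by (intro mult_left_mono) auto
    then show ?thesis using bound[OF x, of n] by (simp add: E_def mult_ac)
  qed
  define u where "u x = (\<Sum>n. un n x)" for x
  have ul: "uniform_limit {c..d} (\<lambda>n x. \<Sum>i<n. un i x) u sequentially"
    unfolding u_def
    by (rule Weierstrass_m_test[where M = "\<lambda>n. E * (1 / 2) ^ n"])
      (use bound' in \<open>auto intro!: summable_mult summable_geometric\<close>)
  have uc: "continuous_on {c..d} u"
    by (rule uniform_limit_theorem[OF _ ul]) (auto intro!: always_eventually continuous_intros unc)
  have Sc: "continuous_on {c..d} (\<lambda>x. \<Sum>i<n. un i x)" for n
    by (intro continuous_intros unc)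
  have part: "(\<Sum>i<Suc n. un i x) = g x - \<mu> * volterra (\<lambda>x. \<Sum>i<n. un i x) x" for n x
  proof (induction n)
    case 0
    have "volterra (\<lambda>x. 0) x = 0" using volterra_scale[of 0 "\<lambda>_. 0"] by simp
    then show ?case by (simp add: un0)
  next
    case (Suc n)
    have "volterra (\<lambda>x. \<Sum>i<Suc n. un i x) x = volterra (\<lambda>x. \<Sum>i<n. un i x) x + volterra (un n) x"
      using volterra_add[OF continuous_integrable[OF Sc[of n]] uni[of n]] by simp
    then show ?case using Suc by (simp add: unS[of n] algebra_simps)
  qed
  define C where "C = p_bd * w_bd * exp (d - c)"
  have C: "0 < C" using p_bd(1) w_bd(1) by (simp add: C_def)
  have "u x = g x - \<mu> * volterra u x" if x: "x \<in> {c..d}" for x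
  proof -
    have 1: "(\<lambda>n. \<Sum>i<n. un i x) \<longlonglongrightarrow> u x" using tendsto_uniform_limitI[OF ul x] .
    have 2: "(\<lambda>n. volterra (\<lambda>x. \<Sum>i<n. un i x) x) \<longlonglongrightarrow> volterra u x"
    proof (rule tendstoI)
      fix e :: real assume e: "0 < e"
      have "\<forall>\<^sub>F n in sequentially. \<forall>t\<in>{c..d}. dist (\<Sum>i<n. un i t) (u t) < e / (2 * C)"
        using uniform_limitD[OF ul, of "e / (2 * C)"] e C by simp
      then show "\<forall>\<^sub>F n in sequentially. dist (volterra (\<lambda>x. \<Sum>i<n. un i x) x) (volterra u x) < e"
      proof eventually_elim
        fix n assume n: "\<forall>t\<in>{c..d}. dist (\<Sum>i<n. un i t) (u t) < e / (2 * C)"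
        have "cmod (volterra (\<lambda>t. (\<Sum>i<n. un i t) - u t) x) \<le> C * (e / (2 * C))"
          using n e C x unfolding C_def
          by (intro volterra_bound continuous_integrable continuous_intros unc uc) (auto simp: dist_norm less_imp_le)
        also have "\<dots> < e" using C e by simp
        finally show "dist (volterra (\<lambda>x. \<Sum>i<n. un i x) x) (volterra u x) < e"
          using volterra_diff[OF continuous_integrable[OF Sc[of n]] continuous_integrable[OF uc]]
          by (simp add: dist_norm)
      qed
    qed
    have "(\<lambda>n. \<Sum>i<Suc n. un i x) \<longlonglongrightarrow> g x - \<mu> * volterra u x"
      unfolding part by (intro tendsto_intros 2)
    moreover have "(\<lambda>n. \<Sum>i<Suc n. un i x) \<longlonglongrightarrow> u x" using LIMSEQ_Suc[OF 1] .
    ultimately show ?thesis by (rule LIMSEQ_unique[symmetric])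
  qed
  with uc show ?thesis by blast
qed

text \<open>
  Solutions of \<open>- (p U')' / w - \<mu> U = F\<close>.
\<close>

definition isol :: "complex \<Rightarrow> (real \<Rightarrow> complex) \<Rightarrow> (real \<Rightarrow> complex) \<Rightarrow> (real \<Rightarrow> complex) \<Rightarrow> bool"
  where "isol \<mu> U V F \<longleftrightarrow> sol U V (\<lambda>x. \<mu> * U x + F x)"

theorem ivp_exists:
  assumes F: "sqi F"
  shows "\<exists>U V. isol \<mu> U V F \<and> U c = \<alpha> \<and> V c = \<beta>"
proof -
  have wF: "integrable M (\<lambda>t. of_real (w t) * F t)" using volterra_inner(1)[OF sqi_integrable[OF F]] .
  define v0 where "v0 = (\<lambda>s. \<beta> - prim (\<lambda>t. of_real (w t) * F t) s)"
  have v0: "continuous_on {c..d} v0" unfolding v0_def by (intro continuous_intros continuous_prim wF)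
  have v0p: "integrable M (\<lambda>s. v0 s / of_real (p s))"
    using continuous_on_mult[OF v0 p_inv_cont] by (intro continuous_integrable) simp
  have "continuous_on {c..d} (\<lambda>x. \<alpha> + prim (\<lambda>s. v0 s / of_real (p s)) x)"
    by (intro continuous_intros continuous_prim v0p)
  then obtain U where U: "continuous_on {c..d} U"
      "\<And>x. x \<in> {c..d} \<Longrightarrow> U x = \<alpha> + prim (\<lambda>s. v0 s / of_real (p s)) x - \<mu> * volterra U x"
    using volterra_solve[of "\<lambda>x. \<alpha> + prim (\<lambda>s. v0 s / of_real (p s)) x" \<mu>] by blast
  have Ui: "integrable M U" using continuous_integrable[OF U(1)] .
  define V where "V = (\<lambda>s. v0 s - \<mu> * prim (\<lambda>t. of_real (w t) * U t) s)"
  have s: "sqi (\<lambda>x. \<mu> * U x + F x)" by (intro sqi_add sqi_scale sqi_continuous U F)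
  have "AC U (\<lambda>x. V x / of_real (p x))"
  proof (rule AC_cong[OF AC_prim[of _ \<alpha>]])
    show i: "integrable M (\<lambda>x. v0 x / of_real (p x) + (- \<mu>) * (prim (\<lambda>t. of_real (w t) * U t) x / of_real (p x)))"
      by (intro Bochner_Integration.integrable_add integrable_mult_right volterra_inner v0p Ui)
    show "U x = \<alpha> + prim (\<lambda>x. v0 x / of_real (p x) + (- \<mu>) * (prim (\<lambda>t. of_real (w t) * U t) x / of_real (p x))) x"
      if "x \<in> {c..d}" for x
      by (subst U(2)[OF that], subst prim_add[OF v0p integrable_mult_right[OF volterra_inner(2)[OF Ui]]])
        (simp only: prim_scale volterra_def, simp)
    have eq: "(\<lambda>x. V x / of_real (p x)) = (\<lambda>x. v0 x / of_real (p x) + (- \<mu>) * (prim (\<lambda>t. of_real (w t) * U t) x / of_real (p x)))"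
      by (simp add: V_def fun_eq_iff diff_divide_distrib)
    show "(\<lambda>x. V x / of_real (p x)) \<in> borel_measurable M" unfolding eq using i by auto
    show "AE x in M. V x / of_real (p x) = v0 x / of_real (p x) + (- \<mu>) * (prim (\<lambda>t. of_real (w t) * U t) x / of_real (p x))"
      by (rule AE_I2) (rule fun_cong[OF eq])
  qed
  moreover have "AC V (\<lambda>x. - of_real (w x) * (\<mu> * U x + F x))"
  proof -
    have "AC V (\<lambda>x. (0 - of_real (w x) * F x) - \<mu> * (of_real (w x) * U x))"
      unfolding V_def v0_def
      using AC_diff[OF AC_diff[OF AC_const[of \<beta>] AC_prim[OF wF, of 0]] AC_scale[OF AC_prim[OF volterra_inner(1)[OF Ui], of 0], of \<mu>]]
      by simp
    then show ?thesis by (simp add: algebra_simps)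
  qed
  moreover have "U c = \<alpha>" using U(2)[of c] c_less_d by (simp add: volterra_def)
  moreover have "V c = \<beta>" by (simp add: V_def v0_def)
  ultimately show ?thesis using s unfolding isol_def sol_def by blast
qed

definition wnorm :: "(real \<Rightarrow> complex) \<Rightarrow> real"
  where "wnorm f = sqrt (\<integral>x. w x * (cmod (f x))\<^sup>2 \<partial>M)"

lemma w_meas: "w \<in> borel_measurable M"
  using continuous_measurable[OF w_cont] .

lemma w_int: "integrable M w"
  using continuous_integrable[OF w_cont] .

lemma wsq_integrable: "sqi f \<Longrightarrow> integrable M (\<lambda>x. w x * (cmod (f x))\<^sup>2)"
proof -
  assume f: "sqi f"
  have "integrable M (\<lambda>x. of_real (w x) * (of_real ((cmod (f x))\<^sup>2) :: complex))"
    by (rule integrable_mult_continuous(2)[OF integrable_of_real[OF sq_integrable[OF f]] w_of_real_cont])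
  then show ?thesis by (simp flip: of_real_mult add: complex_of_real_integrable_eq del: of_real_power)
qed

lemma AE_w_pos: "AE x in M. 0 < w x"
  using AE_M_in by eventually_elim (use w_pos in auto)

lemma wint_nonneg: "0 \<le> (\<integral>x. w x * (cmod (f x))\<^sup>2 \<partial>M)"
  using AE_w_pos by (intro integral_nonneg_AE) (auto elim!: eventually_mono)

lemma wnorm_nonneg [simp]: "0 \<le> wnorm f"
  using wint_nonneg by (simp add: wnorm_def)

definition wtotal :: real where "wtotal = (\<integral>x. w x \<partial>M)"

lemma wtotal_nonneg: "0 \<le> wtotal"
  unfolding wtotal_def using AE_w_pos by (intro integral_nonneg_AE) (auto elim!: eventually_mono)

text \<open>
  The Cauchy-Schwarz inequality \<open>I\<^sup>2 \<le> wtotal \<parallel>f\<parallel>\<^sup>2\<close> for \<open>I = \<integral> w \<bar>f\<bar>\<close>, obtained by integrating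
  \<open>w (wtotal \<bar>f\<bar> - I)\<^sup>2 \<ge> 0\<close>.
\<close>

lemma L1_le_wnorm:
  assumes f: "sqi f"
  shows "(\<integral>x. cmod (of_real (w x) * f x) \<partial>M) \<le> sqrt wtotal * wnorm f"
proof -
  define I where "I = (\<integral>x. w x * cmod (f x) \<partial>M)"
  have fi: "integrable M (\<lambda>x. of_real (w x) * f x)" using volterra_inner(1)[OF sqi_integrable[OF f]] .
  have eq: "(\<integral>x. cmod (of_real (w x) * f x) \<partial>M) = I"
    unfolding I_def using AE_w_pos f w_meas
    by (intro integral_cong_AE) (auto simp: norm_mult sqi_def elim!: eventually_mono)
  have Ii: "integrable M (\<lambda>x. w x * cmod (f x))"
  proof (rule integrable_cong_AE_imp[OF integrable_norm[OF fi]])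
    show "(\<lambda>x. w x * cmod (f x)) \<in> borel_measurable M"
      using f w_meas by (auto simp: sqi_def)
    show "AE x in M. cmod (of_real (w x) * f x) = w x * cmod (f x)"
      using AE_w_pos by eventually_elim (simp add: norm_mult)
  qed
  have I0: "0 \<le> I" unfolding eq[symmetric] by simp
  have "0 \<le> (\<integral>x. w x * (wtotal * cmod (f x) - I)\<^sup>2 \<partial>M)"
    using AE_w_pos by (intro integral_nonneg_AE) (auto elim!: eventually_mono)
  also have "\<dots> = (\<integral>x. wtotal\<^sup>2 * (w x * (cmod (f x))\<^sup>2) - 2 * wtotal * I * (w x * cmod (f x)) + I\<^sup>2 * w x \<partial>M)"
    by (intro Bochner_Integration.integral_cong refl) (simp add: power2_eq_square algebra_simps)
  also have "\<dots> = wtotal\<^sup>2 * (wnorm f)\<^sup>2 - 2 * wtotal * I * I + I\<^sup>2 * wtotal"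
    using wsq_integrable[OF f] Ii w_int wint_nonneg[of f] by (simp add: I_def[symmetric] wnorm_def wtotal_def[symmetric])
  finally have *: "0 \<le> wtotal * (wtotal * (wnorm f)\<^sup>2 - I\<^sup>2)" by (simp add: power2_eq_square algebra_simps)
  have "I\<^sup>2 \<le> wtotal * (wnorm f)\<^sup>2"
  proof (cases "wtotal = 0")
    case True
    moreover have w0: "AE x in M. 0 \<le> w x" using AE_w_pos by eventually_elim simp
    ultimately have "AE x in M. w x = 0"
      using integral_nonneg_eq_0_iff_AE[OF w_int] w0 by (simp add: wtotal_def)
    with AE_w_pos have "AE x in M. False" by eventually_elim simp
    then have "emeasure M (space M) = 0" by (simp add: eventually_False ae_filter_eq_bot_iff)
    then show ?thesis using c_less_d by (simp add: emeasure_restrict_space)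
  next
    case False
    then have "0 < wtotal" using wtotal_nonneg by simp
    with * show ?thesis by (simp add: zero_le_mult_iff)
  qed
  then have "sqrt (I\<^sup>2) \<le> sqrt (wtotal * (wnorm f)\<^sup>2)" by (rule real_sqrt_le_mono)
  then show ?thesis using I0 by (simp add: eq real_sqrt_mult)
qed

text \<open>
  Gronwall's inequality in the form suited to \<open>volterra_contraction\<close>: at a maximum \<open>y\<close> of
  \<open>exp (- L (x - c)) \<bar>U x\<bar>\<close> the Volterra term contributes at most half of the maximum \<open>m\<close>, which
  bounds \<open>m\<close> by the contribution of the right-hand side.  The bound for \<open>V\<close> follows from its
  integral equation.
\<close>

theorem ivp_bound:
  "\<exists>C. \<forall>U V F. isol \<mu> U V F \<longrightarrow> sqi F \<longrightarrow> U c = 0 \<longrightarrow> V c = 0 \<longrightarrow>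
    (\<forall>x\<in>{c..d}. cmod (U x) \<le> C * wnorm F \<and> cmod (V x) \<le> C * wnorm F)"
proof -
  define L where "L = rate \<mu>"
  have L: "0 < L" using rate_ge_1 by (simp add: L_def)
  \<comment> \<open>\<open>C1\<close> bounds the contribution of the right-hand side to \<open>U\<close>; \<open>C2\<close> and \<open>C3\<close> bound \<open>U\<close> and \<open>V\<close>.\<close>
  define C1 where "C1 = p_bd * (d - c) * sqrt wtotal"
  define C2 where "C2 = 2 * C1 * exp (L * (d - c))"
  define C3 where "C3 = sqrt wtotal + cmod \<mu> * w_bd * C2 * (d - c)"
  have main: "cmod (U x) \<le> C2 * wnorm F \<and> cmod (V x) \<le> C3 * wnorm F"
    if s: "isol \<mu> U V F" and F: "sqi F" and ini: "U c = 0" "V c = 0" and x: "x \<in> {c..d}" for U V F x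
  proof -
    have s': "sol U V (\<lambda>x. \<mu> * U x + F x)" using s by (simp add: isol_def)
    have Uc: "continuous_on {c..d} U" using sol_cont(1)[OF s'] .
    have Ui: "integrable M U" using continuous_integrable[OF Uc] .
    have wF: "integrable M (\<lambda>t. of_real (w t) * F t)" using volterra_inner(1)[OF sqi_integrable[OF F]] .
    have wU: "integrable M (\<lambda>t. of_real (w t) * U t)" using volterra_inner(1)[OF Ui] .
    define f where "f = prim (\<lambda>t. of_real (w t) * F t)"
    have fi: "integrable M (\<lambda>t. f t / of_real (p t))"
      using continuous_on_mult[OF continuous_prim[OF wF] p_inv_cont] unfolding f_def by (intro continuous_integrable) simp
    have fb: "cmod (f t) \<le> sqrt wtotal * wnorm F" for t
      using norm_prim_le[OF wF, of t] L1_le_wnorm[OF F] by (simp add: f_def)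
    have Veq: "V t = - \<mu> * prim (\<lambda>t. of_real (w t) * U t) t - f t" if t: "t \<in> {c..d}" for t
    proof -
      have "V t = prim (\<lambda>x. - of_real (w x) * (\<mu> * U x + F x)) t"
        using AC_eq[OF solD(2)[OF s'] t] ini by simp
      also have "(\<lambda>x. - of_real (w x) * (\<mu> * U x + F x)) = (\<lambda>x. (- \<mu>) * (of_real (w x) * U x) + (-1) * (of_real (w x) * F x))"
        by (simp add: fun_eq_iff algebra_simps)
      also have "prim \<dots> t = - \<mu> * prim (\<lambda>t. of_real (w t) * U t) t + (-1) * f t"
        unfolding f_def using wU wF by (subst prim_add) (auto simp only: prim_scale intro!: integrable_mult_right)
      finally show ?thesis by simp
    qed
    have Ueq: "U t = - prim (\<lambda>t. f t / of_real (p t)) t - \<mu> * volterra U t" if t: "t \<in> {c..d}" for t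
    proof -
      have "U t = prim (\<lambda>x. V x / of_real (p x)) t"
        using AC_eq[OF solD(1)[OF s'] t] ini by simp
      also have "\<dots> = prim (\<lambda>x. (- \<mu>) * (prim (\<lambda>t. of_real (w t) * U t) x / of_real (p x)) + (-1) * (f x / of_real (p x))) t"
      proof (rule prim_cong[OF AC_integrable[OF solD(1)[OF s']]])
        show "AE s in M. s \<le> t \<longrightarrow> V s / of_real (p s)
            = (- \<mu>) * (prim (\<lambda>t. of_real (w t) * U t) s / of_real (p s)) + (-1) * (f s / of_real (p s))"
          using AE_M_in by eventually_elim (auto simp: Veq diff_divide_distrib)
      qed (intro Bochner_Integration.integrable_add integrable_mult_right volterra_inner Ui fi)
      also have "\<dots> = - \<mu> * volterra U t + (-1) * prim (\<lambda>t. f t / of_real (p t)) t"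
        unfolding volterra_def using volterra_inner(2)[OF Ui] fi
        by (subst prim_add) (auto simp only: prim_scale intro!: integrable_mult_right)
      finally show ?thesis by simp
    qed
    have gb: "cmod (prim (\<lambda>t. f t / of_real (p t)) t) \<le> C1 * wnorm F" for t
    proof -
      have "cmod (prim (\<lambda>t. f t / of_real (p t)) t) \<le> (\<integral>t. cmod (f t / of_real (p t)) \<partial>M)"
        by (rule norm_prim_le[OF fi])
      also have "\<dots> \<le> (\<integral>t. p_bd * (sqrt wtotal * wnorm F) \<partial>M)"
      proof (rule integral_mono_AE)
        show "AE t in M. cmod (f t / of_real (p t)) \<le> p_bd * (sqrt wtotal * wnorm F)"
          using AE_M_in
        proof eventually_elim
          fix t assume t: "t \<in> {c<..<d}"
          have "cmod (1 / of_real (p t)) * cmod (f t) \<le> p_bd * (sqrt wtotal * wnorm F)"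
            using t p_bd(1) fb[of t] by (intro mult_mono p_bd(2)) auto
          then show "cmod (f t / of_real (p t)) \<le> p_bd * (sqrt wtotal * wnorm F)" by (simp add: norm_divide)
        qed
        show "integrable M (\<lambda>t. p_bd * (sqrt wtotal * wnorm F))"
          using continuous_integrable[of "\<lambda>_. p_bd * (sqrt wtotal * wnorm F)"] by simp
      qed (use fi in auto)
      also have "\<dots> = C1 * wnorm F" using measure_M by (simp add: C1_def)
      finally show ?thesis .
    qed
    have Ec: "continuous_on {c..d} (\<lambda>t. exp (- (L * (t - c))) * cmod (U t))"
      by (intro continuous_intros Uc)
    have "{c..d} \<noteq> {}" using c_less_d by simp
    from continuous_attains_sup[OF compact_Icc this Ec]
    obtain y where y: "y \<in> {c..d}"
        "\<And>t. t \<in> {c..d} \<Longrightarrow> exp (- (L * (t - c))) * cmod (U t) \<le> exp (- (L * (y - c))) * cmod (U y)"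
      by blast
    define m where "m = exp (- (L * (y - c))) * cmod (U y)"
    have m0: "0 \<le> m" by (simp add: m_def)
    have Um: "cmod (U t) \<le> m * exp (L * (t - c))" if t: "t \<in> {c..d}" for t
    proof -
      have "cmod (U t) / exp (L * (t - c)) \<le> m"
        using y(2)[OF t] by (simp add: m_def exp_minus divide_inverse mult.commute)
      then show ?thesis by (simp add: pos_divide_le_eq)
    qed
    have "cmod (\<mu> * volterra U y) \<le> m / 2 * exp (L * (y - c))"
      using Um y(1) unfolding L_def by (intro volterra_contraction Ui m0) auto
    moreover have "cmod (U y) \<le> cmod (prim (\<lambda>t. f t / of_real (p t)) y) + cmod (\<mu> * volterra U y)"
      using norm_triangle_ineq4[of "- prim (\<lambda>t. f t / of_real (p t)) y" "\<mu> * volterra U y"]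
      unfolding Ueq[OF y(1), symmetric] by simp
    moreover have "cmod (U y) = m * exp (L * (y - c))"
      by (simp add: m_def exp_minus)
    ultimately have "m / 2 * exp (L * (y - c)) \<le> C1 * wnorm F" using gb[of y] by linarith
    moreover have "m / 2 * 1 \<le> m / 2 * exp (L * (y - c))" using m0 L y(1) by (intro mult_left_mono) auto
    ultimately have m: "m \<le> 2 * (C1 * wnorm F)" by linarith
    have C10: "0 \<le> C1" using p_bd(1) c_less_d wtotal_nonneg by (simp add: C1_def)
    have Ub: "cmod (U t) \<le> C2 * wnorm F" if t: "t \<in> {c..d}" for t
    proof -
      have "m * exp (L * (t - c)) \<le> 2 * (C1 * wnorm F) * exp (L * (d - c))"
        using m C10 L t m0 by (intro mult_mono) auto
      then show ?thesis using Um[OF t] by (simp add: C2_def mult_ac)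
    qed
    have "cmod (V x) \<le> cmod \<mu> * cmod (prim (\<lambda>t. of_real (w t) * U t) x) + cmod (f x)"
      unfolding Veq[OF x] using norm_triangle_ineq4[of "- \<mu> * prim (\<lambda>t. of_real (w t) * U t) x" "f x"]
      by (simp add: norm_mult)
    also have "\<dots> \<le> cmod \<mu> * (w_bd * (C2 * wnorm F) * (d - c)) + sqrt wtotal * wnorm F"
    proof (intro add_mono mult_left_mono fb)
      have "cmod (prim (\<lambda>t. of_real (w t) * U t) x) \<le> (\<integral>t. cmod (of_real (w t) * U t) \<partial>M)"
        by (rule norm_prim_le[OF wU])
      also have "\<dots> \<le> (\<integral>t. w_bd * (C2 * wnorm F) \<partial>M)"
      proof (rule integral_mono_AE)
        show "AE t in M. cmod (of_real (w t) * U t) \<le> w_bd * (C2 * wnorm F)"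
          using AE_M_in
        proof eventually_elim
          fix t assume t: "t \<in> {c<..<d}"
          then show "cmod (of_real (w t) * U t) \<le> w_bd * (C2 * wnorm F)"
            unfolding norm_mult using w_bd(1) Ub[of t] by (intro mult_mono w_bd(2)) auto
        qed
        show "integrable M (\<lambda>t. w_bd * (C2 * wnorm F))"
          using continuous_integrable[of "\<lambda>_. w_bd * (C2 * wnorm F)"] by simp
      qed (use wU in auto)
      also have "\<dots> = w_bd * (C2 * wnorm F) * (d - c)" using measure_M by simp
      finally show "cmod (prim (\<lambda>t. of_real (w t) * U t) x) \<le> w_bd * (C2 * wnorm F) * (d - c)" .
    qed simp
    also have "\<dots> = C3 * wnorm F" by (simp add: C3_def algebra_simps)
    finally show ?thesis using Ub[OF x] by simp
  qed
  show ?thesis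
  proof (intro exI[of _ "max C2 C3"] allI impI ballI)
    fix U V F x assume *: "isol \<mu> U V F" "sqi F" "U c = 0" "V c = 0" "x \<in> {c..d}"
    have "C2 * wnorm F \<le> max C2 C3 * wnorm F" "C3 * wnorm F \<le> max C2 C3 * wnorm F"
      by (intro mult_right_mono; simp)+
    with main[OF *] show "cmod (U x) \<le> max C2 C3 * wnorm F \<and> cmod (V x) \<le> max C2 C3 * wnorm F" by linarith
  qed
qed

section \<open>Fundamental solutions\<close>

lemma isol_sol: "isol \<mu> U V F \<Longrightarrow> sol U V (\<lambda>x. \<mu> * U x + F x)"
  by (simp add: isol_def)

lemma isol_cont: "isol \<mu> U V F \<Longrightarrow> continuous_on {c..d} U" "isol \<mu> U V F \<Longrightarrow> continuous_on {c..d} V"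
  using isol_sol sol_cont by blast+

lemma isol_sqi: "isol \<mu> U V F \<Longrightarrow> sqi U"
  by (intro sqi_continuous isol_cont)

lemma isol_lin:
  assumes "isol \<mu> U V F" "isol \<mu> X Y H"
  shows "isol \<mu> (\<lambda>x. s * U x + X x) (\<lambda>x. s * V x + Y x) (\<lambda>x. s * F x + H x)"
proof -
  have "(\<lambda>x. s * (\<mu> * U x + F x) + (\<mu> * X x + H x)) = (\<lambda>x. \<mu> * (s * U x + X x) + (s * F x + H x))"
    by (simp add: fun_eq_iff algebra_simps)
  then show ?thesis using sol_lin[OF isol_sol[OF assms(1)] isol_sol[OF assms(2)], of s] by (simp add: isol_def)
qed

lemma isol_add:
  "isol \<mu> U V F \<Longrightarrow> isol \<mu> X Y H \<Longrightarrow> isol \<mu> (\<lambda>x. U x + X x) (\<lambda>x. V x + Y x) (\<lambda>x. F x + H x)"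
  using isol_lin[of \<mu> U V F X Y H 1] by simp

lemma isol_zero: "isol \<mu> (\<lambda>x. 0) (\<lambda>x. 0) (\<lambda>x. 0)"
  using AC_const[of 0] sqi_continuous[of "\<lambda>_. 0"] by (simp add: isol_def sol_def)

lemma isol_scale: "isol \<mu> U V F \<Longrightarrow> isol \<mu> (\<lambda>x. s * U x) (\<lambda>x. s * V x) (\<lambda>x. s * F x)"
  using isol_lin[OF _ isol_zero, of \<mu> U V F s] by simp

lemma wnorm_zero: "wnorm (\<lambda>x. 0) = 0"
  by (simp add: wnorm_def)

lemma ivp_unique:
  assumes s: "isol \<mu> U V F" and t: "isol \<mu> X Y F" and eq: "U c = X c" "V c = Y c" and x: "x \<in> {c..d}"
  shows "U x = X x" "V x = Y x"
proof -
  have "isol \<mu> (\<lambda>x. U x + (-1) * X x) (\<lambda>x. V x + (-1) * Y x) (\<lambda>x. F x + (-1) * F x)"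
    by (intro isol_add isol_scale s t)
  then have i: "isol \<mu> (\<lambda>x. U x - X x) (\<lambda>x. V x - Y x) (\<lambda>x. 0)" by simp
  obtain C where C: "\<And>U V F x. isol \<mu> U V F \<Longrightarrow> sqi F \<Longrightarrow> U c = 0 \<Longrightarrow> V c = 0 \<Longrightarrow> x \<in> {c..d} \<Longrightarrow>
    cmod (U x) \<le> C * wnorm F \<and> cmod (V x) \<le> C * wnorm F"
    using ivp_bound[of \<mu>] by blast
  show "U x = X x" "V x = Y x"
    using C[OF i _ _ _ x] eq sqi_continuous[of "\<lambda>_. 0"] by (auto simp: wnorm_zero)
qed

definition ivp :: "complex \<Rightarrow> (real \<Rightarrow> complex) \<Rightarrow> complex \<Rightarrow> complex \<Rightarrow> (real \<Rightarrow> complex) \<times> (real \<Rightarrow> complex)"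
  where "ivp \<mu> F \<alpha> \<beta> = (SOME UV. isol \<mu> (fst UV) (snd UV) F \<and> fst UV c = \<alpha> \<and> snd UV c = \<beta>)"

lemma ivp:
  assumes "sqi F"
  shows "isol \<mu> (fst (ivp \<mu> F \<alpha> \<beta>)) (snd (ivp \<mu> F \<alpha> \<beta>)) F"
    "fst (ivp \<mu> F \<alpha> \<beta>) c = \<alpha>" "snd (ivp \<mu> F \<alpha> \<beta>) c = \<beta>"
proof -
  have "\<exists>UV. isol \<mu> (fst UV) (snd UV) F \<and> fst UV c = \<alpha> \<and> snd UV c = \<beta>"
    using ivp_exists[OF assms, of \<mu> \<alpha> \<beta>] by auto
  from someI_ex[OF this]
  show "isol \<mu> (fst (ivp \<mu> F \<alpha> \<beta>)) (snd (ivp \<mu> F \<alpha> \<beta>)) F"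
    "fst (ivp \<mu> F \<alpha> \<beta>) c = \<alpha>" "snd (ivp \<mu> F \<alpha> \<beta>) c = \<beta>" by (auto simp: ivp_def)
qed

text \<open>
  \<open>(U1, V1)\<close> and \<open>(U2, V2)\<close> are the homogeneous solutions with initial data \<open>(1, 0)\<close> and \<open>(0, 1)\<close> at
  \<open>c\<close>; \<open>(UP, VP)\<close> is the particular solution with zero initial data.
\<close>

definition U1 where "U1 \<mu> = fst (ivp \<mu> (\<lambda>_. 0) 1 0)"
definition V1 where "V1 \<mu> = snd (ivp \<mu> (\<lambda>_. 0) 1 0)"
definition U2 where "U2 \<mu> = fst (ivp \<mu> (\<lambda>_. 0) 0 1)"
definition V2 where "V2 \<mu> = snd (ivp \<mu> (\<lambda>_. 0) 0 1)"
definition UP where "UP \<mu> F = fst (ivp \<mu> F 0 0)"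
definition VP where "VP \<mu> F = snd (ivp \<mu> F 0 0)"

lemma sqi_zero: "sqi (\<lambda>_. 0)"
  by (rule sqi_continuous) auto

lemma fundamental:
  "isol \<mu> (U1 \<mu>) (V1 \<mu>) (\<lambda>_. 0)" "U1 \<mu> c = 1" "V1 \<mu> c = 0"
  "isol \<mu> (U2 \<mu>) (V2 \<mu>) (\<lambda>_. 0)" "U2 \<mu> c = 0" "V2 \<mu> c = 1"
  using ivp[OF sqi_zero] by (auto simp: U1_def V1_def U2_def V2_def)

lemma particular: "sqi F \<Longrightarrow> isol \<mu> (UP \<mu> F) (VP \<mu> F) F" "sqi F \<Longrightarrow> UP \<mu> F c = 0" "sqi F \<Longrightarrow> VP \<mu> F c = 0"
  using ivp by (auto simp: UP_def VP_def)

lemma general_isol: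
  assumes "sqi F"
  shows "isol \<mu> (\<lambda>x. UP \<mu> F x + (\<alpha> * U1 \<mu> x + \<beta> * U2 \<mu> x)) (\<lambda>x. VP \<mu> F x + (\<alpha> * V1 \<mu> x + \<beta> * V2 \<mu> x)) F"
  using isol_add[OF particular(1)[OF assms, of \<mu>]
      isol_add[OF isol_scale[OF fundamental(1)[of \<mu>], where s = \<alpha>] isol_scale[OF fundamental(4)[of \<mu>], where s = \<beta>]]]
  by simp

lemma isol_decomp:
  assumes s: "isol \<mu> U V F" and F: "sqi F" and x: "x \<in> {c..d}"
  shows "U x = UP \<mu> F x + (U c * U1 \<mu> x + V c * U2 \<mu> x)"
    "V x = VP \<mu> F x + (U c * V1 \<mu> x + V c * V2 \<mu> x)"
  using ivp_unique[OF s general_isol[OF F, of \<mu> "U c" "V c"] _ _ x] F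
  by (simp_all add: fundamental particular)

lemma isol_homogeneous:
  assumes s: "isol \<mu> U V (\<lambda>_. 0)" and x: "x \<in> {c..d}"
  shows "U x = U c * U1 \<mu> x + V c * U2 \<mu> x" "V x = U c * V1 \<mu> x + V c * V2 \<mu> x"
proof -
  have "UP \<mu> (\<lambda>_. 0) x = 0 \<and> VP \<mu> (\<lambda>_. 0) x = 0"
    using ivp_unique[OF particular(1)[OF sqi_zero] isol_zero _ _ x] particular[OF sqi_zero] by simp
  then show "U x = U c * U1 \<mu> x + V c * U2 \<mu> x" "V x = U c * V1 \<mu> x + V c * V2 \<mu> x"
    using isol_decomp[OF s sqi_zero x] by simp_all
qed

text \<open>
  By the Lagrange identity the Wronskian has the same value at \<open>d\<close> as at \<open>c\<close>.
\<close>

lemma wronskian: "U1 \<mu> d * V2 \<mu> d - V1 \<mu> d * U2 \<mu> d = 1"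
proof -
  have "(\<integral>x. of_real (w x) * ((\<mu> * U1 \<mu> x + 0) * U2 \<mu> x - U1 \<mu> x * (\<mu> * U2 \<mu> x + 0)) \<partial>M) = 0"
    by (simp add: mult.left_commute mult.assoc)
  with lagrange_identity[OF isol_sol[OF fundamental(1)] isol_sol[OF fundamental(4)], of \<mu> \<mu>]
  show ?thesis by (simp add: fundamental)
qed

text \<open>
  The bridge between the operators on classes and the differential equation: an equation with the shifted
  operator means that the right-hand side \<open>F\<close> of \<open>U\<close> agrees with \<open>\<mu> U + f\<close> almost everywhere.
\<close>

lemma shift_isol:
  assumes s: "sol U V F" and f: "sqi f"
  shows "sturm_expr c d p w (cls U) - \<mu> *\<^sub>C cls U = cls f \<longleftrightarrow> isol \<mu> U V f"
proof -
  have m: "U \<in> borel_measurable M" "F \<in> borel_measurable M" "f \<in> borel_measurable M"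
    using continuous_measurable[OF sol_cont(1)[OF s]] sqi_measurable[OF solD(3)[OF s]] sqi_measurable[OF f] by auto
  have m': "(\<lambda>x. F x - \<mu> * U x) \<in> borel_measurable M" "(\<lambda>x. \<mu> * U x + f x) \<in> borel_measurable M"
     "(\<lambda>x. \<mu> * U x) \<in> borel_measurable M"
    using m by auto
  have "sturm_expr c d p w (cls U) - \<mu> *\<^sub>C cls U = cls (\<lambda>x. F x - \<mu> * U x)"
    using m m' by (simp add: sol_H2(3)[OF s] cls_scale cls_diff)
  moreover have "cls (\<lambda>x. F x - \<mu> * U x) = cls f \<longleftrightarrow> (AE x in M. F x - \<mu> * U x = f x)"
    using m m' by (intro cls_eq_iff) auto
  moreover have "(AE x in M. F x - \<mu> * U x = f x) \<longleftrightarrow> isol \<mu> U V f"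
  proof
    assume "AE x in M. F x - \<mu> * U x = f x"
    then have "AE x in M. \<mu> * U x + f x = F x" by eventually_elim (auto simp: algebra_simps)
    then show "isol \<mu> U V f" unfolding isol_def by (rule sol_cong[OF s _ m'(2)])
  next
    assume "isol \<mu> U V f"
    then have "AE x in M. F x = \<mu> * U x + f x" using sol_eq(3)[OF s isol_sol refl] by blast
    then show "AE x in M. F x - \<mu> * U x = f x" by eventually_elim simp
  qed
  ultimately show ?thesis by simp
qed

lemma shift_cls:
  assumes s: "isol \<mu> U V f" and f: "sqi f"
  shows "sturm_expr c d p w (cls U) - \<mu> *\<^sub>C cls U = cls f"
  using shift_isol[OF isol_sol[OF s] f] s by simp

lemma cls_eq_0D:
  assumes s: "isol \<mu> U V F" and z: "cls U = 0" and x: "x \<in> {c..d}" shows "U x = 0" "V x = 0"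
  using sol_eq(1,2)[OF isol_sol[OF s] isol_sol[OF isol_zero[of \<mu>]], of x] z x by (simp_all add: cls_zero)

lemma cls_cong_Icc:
  assumes "isol \<mu> U V F" "\<And>x. x \<in> {c..d} \<Longrightarrow> X x = U x" shows "cls X = cls U"
  unfolding cls_def using assms(2) by (intro arg_cong[where f = abs_aefun]) (auto simp: fun_eq_iff)

lemma cls_U2_nonzero: "cls (U2 \<mu>) \<noteq> 0"
  using cls_eq_0D(2)[OF fundamental(4), of \<mu> c] c_less_d by (auto simp: fundamental)

lemma L2_vecs_w: "vecs (L2 w {c<..<d}) = sq_cls"
  by (rule L2_vecs[OF w_cont w_pos])

lemma L2_nrm_w: "sqi f \<Longrightarrow> nrm (L2 w {c<..<d}) (cls f) = wnorm f"
  using L2_nrm[OF _ w_meas] by (simp add: wnorm_def)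

lemma sturm_lin:
  assumes s: "sol U V F" and t: "sol X Y H"
  shows "s *\<^sub>C cls U + cls X = cls (\<lambda>x. s * U x + X x)"
    "sturm_expr c d p w (cls (\<lambda>x. s * U x + X x)) = s *\<^sub>C sturm_expr c d p w (cls U) + sturm_expr c d p w (cls X)"
proof -
  have m: "U \<in> borel_measurable M" "X \<in> borel_measurable M" "F \<in> borel_measurable M" "H \<in> borel_measurable M"
    using continuous_measurable sol_cont(1) sqi_measurable solD(3) s t by blast+
  then show "s *\<^sub>C cls U + cls X = cls (\<lambda>x. s * U x + X x)" by (simp add: cls_scale cls_add)
  show "sturm_expr c d p w (cls (\<lambda>x. s * U x + X x)) = s *\<^sub>C sturm_expr c d p w (cls U) + sturm_expr c d p w (cls X)"
    using m by (simp add: sol_H2(3)[OF s] sol_H2(3)[OF t] sol_H2(3)[OF sol_lin[OF s t]] cls_scale cls_add)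
qed

lemma cls_in_sq: "sqi f \<Longrightarrow> cls f \<in> sq_cls"
  by (auto simp: sq_cls_def)

lemma zero_in_sq: "0 \<in> sq_cls"
  using cls_in_sq[OF sqi_zero] by (simp add: cls_zero)

lemma wnorm_sup:
  assumes f: "sqi f" and B: "0 \<le> B" "\<And>x. x \<in> {c<..<d} \<Longrightarrow> cmod (f x) \<le> B"
  shows "wnorm f \<le> sqrt wtotal * B"
proof -
  have "(\<integral>x. w x * (cmod (f x))\<^sup>2 \<partial>M) \<le> (\<integral>x. w x * B\<^sup>2 \<partial>M)"
  proof (rule integral_mono_AE)
    show "AE x in M. w x * (cmod (f x))\<^sup>2 \<le> w x * B\<^sup>2" using AE_M_in
    proof eventually_elim
      fix x assume x: "x \<in> {c<..<d}"
      then show "w x * (cmod (f x))\<^sup>2 \<le> w x * B\<^sup>2"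
        using B(2)[OF x] w_pos[of x] by (intro mult_left_mono power_mono) auto
    qed
  qed (use w_int wsq_integrable[OF f] in auto)
  also have "\<dots> = wtotal * B\<^sup>2" by (simp add: wtotal_def)
  finally have "wnorm f \<le> sqrt (wtotal * B\<^sup>2)" unfolding wnorm_def by (rule real_sqrt_le_mono)
  then show ?thesis using B(1) by (simp add: real_sqrt_mult)
qed

section \<open>The boundary value problem\<close>

text \<open>
  Both scalar problems have a Dirichlet condition at the left end point.  At the right end point the
  flag selects the Neumann condition, for \<open>A\<^sub>1\<close>, or the Dirichlet condition, for \<open>A\<^sub>2\<close> restricted to
  functions that vanish at \<open>0\<close>.
\<close>

definition bc :: "bool \<Rightarrow> (real \<Rightarrow> complex) \<Rightarrow> (real \<Rightarrow> complex) \<Rightarrow> complex"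
  where "bc N U V = (if N then V d else U d)"

definition T :: "bool \<Rightarrow> aefun lin_op"
  where "T N = \<lparr> op_dom = {cls U | U V F. sol U V F \<and> U c = 0 \<and> bc N U V = 0}, op_app = sturm_expr c d p w \<rparr>"

text \<open>
  The characteristic function: \<open>U2 \<mu>\<close> spans the homogeneous solutions that satisfy the left
  condition, and \<open>\<mu>\<close> is an eigenvalue if it satisfies the right condition as well.
\<close>

definition char_fun :: "bool \<Rightarrow> complex \<Rightarrow> complex"
  where "char_fun N \<mu> = bc N (U2 \<mu>) (V2 \<mu>)"

lemma T_shift: "op_app (op_shift (T N) \<mu>) u = sturm_expr c d p w u - \<mu> *\<^sub>C u"
  by (simp add: op_shift_def T_def)

lemma T_solI: "sol U V F \<Longrightarrow> U c = 0 \<Longrightarrow> bc N U V = 0 \<Longrightarrow> cls U \<in> op_dom (T N)"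
  unfolding T_def by auto

lemma T_domI: "isol \<mu> U V f \<Longrightarrow> U c = 0 \<Longrightarrow> bc N U V = 0 \<Longrightarrow> cls U \<in> op_dom (T N)"
  by (rule T_solI[OF isol_sol])

lemma T_domE:
  assumes "u \<in> op_dom (T N)"
  obtains U V f where "isol \<mu> U V f" "sqi f" "u = cls U" "U c = 0" "bc N U V = 0"
proof -
  obtain U V F where s: "sol U V F" "U c = 0" "bc N U V = 0" "u = cls U" using assms by (auto simp: T_def)
  have "isol \<mu> U V (\<lambda>x. F x - \<mu> * U x)" using s by (simp add: isol_def)
  moreover have "sqi (\<lambda>x. F x - \<mu> * U x)"
    by (intro sqi_diff sqi_scale sqi_continuous sol_cont[OF s(1)] solD(3)[OF s(1)])
  ultimately show ?thesis using that s by blast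
qed

lemma T_domE_eq:
  assumes "u \<in> op_dom (T N)" "op_app (op_shift (T N) \<mu>) u = cls f" "sqi f"
  obtains U V where "isol \<mu> U V f" "u = cls U" "U c = 0" "bc N U V = 0"
proof -
  obtain U V F where s: "sol U V F" "U c = 0" "bc N U V = 0" "u = cls U" using assms by (auto simp: T_def)
  then have "isol \<mu> U V f" using shift_isol[OF s(1) assms(3), of \<mu>] assms(2) by (simp add: T_shift)
  then show ?thesis using that s by blast
qed

lemma linear_T: "linear_op (T N)"
proof
  show "0 \<in> op_dom (T N)"
    using T_domI[OF isol_zero, of N] by (simp add: cls_zero bc_def)
  fix s u v assume "u \<in> op_dom (T N)" "v \<in> op_dom (T N)"
  then obtain U V F X Y H where
      u: "sol U V F" "U c = 0" "bc N U V = 0" "u = cls U" and v: "sol X Y H" "X c = 0" "bc N X Y = 0" "v = cls X"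
    by (auto simp: T_def)
  have "bc N (\<lambda>x. s * U x + X x) (\<lambda>x. s * V x + Y x) = s * bc N U V + bc N X Y" by (simp add: bc_def)
  then have "cls (\<lambda>x. s * U x + X x) \<in> op_dom (T N)"
    using u v by (intro T_solI[OF sol_lin[OF u(1) v(1), of s]]) auto
  then show "s *\<^sub>C u + v \<in> op_dom (T N) \<and> op_app (T N) (s *\<^sub>C u + v) = s *\<^sub>C op_app (T N) u + op_app (T N) v"
    using sturm_lin[OF u(1) v(1), of s] u v by (simp add: T_def)
qed

lemmas T_dom_closed = linear_op.dom_closed[OF linear_T] and T_app = linear_op.app_add[OF linear_T] linear_op.app_scale[OF linear_T]

lemma bc_lin: "bc N (\<lambda>x. UP \<mu> f x + (\<alpha> * U1 \<mu> x + \<beta> * U2 \<mu> x)) (\<lambda>x. VP \<mu> f x + (\<alpha> * V1 \<mu> x + \<beta> * V2 \<mu> x))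
    = bc N (UP \<mu> f) (VP \<mu> f) + (\<alpha> * bc N (U1 \<mu>) (V1 \<mu>) + \<beta> * char_fun N \<mu>)"
  by (simp add: bc_def char_fun_def)

lemma bc_decomp:
  assumes "isol \<mu> U V f" "sqi f"
  shows "bc N U V = bc N (UP \<mu> f) (VP \<mu> f) + (U c * bc N (U1 \<mu>) (V1 \<mu>) + V c * char_fun N \<mu>)"
  using isol_decomp[OF assms, of d] c_less_d by (simp add: bc_def char_fun_def)

text \<open>
  The boundary value problem solved by shooting: the particular solution is corrected by the multiple of
  \<open>U2\<close> that cancels its right boundary value.
\<close>

definition bvp :: "bool \<Rightarrow> complex \<Rightarrow> (real \<Rightarrow> complex) \<Rightarrow> (real \<Rightarrow> complex) \<times> (real \<Rightarrow> complex)"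
  where "bvp N \<mu> f = (let \<beta> = - bc N (UP \<mu> f) (VP \<mu> f) / char_fun N \<mu> in
    (\<lambda>x. UP \<mu> f x + (0 * U1 \<mu> x + \<beta> * U2 \<mu> x), \<lambda>x. VP \<mu> f x + (0 * V1 \<mu> x + \<beta> * V2 \<mu> x)))"

lemma bvp:
  assumes f: "sqi f" and D: "char_fun N \<mu> \<noteq> 0"
  shows "isol \<mu> (fst (bvp N \<mu> f)) (snd (bvp N \<mu> f)) f" "fst (bvp N \<mu> f) c = 0" "bc N (fst (bvp N \<mu> f)) (snd (bvp N \<mu> f)) = 0"
proof -
  show "isol \<mu> (fst (bvp N \<mu> f)) (snd (bvp N \<mu> f)) f"
    unfolding bvp_def Let_def fst_conv snd_conv by (rule general_isol[OF f])
  show "fst (bvp N \<mu> f) c = 0"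
    unfolding bvp_def Let_def fst_conv snd_conv using f by (simp add: fundamental particular)
  show "bc N (fst (bvp N \<mu> f)) (snd (bvp N \<mu> f)) = 0"
    unfolding bvp_def Let_def fst_conv snd_conv bc_lin using D by simp
qed

lemma bvp_unique:
  assumes f: "sqi f" and D: "char_fun N \<mu> \<noteq> 0" and s: "isol \<mu> U V f" "U c = 0" "bc N U V = 0" and x: "x \<in> {c..d}"
  shows "U x = fst (bvp N \<mu> f) x" "V x = snd (bvp N \<mu> f) x"
proof -
  have "bc N (UP \<mu> f) (VP \<mu> f) + V c * char_fun N \<mu> = 0"
    using bc_decomp[OF s(1) f, of N] s by simp
  then have V: "V c = - bc N (UP \<mu> f) (VP \<mu> f) / char_fun N \<mu>"
    using D by (simp add: field_simps eq_neg_iff_add_eq_0)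
  show "U x = fst (bvp N \<mu> f) x" "V x = snd (bvp N \<mu> f) x"
    using isol_decomp[OF s(1) f x] s(2) V by (simp_all add: bvp_def Let_def)
qed

lemma bvp_bound:
  assumes D: "char_fun N \<mu> \<noteq> 0"
  shows "\<exists>C. \<forall>f x. sqi f \<longrightarrow> x \<in> {c..d} \<longrightarrow>
    cmod (fst (bvp N \<mu> f) x) \<le> C * wnorm f \<and> cmod (snd (bvp N \<mu> f) x) \<le> C * wnorm f"
proof -
  obtain C where C: "\<And>U V F x. isol \<mu> U V F \<Longrightarrow> sqi F \<Longrightarrow> U c = 0 \<Longrightarrow> V c = 0 \<Longrightarrow> x \<in> {c..d} \<Longrightarrow>
    cmod (U x) \<le> C * wnorm F \<and> cmod (V x) \<le> C * wnorm F"
    using ivp_bound[of \<mu>] by blast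
  obtain B1 where B1: "0 < B1" "\<And>x. x \<in> {c..d} \<Longrightarrow> cmod (U2 \<mu> x) \<le> B1"
    using continuous_bounded[OF isol_cont(1)[OF fundamental(4)]] by metis
  obtain B2 where B2: "0 < B2" "\<And>x. x \<in> {c..d} \<Longrightarrow> cmod (V2 \<mu> x) \<le> B2"
    using continuous_bounded[OF isol_cont(2)[OF fundamental(4)]] by metis
  define K where "K = C + C / cmod (char_fun N \<mu>) * (B1 + B2)"
  show ?thesis
  proof (intro exI[of _ K] allI impI)
    fix f x assume f: "sqi f" and x: "x \<in> {c..d}"
    have P: "cmod (UP \<mu> f y) \<le> C * wnorm f" "cmod (VP \<mu> f y) \<le> C * wnorm f" if "y \<in> {c..d}" for y
      using C[OF particular(1)[OF f] f _ _ that] particular f by auto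
    define \<beta> where "\<beta> = - bc N (UP \<mu> f) (VP \<mu> f) / char_fun N \<mu>"
    have "cmod (bc N (UP \<mu> f) (VP \<mu> f)) \<le> C * wnorm f"
      using P[of d] c_less_d by (simp add: bc_def)
    then have b: "cmod \<beta> \<le> C * wnorm f / cmod (char_fun N \<mu>)"
      by (simp add: \<beta>_def norm_divide divide_right_mono)
    have b0: "0 \<le> C * wnorm f / cmod (char_fun N \<mu>)" using b norm_ge_zero[of \<beta>] by linarith
    have "cmod (\<beta> * U2 \<mu> x) \<le> C * wnorm f / cmod (char_fun N \<mu>) * (B1 + B2)"
      "cmod (\<beta> * V2 \<mu> x) \<le> C * wnorm f / cmod (char_fun N \<mu>) * (B1 + B2)"
      unfolding norm_mult using B1(1) B2(1) B1(2)[OF x] B2(2)[OF x] by (intro mult_mono b b0; simp)+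
    note this[THEN norm_triangle_mono[rotated]]
    note UV = this(1)[OF P(1)[OF x]] this(2)[OF P(2)[OF x]]
    have "cmod (UP \<mu> f x + \<beta> * U2 \<mu> x) \<le> C * wnorm f + C * wnorm f / cmod (char_fun N \<mu>) * (B1 + B2)"
      by (rule UV)
    moreover have "cmod (VP \<mu> f x + \<beta> * V2 \<mu> x) \<le> C * wnorm f + C * wnorm f / cmod (char_fun N \<mu>) * (B1 + B2)"
      by (rule UV)
    moreover have "C * wnorm f + C * wnorm f / cmod (char_fun N \<mu>) * (B1 + B2) = K * wnorm f"
      by (simp add: K_def algebra_simps)
    ultimately show "cmod (fst (bvp N \<mu> f) x) \<le> K * wnorm f \<and> cmod (snd (bvp N \<mu> f) x) \<le> K * wnorm f"
      by (simp add: bvp_def Let_def \<beta>_def)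
  qed
qed

definition green :: "bool \<Rightarrow> complex \<Rightarrow> aefun \<Rightarrow> aefun"
  where "green N \<mu> f = cls (fst (bvp N \<mu> (rep_aefun f)))"

lemma sq_cls_rep:
  assumes "f \<in> sq_cls" shows "sqi (rep_aefun f)" "cls (rep_aefun f) = f"
proof -
  obtain g where g: "sqi g" "f = cls g" using assms by (auto simp: sq_cls_def)
  have "AE x in M. g x = rep_aefun f x" using rep_cls[OF sqi_measurable[OF g(1)]] unfolding g(2) by eventually_elim simp
  then show "sqi (rep_aefun f)" by (rule sqi_cong[OF g(1) _ rep_measurable_M])
  show "cls (rep_aefun f) = f"
    using rep_cls'[OF sqi_measurable[OF g(1)]] g(2) by (intro cls_rep) (auto elim: eventually_mono)
qed

lemma green:
  assumes D: "char_fun N \<mu> \<noteq> 0"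
  shows "f \<in> sq_cls \<Longrightarrow> green N \<mu> f \<in> op_dom (T N) \<and> op_app (op_shift (T N) \<mu>) (green N \<mu> f) = f"
    and "u \<in> op_dom (T N) \<Longrightarrow> op_app (op_shift (T N) \<mu>) u \<in> sq_cls \<and> green N \<mu> (op_app (op_shift (T N) \<mu>) u) = u"
    and "\<exists>C. \<forall>f\<in>sq_cls. nrm (L2 w {c<..<d}) (green N \<mu> f) \<le> C * nrm (L2 w {c<..<d}) f"
proof -
  show "green N \<mu> f \<in> op_dom (T N) \<and> op_app (op_shift (T N) \<mu>) (green N \<mu> f) = f" if "f \<in> sq_cls"
    using T_domI[OF bvp[OF sq_cls_rep(1)[OF that] D]] shift_cls[OF bvp(1)[OF sq_cls_rep(1)[OF that] D] sq_cls_rep(1)[OF that]]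
      sq_cls_rep(2)[OF that]
    by (simp add: green_def T_shift)
  show "op_app (op_shift (T N) \<mu>) u \<in> sq_cls \<and> green N \<mu> (op_app (op_shift (T N) \<mu>) u) = u" if u: "u \<in> op_dom (T N)"
  proof -
    obtain U0 V0 g where g: "isol \<mu> U0 V0 g" "sqi g" "u = cls U0" using T_domE[OF u] by metis
    define f where "f = op_app (op_shift (T N) \<mu>) u"
    have "f = cls g" using shift_cls[OF g(1,2)] g by (simp add: f_def T_shift)
    then have f: "f \<in> sq_cls" using g by (simp add: cls_in_sq)
    note r = sq_cls_rep[OF f]
    obtain U V where U: "isol \<mu> U V (rep_aefun f)" "u = cls U" "U c = 0" "bc N U V = 0"
      using T_domE_eq[OF u _ r(1)] r(2) f_def by metis
    have "green N \<mu> f = u" unfolding green_def U(2)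
      using bvp_unique(1)[OF r(1) D U(1,3,4)] by (intro cls_cong_Icc[OF U(1)]) simp
    then show ?thesis using f by (simp add: f_def)
  qed
  obtain C where C: "\<And>f x. sqi f \<Longrightarrow> x \<in> {c..d} \<Longrightarrow>
    cmod (fst (bvp N \<mu> f) x) \<le> C * wnorm f \<and> cmod (snd (bvp N \<mu> f) x) \<le> C * wnorm f"
    using bvp_bound[OF D] by blast
  show "\<exists>C. \<forall>f\<in>sq_cls. nrm (L2 w {c<..<d}) (green N \<mu> f) \<le> C * nrm (L2 w {c<..<d}) f"
  proof (intro exI[of _ "sqrt wtotal * C"] ballI)
    fix f assume f: "f \<in> sq_cls"
    note r = sq_cls_rep[OF f]
    have nf: "nrm (L2 w {c<..<d}) f = wnorm (rep_aefun f)" using L2_nrm_w[OF r(1)] r(2) by simp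
    have s: "sqi (fst (bvp N \<mu> (rep_aefun f)))" using isol_sqi[OF bvp(1)[OF r(1) D]] .
    have "0 \<le> C * wnorm (rep_aefun f)" using C[OF r(1), of c] c_less_d
      by (metis atLeastAtMost_iff less_imp_le norm_ge_zero order_refl order_trans)
    then have "wnorm (fst (bvp N \<mu> (rep_aefun f))) \<le> sqrt wtotal * (C * wnorm (rep_aefun f))"
      using C[OF r(1)] by (intro wnorm_sup[OF s]) auto
    then show "nrm (L2 w {c<..<d}) (green N \<mu> f) \<le> sqrt wtotal * C * nrm (L2 w {c<..<d}) f"
      using L2_nrm_w[OF s] nf by (simp add: green_def mult.assoc)
  qed
qed

theorem spectrum_T: "spectrum (L2 w {c<..<d}) (T N) = {\<mu>. char_fun N \<mu> = 0}"
proof (intro set_eqI iffI)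
  fix \<mu> assume m: "\<mu> \<in> spectrum (L2 w {c<..<d}) (T N)"
  show "\<mu> \<in> {\<mu>. char_fun N \<mu> = 0}"
  proof (rule ccontr)
    assume "\<mu> \<notin> {\<mu>. char_fun N \<mu> = 0}"
    then have D: "char_fun N \<mu> \<noteq> 0" by simp
    obtain C where "\<And>f. f\<in>sq_cls \<Longrightarrow> nrm (L2 w {c<..<d}) (green N \<mu> f) \<le> C * nrm (L2 w {c<..<d}) f"
      using green(3)[OF D] by blast
    then have "\<mu> \<in> resolvent_set (L2 w {c<..<d}) (T N)"
      using green(1,2)[OF D]
    proof (intro linear_op.resolvent_setI[OF linear_T, where S = "green N \<mu>" and C = C])
      fix u assume u: "u \<in> op_dom (T N)" "op_app (op_shift (T N) \<mu>) u = 0"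
      moreover have "op_app (op_shift (T N) \<mu>) 0 = 0"
        using linear_op.app_zero[OF linear_T] by (simp add: op_shift_def)
      ultimately show "u = 0" using green(2)[OF D] linear_op.zero_dom[OF linear_T] by metis
    qed (auto simp: L2_vecs_w)
    with m show False by (simp add: spectrum_def)
  qed
next
  fix \<mu> assume "\<mu> \<in> {\<mu>. char_fun N \<mu> = 0}"
  then have "cls (U2 \<mu>) \<in> op_dom (T N)"
    by (intro T_domI[OF fundamental(4)]) (auto simp: fundamental char_fun_def)
  moreover have "op_app (op_shift (T N) \<mu>) (cls (U2 \<mu>)) = 0"
    using shift_cls[OF fundamental(4) sqi_zero] by (simp add: T_shift cls_zero)
  ultimately show "\<mu> \<in> spectrum (L2 w {c<..<d}) (T N)"
    using cls_U2_nonzero by (intro linear_op.spectrumI[OF linear_T]) auto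
qed

text \<open>
  The boundary terms of the Lagrange identity vanish, which is the symmetry of the operators \<open>T N\<close>.
\<close>

lemma bc_boundary:
  assumes "U c = 0" "X c = 0" "bc N U V = 0" "bc N X Y = 0"
  shows "(U d * Y d - V d * X d) - (U c * Y c - V c * X c) = 0"
  using assms by (cases N) (simp_all add: bc_def)

lemma wsq_eq: "sqi f \<Longrightarrow> (\<integral>x. of_real (w x) * (f x * cnj (f x)) \<partial>M) = of_real ((wnorm f)\<^sup>2)"
proof -
  assume f: "sqi f"
  have "(\<integral>x. of_real (w x) * (f x * cnj (f x)) \<partial>M) = (\<integral>x. complex_of_real (w x * (cmod (f x))\<^sup>2) \<partial>M)"
    by (simp only: of_real_mult complex_norm_square)
  also have "\<dots> = of_real (\<integral>x. w x * (cmod (f x))\<^sup>2 \<partial>M)" by (rule integral_complex_of_real)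
  finally show ?thesis using wint_nonneg[of f] by (simp add: wnorm_def)
qed

lemma wnorm_0_iff: "sqi f \<Longrightarrow> wnorm f = 0 \<longleftrightarrow> cls f = 0"
proof -
  assume f: "sqi f"
  have "wnorm f = 0 \<longleftrightarrow> (\<integral>x. w x * (cmod (f x))\<^sup>2 \<partial>M) = 0" by (simp add: wnorm_def)
  also have "\<dots> \<longleftrightarrow> (AE x in M. w x * (cmod (f x))\<^sup>2 = 0)"
    using AE_w_pos by (intro integral_nonneg_eq_0_iff_AE[OF wsq_integrable[OF f]]) (auto elim!: eventually_mono)
  also have "\<dots> \<longleftrightarrow> (AE x in M. f x = 0)"
  proof
    assume "AE x in M. w x * (cmod (f x))\<^sup>2 = 0"
    with AE_w_pos show "AE x in M. f x = 0" by eventually_elim auto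
  next
    assume "AE x in M. f x = 0"
    then show "AE x in M. w x * (cmod (f x))\<^sup>2 = 0" by eventually_elim simp
  qed
  also have "\<dots> \<longleftrightarrow> cls f = 0"
    using cls_eq_iff[OF sqi_measurable[OF f] sqi_measurable[OF sqi_zero]] by (simp add: cls_zero)
  finally show ?thesis .
qed

lemma isol_cnj: "isol \<mu> U V F \<Longrightarrow> isol (cnj \<mu>) (\<lambda>x. cnj (U x)) (\<lambda>x. cnj (V x)) (\<lambda>x. cnj (F x))"
  using sol_cnj[of U V "\<lambda>x. \<mu> * U x + F x"] by (simp add: isol_def)

lemma bc_cnj: "bc N U V = 0 \<Longrightarrow> bc N (\<lambda>x. cnj (U x)) (\<lambda>x. cnj (V x)) = 0"
  by (auto simp: bc_def split: if_splits)

text \<open>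
  Let \<open>\<phi> = U2 \<mu>\<close> be an eigenfunction.  The Lagrange identity for \<open>\<phi>\<close> and its conjugate gives
  \<open>(\<mu> - cnj \<mu>) \<parallel>\<phi>\<parallel>\<^sup>2 = 0\<close>, so \<open>\<mu>\<close> is real.  If the particular solution \<open>P\<close> of \<open>(T N - \<mu>) P = \<phi>\<close>
  satisfied the right boundary condition, the identity for \<open>P\<close> and \<open>cnj \<phi>\<close> would give
  \<open>\<parallel>\<phi>\<parallel>\<^sup>2 = 0\<close>.
\<close>

theorem no_adjoined_function:
  assumes D: "char_fun N \<mu> = 0" shows "bc N (UP \<mu> (U2 \<mu>)) (VP \<mu> (U2 \<mu>)) \<noteq> 0"
proof
  assume P: "bc N (UP \<mu> (U2 \<mu>)) (VP \<mu> (U2 \<mu>)) = 0"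
  have s: "sqi (U2 \<mu>)" using isol_sqi[OF fundamental(4)] .
  have pos: "wnorm (U2 \<mu>) \<noteq> 0" using wnorm_0_iff[OF s] cls_U2_nonzero by simp
  have b: "bc N (U2 \<mu>) (V2 \<mu>) = 0" using D by (simp add: char_fun_def)
  note cs = isol_sol[OF isol_cnj[OF fundamental(4)[of \<mu>]]]
  have "(\<integral>x. of_real (w x) * ((\<mu> * U2 \<mu> x + 0) * cnj (U2 \<mu> x) - U2 \<mu> x * (cnj \<mu> * cnj (U2 \<mu> x) + cnj 0)) \<partial>M) = 0"
    unfolding lagrange_identity[OF isol_sol[OF fundamental(4)[of \<mu>]] cs, symmetric]
    by (intro bc_boundary[where N = N] b bc_cnj) (simp_all add: fundamental)
  also have "(\<lambda>x. of_real (w x) * ((\<mu> * U2 \<mu> x + 0) * cnj (U2 \<mu> x) - U2 \<mu> x * (cnj \<mu> * cnj (U2 \<mu> x) + cnj 0)))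
      = (\<lambda>x. (\<mu> - cnj \<mu>) * (of_real (w x) * (U2 \<mu> x * cnj (U2 \<mu> x))))"
    by (simp add: fun_eq_iff algebra_simps)
  finally have "(\<mu> - cnj \<mu>) * of_real ((wnorm (U2 \<mu>))\<^sup>2) = 0" by (simp only: integral_mult_right_zero wsq_eq[OF s])
  then have mu: "cnj \<mu> = \<mu>" using pos by simp
  have "(\<integral>x. of_real (w x) * ((\<mu> * UP \<mu> (U2 \<mu>) x + U2 \<mu> x) * cnj (U2 \<mu> x)
      - UP \<mu> (U2 \<mu>) x * (cnj \<mu> * cnj (U2 \<mu> x) + cnj 0)) \<partial>M) = 0"
    unfolding lagrange_identity[OF isol_sol[OF particular(1)[OF s, of \<mu>]] cs, symmetric]
    by (intro bc_boundary[where N = N] b bc_cnj P) (simp_all add: fundamental particular[OF s])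
  also have "(\<lambda>x. of_real (w x) * ((\<mu> * UP \<mu> (U2 \<mu>) x + U2 \<mu> x) * cnj (U2 \<mu> x)
      - UP \<mu> (U2 \<mu>) x * (cnj \<mu> * cnj (U2 \<mu> x) + cnj 0))) = (\<lambda>x. of_real (w x) * (U2 \<mu> x * cnj (U2 \<mu> x)))"
    by (simp add: fun_eq_iff mu algebra_simps)
  finally show False using pos by (simp add: wsq_eq[OF s])
qed

section \<open>Completeness of the eigenfunctions\<close>

definition ipw :: "aefun \<Rightarrow> aefun \<Rightarrow> complex"
  where "ipw u v = (\<integral>x. of_real (w x) * (rep_aefun u x * cnj (rep_aefun v x)) \<partial>M)"

lemma w_mult_integrable: "sqi f \<Longrightarrow> sqi g \<Longrightarrow> integrable M (\<lambda>x. of_real (w x) * (f x * cnj (g x)))"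
  by (intro volterra_inner(1) sqi_mult_integrable sqi_cnj)

lemma ipw_cls:
  assumes "sqi f" "sqi g" shows "ipw (cls f) (cls g) = (\<integral>x. of_real (w x) * (f x * cnj (g x)) \<partial>M)"
  unfolding ipw_def
proof (rule integral_cong_AE)
  show "AE x in M. of_real (w x) * (rep_aefun (cls f) x * cnj (rep_aefun (cls g) x)) = of_real (w x) * (f x * cnj (g x))"
    using rep_cls[OF sqi_measurable[OF assms(1)]] rep_cls[OF sqi_measurable[OF assms(2)]] by eventually_elim simp
  show "(\<lambda>x. of_real (w x) * (rep_aefun (cls f) x * cnj (rep_aefun (cls g) x))) \<in> borel_measurable M"
    using w_mult_integrable[OF sq_cls_rep(1)[OF cls_in_sq] sq_cls_rep(1)[OF cls_in_sq], OF assms] by auto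
qed (use w_mult_integrable[OF assms] in auto)

lemma sq_clsE: "u \<in> sq_cls \<Longrightarrow> (\<And>f. sqi f \<Longrightarrow> u = cls f \<Longrightarrow> thesis) \<Longrightarrow> thesis"
  by (auto simp: sq_cls_def)

lemma sq_cls_add: "sqi f \<Longrightarrow> sqi g \<Longrightarrow> cls f + cls g = cls (\<lambda>x. f x + g x)"
  and sq_cls_diff: "sqi f \<Longrightarrow> sqi g \<Longrightarrow> cls f - cls g = cls (\<lambda>x. f x - g x)"
  and sq_cls_scale: "sqi f \<Longrightarrow> a *\<^sub>C cls f = cls (\<lambda>x. a * f x)"
  by (simp_all add: cls_add cls_diff cls_scale sqi_measurable)

lemma pre_hilbert_ipw: "pre_hilbert sq_cls ipw"
proof
  show "complex_vector.subspace sq_cls"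
    unfolding complex_vector.subspace_def
    by (auto simp: zero_in_sq sq_cls_add sq_cls_scale intro!: cls_in_sq sqi_add sqi_scale elim!: sq_clsE)
next
  fix x y z assume "x \<in> sq_cls" "y \<in> sq_cls" "z \<in> sq_cls"
  then obtain f g h where *: "sqi f" "x = cls f" "sqi g" "y = cls g" "sqi h" "z = cls h" by (metis sq_clsE)
  show "ipw (x + y) z = ipw x z + ipw y z"
    using * w_mult_integrable[OF *(1) *(5)] w_mult_integrable[OF *(3) *(5)]
    by (simp add: sq_cls_add ipw_cls sqi_add ring_distribs)
next
  fix a x z assume "x \<in> sq_cls" "z \<in> sq_cls"
  then obtain f h where *: "sqi f" "x = cls f" "sqi h" "z = cls h" by (metis sq_clsE)
  show "ipw (a *\<^sub>C x) z = a * ipw x z"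
    using * by (simp add: sq_cls_scale ipw_cls sqi_scale mult.assoc mult.left_commute[of _ a])
next
  fix x y assume "x \<in> sq_cls" "y \<in> sq_cls"
  then obtain f g where *: "sqi f" "x = cls f" "sqi g" "y = cls g" by (metis sq_clsE)
  have "cnj (ipw x y) = (\<integral>x. cnj (of_real (w x) * (f x * cnj (g x))) \<partial>M)"
    using * by (subst Bochner_Integration.integral_cnj) (simp add: ipw_cls)
  then show "ipw y x = cnj (ipw x y)" using * by (simp add: ipw_cls mult.commute)
next
  fix x assume "x \<in> sq_cls" "x \<noteq> 0"
  then obtain f where *: "sqi f" "x = cls f" by (metis sq_clsE)
  have "wnorm f \<noteq> 0" using wnorm_0_iff * \<open>x \<noteq> 0\<close> by simp
  then have "0 < (wnorm f)\<^sup>2" by simp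
  then show "0 < Re (ipw x x)" using * by (simp add: ipw_cls wsq_eq del: of_real_power)
qed

lemma nm_L2: "u \<in> sq_cls \<Longrightarrow> pre_hilbert.nm ipw u = nrm (L2 w {c<..<d}) u"
  by (auto simp: sq_cls_def pre_hilbert.nm_def[OF pre_hilbert_ipw] ipw_cls wsq_eq L2_nrm_w simp del: of_real_power)

text \<open>
  For \<open>\<mu> = 0\<close> the solution is explicit: \<open>V2 = 1\<close> and \<open>U2 d = \<integral> 1 / p\<close>, which is positive.
\<close>

lemma char_fun_0: "char_fun N 0 \<noteq> 0"
proof -
  have s: "sol (U2 0) (V2 0) (\<lambda>_. 0)" using isol_sol[OF fundamental(4)[of 0]] by simp
  have V: "V2 0 x = 1" if "x \<in> {c..d}" for x
  proof -
    have "prim (\<lambda>x. 0) x = 0" using prim_scale[of 0 "\<lambda>_. 0"] by simp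
    then show ?thesis using AC_eq[OF solD(2)[OF s] that] by (simp add: fundamental)
  qed
  have "U2 0 d = (\<integral>x. V2 0 x / of_real (p x) \<partial>M)"
    using AC_right[OF solD(1)[OF s]] by (simp add: fundamental)
  also have "\<dots> = (\<integral>x. complex_of_real (1 / p x) \<partial>M)"
    by (intro Bochner_Integration.integral_cong refl) (simp add: V)
  finally have U: "U2 0 d = of_real (\<integral>x. 1 / p x \<partial>M)" by (simp only: integral_complex_of_real)
  have pi: "integrable M (\<lambda>x. 1 / p x)"
    using p_pos by (intro continuous_integrable continuous_intros p_cont) (metis less_irrefl)
  have pp: "AE x in M. 0 < 1 / p x" using AE_M_in by eventually_elim (use p_pos in auto)
  have "(\<integral>x. 1 / p x \<partial>M) \<noteq> 0"
  proof
    assume "(\<integral>x. 1 / p x \<partial>M) = 0"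
    moreover have "AE x in M. 0 \<le> 1 / p x" using pp by eventually_elim simp
    ultimately have "AE x in M. 1 / p x = 0" using integral_nonneg_eq_0_iff_AE[OF pi] by simp
    with pp have "AE x in M. False" by eventually_elim simp
    then have "emeasure M (space M) = 0" by (simp add: eventually_False ae_filter_eq_bot_iff)
    then show False using c_less_d by (simp add: emeasure_restrict_space)
  qed
  then show ?thesis using U V[of d] c_less_d by (auto simp: char_fun_def bc_def)
qed

lemma op_shift_0: "op_app (op_shift (T N) 0) u = op_app (T N) u"
  by (simp add: op_shift_def)

lemma T_dom_sq: "u \<in> op_dom (T N) \<Longrightarrow> u \<in> sq_cls"
  using isol_sqi cls_in_sq by (metis T_domE)

text \<open>
  Symmetry is the Lagrange identity.  For compactness, the solutions belonging to right-hand sides in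
  the unit ball and their fluxes are uniformly bounded; a bound for the fluxes makes the solutions
  equicontinuous, and the theorem of Arzela and Ascoli yields a uniformly convergent subsequence.
\<close>

lemma compact_symmetric_green: "compact_symmetric sq_cls ipw (green N 0)"
proof -
  interpret pre_hilbert sq_cls ipw by (rule pre_hilbert_ipw)
  note G1 = green(1)[OF char_fun_0, of _ N, unfolded op_shift_0] and G2 = green(2)[OF char_fun_0, of _ N, unfolded op_shift_0]
  note nm = nm_L2
  show ?thesis
  proof
    show in_sq: "green N 0 x \<in> sq_cls" if "x \<in> sq_cls" for x using G1[OF that] T_dom_sq by blast
    show "green N 0 (x + y) = green N 0 x + green N 0 y" if "x \<in> sq_cls" "y \<in> sq_cls" for x y
      using G2[of "green N 0 x + green N 0 y"] G1[OF that(1)] G1[OF that(2)] T_dom_closed T_app by metis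
    show "green N 0 (a *\<^sub>C x) = a *\<^sub>C green N 0 x" if "x \<in> sq_cls" for a x
      using G2[of "a *\<^sub>C green N 0 x"] G1[OF that] T_dom_closed T_app by metis
    show "ipw (green N 0 x) y = ipw x (green N 0 y)" if xs: "x \<in> sq_cls" and ys: "y \<in> sq_cls" for x y
    proof -
      obtain f g where *: "sqi f" "x = cls f" "sqi g" "y = cls g" using xs ys by (metis sq_clsE)
      obtain U V where U: "isol 0 U V f" "green N 0 x = cls U" "U c = 0" "bc N U V = 0"
        using T_domE_eq[of "green N 0 x" N 0 f] G1[OF xs] *(1,2) unfolding op_shift_0 by blast
      obtain X Y where X: "isol 0 X Y g" "green N 0 y = cls X" "X c = 0" "bc N X Y = 0"
        using T_domE_eq[of "green N 0 y" N 0 g] G1[OF ys] *(3,4) unfolding op_shift_0 by blast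
      have sU: "sqi U" and sX: "sqi X" using U X isol_sqi by blast+
      have "(\<integral>x. of_real (w x) * ((0 * U x + f x) * cnj (X x) - U x * (cnj 0 * cnj (X x) + cnj (g x))) \<partial>M) = 0"
        unfolding lagrange_identity[OF isol_sol[OF U(1)] isol_sol[OF isol_cnj[OF X(1)]], symmetric]
        by (intro bc_boundary[where N = N] bc_cnj U X) (simp add: X)
      then have "(\<integral>x. of_real (w x) * (f x * cnj (X x)) \<partial>M) = (\<integral>x. of_real (w x) * (U x * cnj (g x)) \<partial>M)"
        using w_mult_integrable[OF *(1) sX] w_mult_integrable[OF sU *(3)] by (simp add: right_diff_distrib)
      then show ?thesis using * U X sU sX by (simp add: ipw_cls)
    qed
    obtain C where "\<And>f. f\<in>sq_cls \<Longrightarrow> nrm (L2 w {c<..<d}) (green N 0 f) \<le> C * nrm (L2 w {c<..<d}) f"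
      using green(3)[OF char_fun_0] by blast
    then show "\<exists>C. \<forall>x\<in>sq_cls. nm (green N 0 x) \<le> C * nm x" using nm in_sq by (intro exI[of _ C]) auto
    fix f :: "nat \<Rightarrow> aefun" assume f: "\<And>n. f n \<in> sq_cls" and f1: "\<And>n. nm (f n) \<le> 1"
    define r where "r n = rep_aefun (f n)" for n
    have r: "sqi (r n)" "cls (r n) = f n" for n using sq_cls_rep[OF f[of n]] by (auto simp: r_def)
    have r1: "wnorm (r n) \<le> 1" for n using f1[of n] nm[OF f[of n]] L2_nrm_w[OF r(1)[of n]] r(2)[of n] by simp
    define U where "U n = fst (bvp N 0 (r n))" for n
    define V where "V n = snd (bvp N 0 (r n))" for n
    have s: "isol 0 (U n) (V n) (r n)" for n using bvp(1)[OF r(1)[of n] char_fun_0] by (simp add: U_def V_def)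
    have Gf: "green N 0 (f n) = cls (U n)" for n by (simp add: green_def U_def r_def)
    obtain C where C: "\<And>f x. sqi f \<Longrightarrow> x \<in> {c..d} \<Longrightarrow>
      cmod (fst (bvp N 0 f) x) \<le> C * wnorm f \<and> cmod (snd (bvp N 0 f) x) \<le> C * wnorm f"
      using bvp_bound[OF char_fun_0] by blast
    have bd: "cmod (U n x) \<le> \<bar>C\<bar> \<and> cmod (V n x) \<le> \<bar>C\<bar>" if "x \<in> {c..d}" for n x
    proof -
      have "C * wnorm (r n) \<le> \<bar>C\<bar> * 1" using r1[of n] by (intro mult_mono) auto
      then show ?thesis using C[OF r(1)[of n] that] by (simp add: U_def V_def)
    qed
    have lip: "cmod (U n y - U n x) \<le> p_bd * \<bar>C\<bar> * (y - x)" if "c \<le> x" "x \<le> y" "y \<le> d" for n x y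
    proof -
      note A = solD(1)[OF isol_sol[OF s[of n]]]
      have "U n y - U n x = prim (\<lambda>x. V n x / of_real (p x)) y - prim (\<lambda>x. V n x / of_real (p x)) x"
        using AC_eq[OF A, of x] AC_eq[OF A, of y] that by simp
      also have "cmod \<dots> \<le> p_bd * \<bar>C\<bar> * (y - x)"
      proof (rule prim_diff_le[OF AC_integrable[OF A] that])
        show "AE t in M. cmod (V n t / of_real (p t)) \<le> p_bd * \<bar>C\<bar>"
          using AE_M_in
        proof eventually_elim
          fix t assume t: "t \<in> {c<..<d}"
          have "cmod (1 / of_real (p t)) * cmod (V n t) \<le> p_bd * \<bar>C\<bar>"
            using t p_bd(1) bd[of t n] by (intro mult_mono p_bd(2)) auto
          then show "cmod (V n t / of_real (p t)) \<le> p_bd * \<bar>C\<bar>" by (simp add: norm_divide)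
        qed
      qed
      finally show ?thesis .
    qed
    have lip': "cmod (U n x - U n y) \<le> p_bd * \<bar>C\<bar> * \<bar>x - y\<bar>" if "x \<in> {c..d}" "y \<in> {c..d}" for n x y
      using lip[of x y n] lip[of y x n] that by (cases "x \<le> y") (auto simp: norm_minus_commute)
    have equi: "\<exists>e. 0 < e \<and> (\<forall>n y. y \<in> {c..d} \<and> norm (x - y) < e \<longrightarrow> norm (U n x - U n y) < e')"
      if x: "x \<in> {c..d}" and e': "0 < e'" for x e'
    proof -
      define K where "K = p_bd * \<bar>C\<bar> + 1"
      have K: "0 < K" using p_bd(1) by (simp add: K_def add_nonneg_pos)
      show ?thesis
      proof (intro exI[of _ "e' / K"] conjI allI impI)
        show "0 < e' / K" using K e' by simp
        fix n y assume y: "y \<in> {c..d} \<and> norm (x - y) < e' / K"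
        have "cmod (U n x - U n y) \<le> p_bd * \<bar>C\<bar> * \<bar>x - y\<bar>" using lip' x y by blast
        also have "\<dots> \<le> K * \<bar>x - y\<bar>" by (intro mult_right_mono) (auto simp: K_def)
        also have "\<dots> < e'" using y K by (simp add: field_simps)
        finally show "norm (U n x - U n y) < e'" .
      qed
    qed
    obtain h k where h: "continuous_on {c..d} h" "strict_mono (k :: nat \<Rightarrow> nat)"
        "\<And>e. 0 < e \<Longrightarrow> \<exists>n0. \<forall>n x. n \<ge> n0 \<and> x \<in> {c..d} \<longrightarrow> norm (U (k n) x - h x) < e"
      using Arzela_Ascoli[of "{c..d}" U "\<bar>C\<bar>"] bd equi by (metis compact_Icc)
    have sh: "sqi h" using sqi_continuous[OF h(1)] .
    have "(\<lambda>n. nm (green N 0 (f (k n)) - cls h)) \<longlonglongrightarrow> 0"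
    proof (rule LIMSEQ_I)
      fix e :: real assume e: "0 < e"
      define e' where "e' = e / (sqrt wtotal + 1)"
      have w0: "0 \<le> sqrt wtotal" using wtotal_nonneg by simp
      have e': "0 < e'" using e add_nonneg_pos[OF w0, of 1] by (simp add: e'_def)
      obtain n0 where n0: "\<And>n x. n \<ge> n0 \<Longrightarrow> x \<in> {c..d} \<Longrightarrow> norm (U (k n) x - h x) < e'" using h(3)[OF e'] by blast
      have "norm (nm (green N 0 (f (k n)) - cls h) - 0) < e" if n: "n \<ge> n0" for n
      proof -
        have sU: "sqi (U (k n))" using isol_sqi[OF s] .
        have sd: "sqi (\<lambda>x. U (k n) x - h x)" using sqi_diff[OF sU sh] .
        have "nm (green N 0 (f (k n)) - cls h) = wnorm (\<lambda>x. U (k n) x - h x)"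
          using nm[OF cls_in_sq[OF sd]] L2_nrm_w[OF sd] by (simp add: Gf sq_cls_diff[OF sU sh])
        also have "\<dots> \<le> sqrt wtotal * e'"
          using n0[OF n] e' by (intro wnorm_sup[OF sd]) (auto simp: less_imp_le)
        also have "\<dots> < (sqrt wtotal + 1) * e'" using e' by (simp add: distrib_right)
        also have "\<dots> = e" using add_nonneg_pos[OF w0, of 1] by (simp add: e'_def)
        finally show ?thesis
          using nm[OF cls_in_sq[OF sd]] L2_nrm_w[OF sd] by (simp add: Gf sq_cls_diff[OF sU sh])
      qed
      then show "\<exists>no. \<forall>n\<ge>no. norm (nm (green N 0 (f (k n)) - cls h) - 0) < e" by blast
    qed
    with h(2) cls_in_sq[OF sh]
    show "\<exists>h\<in>sq_cls. \<exists>s. strict_mono s \<and> (\<lambda>n. nm (green N 0 (f (s n)) - h)) \<longlonglongrightarrow> 0" by blast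
  qed
qed

text \<open>
  The polynomials of \<open>polynomial_dense\<close> satisfy both kinds of right boundary conditions, and being smooth
  they are solutions for a continuous right-hand side.
\<close>

lemma T_dom_dense:
  assumes f: "sqi f" and e: "0 < e"
  shows "\<exists>h. cls h \<in> op_dom (T N) \<and> sqi h \<and> sqdist f h < e"
proof -
  obtain h h' where h: "polynomial_function h" and h': "polynomial_function h'" "\<And>x. (h has_vector_derivative h' x) (at x)"
    and zero: "h c = 0" "h d = 0" "h' d = 0" and dist: "sqdist f h < e"
    using polynomial_dense[OF f e] by metis
  obtain h'' where h'': "polynomial_function h''" "\<And>x. (h' has_vector_derivative h'' x) (at x)"
    using has_vector_derivative_polynomial_function[OF h'(1)] by blast
  have cont: "continuous_on {c..d} h" "continuous_on {c..d} h'" "continuous_on {c..d} h''"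
    using h h'(1) h''(1) by (simp_all add: continuous_on_polymonial_function)
  have A: "AC h h'" "AC h' h''"
    using h'(2) h''(2) cont by (auto intro!: AC_deriv intro: has_vector_derivative_at_within)
  obtain p' where p': "AC (\<lambda>x. of_real (p x)) p'" "continuous_on {c..d} p'" by (rule AC_p)
  define V where "V = (\<lambda>x. of_real (p x) * h' x)"
  define F where "F = (\<lambda>x. - 1 / of_real (w x) * (p' x * h' x + of_real (p x) * h'' x))"
  have wc: "continuous_on {c..d} (\<lambda>x. - 1 / complex_of_real (w x))"
    using w_pos by (intro continuous_intros w_cont) (metis less_irrefl of_real_eq_0_iff)
  have Fc: "continuous_on {c..d} F" unfolding F_def
    by (intro continuous_on_mult[OF wc] continuous_intros p' cont p_cont)
  have "sol h V F"
    unfolding sol_def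
  proof (intro conjI sqi_continuous[OF Fc])
    have V: "AC V (\<lambda>x. p' x * h' x + of_real (p x) * h'' x)" using AC_mult[OF p'(1) A(2)] by (simp add: V_def)
    have Vc: "continuous_on {c..d} (\<lambda>x. V x / of_real (p x))"
      using continuous_on_mult[OF AC_continuous[OF V] p_inv_cont] by simp
    show "AC h (\<lambda>x. V x / of_real (p x))"
    proof (rule AC_cong[OF A(1)])
      show "AE x in M. V x / of_real (p x) = h' x"
        using AE_M_in
      proof eventually_elim
        fix x assume "x \<in> {c<..<d}"
        then have "p x \<noteq> 0" using p_pos[of x] by auto
        then show "V x / of_real (p x) = h' x" by (simp add: V_def)
      qed
    qed (use continuous_measurable[OF Vc] in auto)
    show "AC V (\<lambda>x. - of_real (w x) * F x)"
    proof (rule AC_cong[OF V])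
      show "AE x in M. - of_real (w x) * F x = p' x * h' x + of_real (p x) * h'' x"
        using AE_M_in
      proof eventually_elim
        fix x assume "x \<in> {c<..<d}"
        then have "w x \<noteq> 0" using w_pos[of x] by auto
        then show "- of_real (w x) * F x = p' x * h' x + of_real (p x) * h'' x" by (simp add: F_def)
      qed
      show "(\<lambda>x. - of_real (w x) * F x) \<in> borel_measurable M"
        by (rule sqi_measurable[OF w_sqi[OF sqi_continuous[OF Fc]]])
    qed simp
  qed
  moreover have "V d = 0" using zero by (simp add: V_def)
  ultimately have "cls h \<in> op_dom (T N)" using zero by (intro T_solI) (auto simp: bc_def)
  then show ?thesis using dist sqi_continuous[OF cont(1)] by blast
qed

text \<open>
  An element of the dense domain of \<open>T N\<close> is \<open>G v\<close> for the compact symmetric inverse \<open>G\<close>, and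
  \<open>range_approx\<close> approximates \<open>G v\<close> by eigenvectors of \<open>G\<close> for nonzero eigenvalues \<open>l\<close>; these are
  eigenvectors of \<open>T N\<close> for \<open>1 / l\<close>.
\<close>

theorem eigenvectors_complete:
  "complete_in (L2 w {c<..<d}) {u. \<exists>\<mu>. is_eigenvector (T N) \<mu> u}"
proof -
  interpret compact_symmetric sq_cls ipw "green N 0" by (rule compact_symmetric_green)
  note nm = nm_L2
  define S where "S = {u. \<exists>\<mu>. is_eigenvector (T N) \<mu> u}"
  have S_sq: "S \<subseteq> sq_cls" using T_dom_sq by (auto simp: S_def is_eigenvector_def)
  have span_sq: "complex_vector.span S \<subseteq> sq_cls" using S_sq subspace_X by (rule complex_vector.span_minimal)
  have eig: "eigvecs \<subseteq> S"
  proof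
    fix v assume "v \<in> eigvecs"
    then obtain l where v: "v \<in> sq_cls" "v \<noteq> 0" "l \<noteq> 0" "green N 0 v = of_real l *\<^sub>C v" by (auto simp: eigvecs_def)
    have G: "green N 0 v \<in> op_dom (T N)" "op_app (T N) (green N 0 v) = v"
      using green(1)[OF char_fun_0, of v N] v by (auto simp: op_shift_0)
    have "v = of_real (1 / l) *\<^sub>C green N 0 v" using v by (simp add: scaleC_one flip: of_real_mult)
    then have "v \<in> op_dom (T N)" "op_app (T N) v = of_real (1 / l) *\<^sub>C v"
      using T_dom_closed(2)[OF G(1), of "of_real (1 / l)"] T_app(2)[OF G(1), of "of_real (1 / l)"] G(2) by metis+
    then show "v \<in> S" using v by (auto simp: S_def is_eigenvector_def)
  qed
  have "\<exists>g\<in>complex_vector.span S. nrm (L2 w {c<..<d}) (u - g) < e" if u: "u \<in> sq_cls" and e: "0 < e" for u e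
  proof -
    obtain f where f: "sqi f" "u = cls f" using u by (rule sq_clsE)
    obtain Q where Q: "0 < Q" "\<And>x. x \<in> {c..d} \<Longrightarrow> norm (w x) \<le> Q" using continuous_bounded[OF w_cont] by metis
    obtain h where h: "cls h \<in> op_dom (T N)" "sqi h" "sqdist f h < (e / 2)\<^sup>2 / Q"
      using T_dom_dense[OF f(1), of "(e / 2)\<^sup>2 / Q" N] e Q by auto
    have sd: "sqi (\<lambda>x. f x - h x)" using f h by (intro sqi_diff)
    have "(\<integral>x. w x * (cmod (f x - h x))\<^sup>2 \<partial>M) \<le> (\<integral>x. Q * (cmod (f x - h x))\<^sup>2 \<partial>M)"
    proof (rule integral_mono_AE)
      show "AE x in M. w x * (cmod (f x - h x))\<^sup>2 \<le> Q * (cmod (f x - h x))\<^sup>2"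
        using AE_M_in
      proof eventually_elim
        fix x assume "x \<in> {c<..<d}"
        then have "w x \<le> Q" using Q(2)[of x] by auto
        then show "w x * (cmod (f x - h x))\<^sup>2 \<le> Q * (cmod (f x - h x))\<^sup>2" by (rule mult_right_mono) simp
      qed
    qed (use wsq_integrable[OF sd] sq_integrable[OF sd] in auto)
    also have "\<dots> = Q * sqdist f h" by (simp add: sqdist_def)
    also have "\<dots> < (e / 2)\<^sup>2" using h(3) Q(1) by (simp add: pos_less_divide_eq mult.commute)
    finally have "wnorm (\<lambda>x. f x - h x) < e / 2"
      unfolding wnorm_def using e by (intro real_less_lsqrt) auto
    then have 1: "nm (u - cls h) < e / 2"
      using nm[OF cls_in_sq[OF sd]] L2_nrm_w[OF sd] f h by (simp add: sq_cls_diff)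
    define v where "v = op_app (T N) (cls h)"
    have v: "v \<in> sq_cls" "green N 0 v = cls h" using green(2)[OF char_fun_0 h(1)] by (auto simp: v_def op_shift_0)
    \<comment> \<open>Chosen such that \<open>\<epsilon> nm v \<le> e / 2\<close>; the summand \<open>1\<close> covers the case \<open>nm v = 0\<close>.\<close>
    define \<epsilon> where "\<epsilon> = e / (2 * (nm v + 1))"
    have nv: "0 \<le> nm v" using v by simp
    have ep: "0 < \<epsilon>" using e nv by (simp add: \<epsilon>_def)
    obtain g where g: "g \<in> complex_vector.span eigvecs" "nm (green N 0 v - g) \<le> \<epsilon> * nm v"
      using range_approx[OF v(1) ep] by blast
    have gS: "g \<in> complex_vector.span S" using g(1) complex_vector.span_mono[OF eig] by blast
    have "\<epsilon> * nm v \<le> \<epsilon> * (nm v + 1)" using ep by simp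
    also have "\<dots> = e / 2" using nv by (simp add: \<epsilon>_def field_simps)
    finally have 2: "nm (cls h - g) \<le> e / 2" using g(2) v(2) by simp
    have "nm (u - g) < e"
      using nm_triangle[OF u cls_in_sq[OF h(2)], of g] 1 2 gS span_sq by auto
    then show ?thesis using nm[of "u - g"] u gS span_sq by (intro bexI[of _ g]) auto
  qed
  then show ?thesis using S_sq unfolding complete_in_def L2_vecs_w S_def by blast
qed

section \<open>Domains in terms of boundary values\<close>

lemma H2_iff_sol: "u \<in> H2 c d \<longleftrightarrow> (\<exists>U V F. sol U V F \<and> u = cls U)"
  using H2_sol sol_H2(1) by metis

lemma value_at_sol:
  assumes "sol U V F" "x \<in> {c..d}"
  shows "value_at c d (cls U) x = U x" "value_at c d (weak_deriv c d (cls U)) x = V x / of_real (p x)"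
proof -
  have "continuous_on {c..d} (\<lambda>x. V x / of_real (p x))"
    using continuous_on_mult[OF sol_cont(2)[OF assms(1)] p_inv_cont] by simp
  then show "value_at c d (weak_deriv c d (cls U)) x = V x / of_real (p x)"
    using sol_H2(2)[OF assms(1)] value_at_cls assms(2) by simp
  show "value_at c d (cls U) x = U x" using value_at_cls[OF sol_cont(1)] assms by blast
qed

text \<open>
  The Neumann condition on the derivative at \<open>d\<close> is the condition \<open>V d = 0\<close> on the flux, because \<open>p d\<close>
  is positive.
\<close>

lemma T_True: "T True = \<lparr> op_dom = {u \<in> H2 c d. value_at c d u c = 0 \<and> value_at c d (weak_deriv c d u) d = 0},
    op_app = sturm_expr c d p w \<rparr>"
proof -
  have pd: "p d \<noteq> 0" using p_pos[of d] c_less_d by simp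
  have "{cls U | U V F. sol U V F \<and> U c = 0 \<and> V d = 0}
      = {u \<in> H2 c d. value_at c d u c = 0 \<and> value_at c d (weak_deriv c d u) d = 0}"
  proof (intro set_eqI iffI)
    fix u assume "u \<in> {cls U | U V F. sol U V F \<and> U c = 0 \<and> V d = 0}"
    then obtain U V F where "sol U V F" "U c = 0" "V d = 0" "u = cls U" by blast
    then show "u \<in> {u \<in> H2 c d. value_at c d u c = 0 \<and> value_at c d (weak_deriv c d u) d = 0}"
      using c_less_d value_at_sol[of U V F] sol_H2(1)[of U V F] by simp
  next
    fix u assume u: "u \<in> {u \<in> H2 c d. value_at c d u c = 0 \<and> value_at c d (weak_deriv c d u) d = 0}"
    then obtain U V F where s: "sol U V F" "u = cls U" using H2_iff_sol by blast
    then have "U c = 0" "V d = 0" using c_less_d value_at_sol[OF s(1)] pd u by auto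
    then show "u \<in> {cls U | U V F. sol U V F \<and> U c = 0 \<and> V d = 0}" using s by blast
  qed
  then show ?thesis by (simp add: T_def bc_def)
qed

lemma H2_right_zero:
  "{u \<in> H2 c d. value_at c d u d = 0} = {cls U | U V F. sol U V F \<and> U d = 0}"
proof (intro set_eqI iffI)
  fix u assume u: "u \<in> {u \<in> H2 c d. value_at c d u d = 0}"
  then obtain U V F where s: "sol U V F" "u = cls U" using H2_iff_sol by blast
  then have "U d = 0" using c_less_d value_at_sol[OF s(1)] u by auto
  then show "u \<in> {cls U | U V F. sol U V F \<and> U d = 0}" using s by blast
next
  fix u assume "u \<in> {cls U | U V F. sol U V F \<and> U d = 0}"
  then obtain U V F where "sol U V F" "U d = 0" "u = cls U" by blast
  then show "u \<in> {u \<in> H2 c d. value_at c d u d = 0}"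
    using c_less_d value_at_sol[of U V F] sol_H2(1)[of U V F] by simp
qed

lemma T_False: "T False = \<lparr> op_dom = {u \<in> {u \<in> H2 c d. value_at c d u d = 0}. value_at c d u c = 0},
    op_app = sturm_expr c d p w \<rparr>"
proof -
  have v: "sol U V F \<Longrightarrow> value_at c d (cls U) c = U c" for U V F using value_at_sol[of U V F c] c_less_d by simp
  have "{cls U | U V F. sol U V F \<and> U c = 0 \<and> U d = 0}
      = {u \<in> {cls U | U V F. sol U V F \<and> U d = 0}. value_at c d u c = 0}"
    by (intro set_eqI iffI; clarsimp simp: v; blast)
  then show ?thesis unfolding H2_right_zero by (simp add: T_def bc_def)
qed

lemma U2_d_nonzero: "V2 \<mu> d = 0 \<Longrightarrow> U2 \<mu> d \<noteq> 0"
  and U1_d_nonzero: "U2 \<mu> d = 0 \<Longrightarrow> U1 \<mu> d \<noteq> 0"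
  using wronskian[of \<mu>] by auto

lemma cls_scale_isol: "isol \<mu> U V F \<Longrightarrow> s *\<^sub>C cls U = cls (\<lambda>x. s * U x)"
  by (rule sq_cls_scale[OF isol_sqi])

lemma isol_left_zero:
  assumes "isol \<mu> U V (\<lambda>_. 0)" "U c = 0"
  shows "cls U = V c *\<^sub>C cls (U2 \<mu>)" "x \<in> {c..d} \<Longrightarrow> U x = V c * U2 \<mu> x" "V d = V c * V2 \<mu> d"
proof -
  show *: "x \<in> {c..d} \<Longrightarrow> U x = V c * U2 \<mu> x" for x
    using isol_homogeneous(1)[OF assms(1), of x] assms(2) by simp
  show "V d = V c * V2 \<mu> d"
    using isol_homogeneous(2)[OF assms(1), of d] assms(2) c_less_d by simp
  show "cls U = V c *\<^sub>C cls (U2 \<mu>)"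
    unfolding cls_scale_isol[OF fundamental(4)]
    by (rule cls_cong_Icc[OF isol_scale[OF fundamental(4)]]) (rule *)
qed

end

section \<open>The coupled system\<close>

locale coupled = A: sturm a 0 k r + B: sturm 0 b \<kappa> \<rho>
  for a b :: real and k r \<kappa> \<rho> :: "real \<Rightarrow> real"
begin

abbreviation \<A> :: "(aefun \<times> aefun) lin_op"
  where "\<A> \<equiv> A_mat a b k r \<kappa> \<rho>"

abbreviation \<L> :: "(aefun \<times> aefun) nspace"
  where "\<L> \<equiv> L_space a b r \<rho>"

lemma a_less_0: "a < 0" and b_greater_0: "0 < b"
  using A.c_less_d B.c_less_d by auto

lemma A1_eq: "A1 a k r = A.T True"
  by (simp add: A1_def A.T_True)

lemma A2_hat_eq: "A2_hat b \<kappa> \<rho> = B.T False"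
  by (simp add: A2_hat_def A2_def B.T_False)

lemma app_shift: "op_app (op_shift \<A> \<mu>) (u1, u2)
    = (sturm_expr a 0 k r u1 - \<mu> *\<^sub>C u1, sturm_expr 0 b \<kappa> \<rho> u2 - \<mu> *\<^sub>C u2)"
  by (simp add: op_shift_def A_mat_def A1_def A2_def scaleC_Pair)

lemma dom_shift: "op_dom (op_shift \<A> \<mu>) = op_dom \<A>"
  by (simp add: op_shift_def)

lemma dom_iff: "(u1, u2) \<in> op_dom \<A> \<longleftrightarrow>
    (\<exists>U V F X Y H. A.sol U V F \<and> B.sol X Y H \<and> u1 = A.cls U \<and> u2 = B.cls X \<and>
      U a = 0 \<and> V 0 = 0 \<and> X b = 0 \<and> X 0 = U 0)"
proof -
  have "u1 \<in> op_dom (A1 a k r) \<longleftrightarrow> (\<exists>U V F. A.sol U V F \<and> u1 = A.cls U \<and> U a = 0 \<and> V 0 = 0)"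
    unfolding A1_eq A.T_def A.bc_def by auto
  moreover have "u2 \<in> op_dom (A2 b \<kappa> \<rho>) \<longleftrightarrow> (\<exists>X Y H. B.sol X Y H \<and> u2 = B.cls X \<and> X b = 0)"
    unfolding A2_def B.H2_right_zero by auto
  ultimately show ?thesis
    using a_less_0 b_greater_0 unfolding A_mat_def
    by (auto simp: A.value_at_sol B.value_at_sol) (metis (no_types))+
qed

lemma dom_solE:
  assumes "u \<in> op_dom \<A>"
  obtains U V F X Y H where "A.sol U V F" "B.sol X Y H" "u = (A.cls U, B.cls X)"
    "U a = 0" "V 0 = 0" "X b = 0" "X 0 = U 0"
  using assms dom_iff by (cases u) metis

lemma dom_solI:
  "A.sol U V F \<Longrightarrow> B.sol X Y H \<Longrightarrow> U a = 0 \<Longrightarrow> V 0 = 0 \<Longrightarrow> X b = 0 \<Longrightarrow> X 0 = U 0 \<Longrightarrow> (A.cls U, B.cls X) \<in> op_dom \<A>"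
  unfolding dom_iff by blast

lemma domI:
  assumes "A.isol \<mu> U V f" "B.isol \<mu> X Y g" "U a = 0" "V 0 = 0" "X b = 0" "X 0 = U 0"
  shows "(A.cls U, B.cls X) \<in> op_dom \<A>"
  using assms by (intro dom_solI[OF A.isol_sol B.isol_sol])

lemma app_shift_cls:
  assumes "A.isol \<mu> U V f" "B.isol \<mu> X Y g" "A.sqi f" "B.sqi g"
  shows "op_app (op_shift \<A> \<mu>) (A.cls U, B.cls X) = (A.cls f, B.cls g)"
  using A.shift_cls[OF assms(1,3)] B.shift_cls[OF assms(2,4)] by (simp add: app_shift)

lemma domE:
  assumes u: "u \<in> op_dom \<A>" and eq: "op_app (op_shift \<A> \<mu>) u = (A.cls f, B.cls g)"
    and f: "A.sqi f" and g: "B.sqi g"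
  obtains U V X Y where "A.isol \<mu> U V f" "B.isol \<mu> X Y g" "u = (A.cls U, B.cls X)"
    "U a = 0" "V 0 = 0" "X b = 0" "X 0 = U 0"
proof -
  obtain U V F X Y H where s: "A.sol U V F" "B.sol X Y H" "u = (A.cls U, B.cls X)"
      "U a = 0" "V 0 = 0" "X b = 0" "X 0 = U 0"
    using u by (rule dom_solE)
  have "A.isol \<mu> U V f" "B.isol \<mu> X Y g"
    using eq A.shift_isol[OF s(1) f, of \<mu>] B.shift_isol[OF s(2) g, of \<mu>] s(3) by (simp_all add: app_shift)
  then show ?thesis using that s by blast
qed

lemma linear_A: "linear_op \<A>"
proof
  show "0 \<in> op_dom \<A>"
    using domI[OF A.isol_zero B.isol_zero] by (simp add: A.cls_zero B.cls_zero zero_prod_def)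
  fix s u v assume "u \<in> op_dom \<A>" "v \<in> op_dom \<A>"
  then obtain U V F X Y H U' V' F' X' Y' H' where u: "A.sol U V F" "B.sol X Y H" "u = (A.cls U, B.cls X)"
      "U a = 0" "V 0 = 0" "X b = 0" "X 0 = U 0"
    and v: "A.sol U' V' F'" "B.sol X' Y' H'" "v = (A.cls U', B.cls X')"
      "U' a = 0" "V' 0 = 0" "X' b = 0" "X' 0 = U' 0"
    using dom_solE by metis
  note lin = A.sol_lin[OF u(1) v(1), of s] B.sol_lin[OF u(2) v(2), of s]
  have eq: "s *\<^sub>C u + v = (A.cls (\<lambda>x. s * U x + U' x), B.cls (\<lambda>x. s * X x + X' x))"
    using A.sturm_lin(1)[OF u(1) v(1), of s] B.sturm_lin(1)[OF u(2) v(2), of s] u v by (simp add: scaleC_Pair)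
  have "s *\<^sub>C u + v \<in> op_dom \<A>"
    unfolding eq using u v by (intro dom_solI[OF lin]) auto
  moreover have "op_app \<A> (s *\<^sub>C u + v) = s *\<^sub>C op_app \<A> u + op_app \<A> v"
    unfolding eq unfolding u(3) v(3) using A.sturm_lin(2)[OF u(1) v(1), of s] B.sturm_lin(2)[OF u(2) v(2), of s]
    by (simp add: A_mat_def A1_def A2_def scaleC_Pair)
  ultimately show "s *\<^sub>C u + v \<in> op_dom \<A> \<and> op_app \<A> (s *\<^sub>C u + v) = s *\<^sub>C op_app \<A> u + op_app \<A> v" ..
qed

lemmas linear_shift = linear_op.shift[OF linear_A]

section \<open>Spectrum and root spaces\<close>

text \<open>
  The diagonal entries of the linear system for the two free parameters of a solution.
\<close>

abbreviation DA :: "complex \<Rightarrow> complex" where "DA \<mu> \<equiv> A.char_fun True \<mu>"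
abbreviation DB :: "complex \<Rightarrow> complex" where "DB \<mu> \<equiv> B.char_fun False \<mu>"

lemma DA_eq: "DA \<mu> = A.V2 \<mu> 0" and DB_eq: "DB \<mu> = B.U2 \<mu> b"
  by (simp_all add: A.char_fun_def A.bc_def B.char_fun_def B.bc_def)

lemma nrm_L: "nrm \<L> (u, v) = sqrt ((nrm (L2 r {a<..<0}) u)\<^sup>2 + (nrm (L2 \<rho> {0<..<b}) v)\<^sup>2)"
  by (simp add: L_space_def direct_sum_def)

lemma vecs_L: "vecs \<L> = A.sq_cls \<times> B.sq_cls"
  by (simp add: L_space_def direct_sum_def A.L2_vecs_w B.L2_vecs_w)

lemma nrm_nonneg: "u \<in> A.sq_cls \<Longrightarrow> 0 \<le> nrm (L2 r {a<..<0}) u" "v \<in> B.sq_cls \<Longrightarrow> 0 \<le> nrm (L2 \<rho> {0<..<b}) v"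
  using A.L2_nrm_w B.L2_nrm_w A.sq_clsE B.sq_clsE by (metis A.wnorm_nonneg, metis B.wnorm_nonneg)

text \<open>
  The eigenvector for a zero of \<open>DA\<close> that is not a zero of \<open>DB\<close>: the eigenfunction of \<open>A\<^sub>1\<close>, continued to
  the right with the same value at \<open>0\<close> and corrected by a multiple of \<open>B.U2\<close> to vanish at \<open>b\<close>.
\<close>

definition eA :: "complex \<Rightarrow> aefun \<times> aefun"
  where "eA \<mu> = (A.cls (A.U2 \<mu>),
    B.cls (\<lambda>x. A.U2 \<mu> 0 * B.U1 \<mu> x + (- A.U2 \<mu> 0 * B.U1 \<mu> b / DB \<mu>) * B.U2 \<mu> x))"

text \<open>
  The eigenvector for a zero of \<open>DB\<close>, whether or not \<open>DA\<close> vanishes there as well.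
\<close>

definition eB :: "complex \<Rightarrow> aefun \<times> aefun"
  where "eB \<mu> = (0, B.cls (B.U2 \<mu>))"

lemma fund_comb: "B.isol \<mu> (\<lambda>x. s * B.U1 \<mu> x + t * B.U2 \<mu> x) (\<lambda>x. s * B.V1 \<mu> x + t * B.V2 \<mu> x) (\<lambda>_. 0)"
  using B.isol_add[OF B.isol_scale[OF B.fundamental(1)[of \<mu>], of s] B.isol_scale[OF B.fundamental(4)[of \<mu>], of t]]
  by simp

lemma zero_pair: "(A.cls (\<lambda>x. 0), B.cls (\<lambda>x. 0)) = 0"
  by (simp add: A.cls_zero B.cls_zero zero_prod_def)

lemma eA_ker:
  assumes "DA \<mu> = 0" "DB \<mu> \<noteq> 0"
  shows "eA \<mu> \<in> op_dom \<A>" "op_app (op_shift \<A> \<mu>) (eA \<mu>) = 0" "eA \<mu> \<noteq> 0"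
proof -
  show "eA \<mu> \<in> op_dom \<A>"
    unfolding eA_def
    by (rule domI[OF A.fundamental(4)[of \<mu>] fund_comb]) (use assms in \<open>simp_all add: A.fundamental B.fundamental DA_eq DB_eq\<close>)
  show "op_app (op_shift \<A> \<mu>) (eA \<mu>) = 0"
    unfolding eA_def zero_pair[symmetric]
    by (rule app_shift_cls[OF A.fundamental(4)[of \<mu>] fund_comb A.sqi_zero B.sqi_zero])
  show "eA \<mu> \<noteq> 0" using A.cls_U2_nonzero by (simp add: eA_def zero_prod_def)
qed

lemma eB_ker:
  assumes "DB \<mu> = 0"
  shows "eB \<mu> \<in> op_dom \<A>" "op_app (op_shift \<A> \<mu>) (eB \<mu>) = 0" "eB \<mu> \<noteq> 0"
proof -
  have eB: "eB \<mu> = (A.cls (\<lambda>x. 0), B.cls (B.U2 \<mu>))" by (simp add: eB_def A.cls_zero)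
  show "eB \<mu> \<in> op_dom \<A>"
    unfolding eB
    by (rule domI[OF A.isol_zero B.fundamental(4)]) (use assms in \<open>simp_all add: B.fundamental DB_eq\<close>)
  show "op_app (op_shift \<A> \<mu>) (eB \<mu>) = 0"
    unfolding eB using app_shift_cls[OF A.isol_zero B.fundamental(4) A.sqi_zero B.sqi_zero] zero_pair by simp
  show "eB \<mu> \<noteq> 0" using B.cls_U2_nonzero by (simp add: eB_def zero_prod_def)
qed

text \<open>
  The kernel in terms of the two parameters \<open>s\<close>, \<open>t\<close> and of the triangular linear system that they satisfy.
\<close>

lemma kerE:
  assumes "u \<in> op_dom \<A>" "op_app (op_shift \<A> \<mu>) u = 0"
  obtains s t where "u = (s *\<^sub>C A.cls (A.U2 \<mu>), B.cls (\<lambda>x. s * A.U2 \<mu> 0 * B.U1 \<mu> x + t * B.U2 \<mu> x))"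
    "s * DA \<mu> = 0" "s * A.U2 \<mu> 0 * B.U1 \<mu> b + t * DB \<mu> = 0"
proof -
  have "op_app (op_shift \<A> \<mu>) u = (A.cls (\<lambda>x. 0), B.cls (\<lambda>x. 0))" using assms(2) zero_pair by simp
  then obtain U V X Y where s: "A.isol \<mu> U V (\<lambda>x. 0)" "B.isol \<mu> X Y (\<lambda>x. 0)" "u = (A.cls U, B.cls X)"
    "U a = 0" "V 0 = 0" "X b = 0" "X 0 = U 0"
    by (rule domE[OF assms(1) _ A.sqi_zero B.sqi_zero])
  have U0: "U 0 = V a * A.U2 \<mu> 0" using A.isol_left_zero(2)[OF s(1,4), of 0] a_less_0 by simp
  have X: "X x = V a * A.U2 \<mu> 0 * B.U1 \<mu> x + Y 0 * B.U2 \<mu> x" if "x \<in> {0..b}" for x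
    using B.isol_homogeneous(1)[OF s(2) that] s(7) U0 by simp
  have "B.cls X = B.cls (\<lambda>x. V a * A.U2 \<mu> 0 * B.U1 \<mu> x + Y 0 * B.U2 \<mu> x)"
    using X by (intro B.cls_cong_Icc[OF s(2), symmetric]) simp
  moreover have "V a * DA \<mu> = 0" using A.isol_left_zero(3)[OF s(1,4)] s(5) by (simp add: DA_eq)
  moreover have "V a * A.U2 \<mu> 0 * B.U1 \<mu> b + Y 0 * DB \<mu> = 0"
    using X[of b] s(6) b_greater_0 by (simp add: DB_eq)
  ultimately show ?thesis using that s(3) A.isol_left_zero(1)[OF s(1,4)] by blast
qed

lemma ker_eA:
  assumes D: "DB \<mu> \<noteq> 0" and u: "u \<in> op_dom \<A>" "op_app (op_shift \<A> \<mu>) u = 0"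
  shows "u \<in> complex_vector.span {eA \<mu>}"
proof -
  obtain s t where st: "u = (s *\<^sub>C A.cls (A.U2 \<mu>), B.cls (\<lambda>x. s * A.U2 \<mu> 0 * B.U1 \<mu> x + t * B.U2 \<mu> x))"
    "s * DA \<mu> = 0" "s * A.U2 \<mu> 0 * B.U1 \<mu> b + t * DB \<mu> = 0" using kerE[OF u] .
  have t: "t = s * (- A.U2 \<mu> 0 * B.U1 \<mu> b / DB \<mu>)"
  proof -
    have "t * DB \<mu> = - (s * A.U2 \<mu> 0 * B.U1 \<mu> b)"
      by (subst eq_neg_iff_add_eq_0, subst add.commute) (rule st(3))
    then have "t = - (s * A.U2 \<mu> 0 * B.U1 \<mu> b) / DB \<mu>" by (rule nonzero_eq_divide_eq[OF D, THEN iffD2])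
    then show ?thesis by (simp add: mult.assoc)
  qed
  have "u = s *\<^sub>C eA \<mu>"
    unfolding eA_def scaleC_Pair B.cls_scale_isol[OF fund_comb] st(1) t
    by (simp add: algebra_simps)
  then show ?thesis by (auto simp: complex_vector.span_singleton)
qed

text \<open>
  If the first component were nonzero, then \<open>DA \<mu> = 0\<close>, and \<open>A.U2 \<mu> 0\<close> and \<open>B.U1 \<mu> b\<close> would not
  vanish by the Wronskian identities, which contradicts the second equation for \<open>s\<close>, \<open>t\<close>.
\<close>

lemma ker_eB:
  assumes D: "DB \<mu> = 0" and u: "u \<in> op_dom \<A>" "op_app (op_shift \<A> \<mu>) u = 0"
  shows "u \<in> complex_vector.span {eB \<mu>}"
proof -
  obtain s t where st: "u = (s *\<^sub>C A.cls (A.U2 \<mu>), B.cls (\<lambda>x. s * A.U2 \<mu> 0 * B.U1 \<mu> x + t * B.U2 \<mu> x))"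
    "s * DA \<mu> = 0" "s * A.U2 \<mu> 0 * B.U1 \<mu> b + t * DB \<mu> = 0" using kerE[OF u] .
  have "s = 0"
  proof (rule ccontr)
    assume "s \<noteq> 0"
    then have "A.U2 \<mu> 0 \<noteq> 0" using st(2) A.U2_d_nonzero by (simp add: DA_eq)
    moreover have "B.U1 \<mu> b \<noteq> 0" using D B.U1_d_nonzero by (simp add: DB_eq)
    ultimately show False using st(3) D \<open>s \<noteq> 0\<close> by simp
  qed
  then have "u = t *\<^sub>C eB \<mu>"
    using st(1) by (simp add: eB_def scaleC_Pair B.cls_scale_isol[OF B.fundamental(4)])
  then show ?thesis by (auto simp: complex_vector.span_singleton)
qed

text \<open>
  The first component alone is responsible: dividing by \<open>s\<close>, it would be a solution for the
  right-hand side \<open>A.U2 \<mu>\<close> that satisfies both boundary conditions, against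
  \<open>no_adjoined_function\<close>.  The arbitrary second component makes the lemma apply both to the eigenvector
  \<open>eA\<close> and to adjoined vectors.
\<close>

lemma eA_not_in_range:
  assumes D: "DA \<mu> = 0" and s: "s \<noteq> 0" and g: "B.sqi g" and z: "z \<in> op_dom \<A>"
  shows "op_app (op_shift \<A> \<mu>) z \<noteq> (s *\<^sub>C A.cls (A.U2 \<mu>), B.cls g)"
proof
  assume "op_app (op_shift \<A> \<mu>) z = (s *\<^sub>C A.cls (A.U2 \<mu>), B.cls g)"
  then have eq: "op_app (op_shift \<A> \<mu>) z = (A.cls (\<lambda>x. s * A.U2 \<mu> x), B.cls g)"
    by (simp add: A.cls_scale_isol[OF A.fundamental(4)])
  have q: "A.sqi (A.U2 \<mu>)" using A.isol_sqi[OF A.fundamental(4)] .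
  obtain U V X Y where *: "A.isol \<mu> U V (\<lambda>x. s * A.U2 \<mu> x)" "U a = 0" "V 0 = 0"
    using domE[OF z eq A.sqi_scale[OF q] g] by metis
  have "A.isol \<mu> (\<lambda>x. (1 / s) * U x) (\<lambda>x. (1 / s) * V x) (\<lambda>x. (1 / s) * (s * A.U2 \<mu> x))"
    by (rule A.isol_scale[OF *(1)])
  then have "A.isol \<mu> (\<lambda>x. (1 / s) * U x) (\<lambda>x. (1 / s) * V x) (A.U2 \<mu>)" using s by simp
  from A.bc_decomp[OF this q, of True] * D A.no_adjoined_function[OF D]
  show False by (simp add: A.bc_def)
qed

text \<open>
  Since \<open>DA \<mu> \<noteq> 0\<close>, the first component of a preimage vanishes; the second one then vanishes at both
  ends, against \<open>no_adjoined_function\<close> on the right interval.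
\<close>

lemma eB_not_in_range:
  assumes D: "DB \<mu> = 0" "DA \<mu> \<noteq> 0" and z: "z \<in> op_dom \<A>"
  shows "op_app (op_shift \<A> \<mu>) z \<noteq> eB \<mu>"
proof
  assume "op_app (op_shift \<A> \<mu>) z = eB \<mu>"
  then have eq: "op_app (op_shift \<A> \<mu>) z = (A.cls (\<lambda>x. 0), B.cls (B.U2 \<mu>))" by (simp add: eB_def A.cls_zero)
  have q: "B.sqi (B.U2 \<mu>)" using B.isol_sqi[OF B.fundamental(4)] .
  obtain U V X Y where *: "A.isol \<mu> U V (\<lambda>x. 0)" "B.isol \<mu> X Y (B.U2 \<mu>)" "U a = 0" "V 0 = 0" "X b = 0" "X 0 = U 0"
    using domE[OF z eq A.sqi_zero q] by metis
  have "V a = 0" using A.isol_left_zero(3)[OF *(1,3)] *(4) D by (simp add: DA_eq)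
  then have "U 0 = 0" using A.isol_left_zero(2)[OF *(1,3), of 0] a_less_0 by simp
  with B.bc_decomp[OF *(2) q, of False] * D B.no_adjoined_function[OF D(1)]
  show False by (simp add: B.bc_def)
qed

text \<open>
  The particular solution for the right-hand side \<open>B.U2 \<mu>\<close> does not vanish at \<open>b\<close>, by
  \<open>no_adjoined_function\<close>.  It is corrected by \<open>\<alpha> B.U1\<close>, with \<open>\<alpha> \<noteq> 0\<close> for the same reason, at the price
  of the value \<open>\<alpha>\<close> at \<open>0\<close>; the first component is the multiple of \<open>A.U2\<close> that has this value at \<open>0\<close>.
\<close>

lemma adjoined_exists:
  assumes D: "DA \<mu> = 0" "DB \<mu> = 0"
  obtains s g where "s \<noteq> 0" "B.sqi g" "(s *\<^sub>C A.cls (A.U2 \<mu>), B.cls g) \<in> op_dom \<A>"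
    "op_app (op_shift \<A> \<mu>) (s *\<^sub>C A.cls (A.U2 \<mu>), B.cls g) = eB \<mu>"
proof -
  have q: "B.sqi (B.U2 \<mu>)" using B.isol_sqi[OF B.fundamental(4)] .
  have A0: "A.U2 \<mu> 0 \<noteq> 0" using D A.U2_d_nonzero by (simp add: DA_eq)
  have B0: "B.U1 \<mu> b \<noteq> 0" using D B.U1_d_nonzero by (simp add: DB_eq)
  have P0: "B.UP \<mu> (B.U2 \<mu>) b \<noteq> 0" using B.no_adjoined_function[OF D(2)] by (simp add: B.bc_def)
  define \<alpha> where "\<alpha> = - B.UP \<mu> (B.U2 \<mu>) b / B.U1 \<mu> b"
  have \<alpha>: "\<alpha> \<noteq> 0" using P0 B0 by (simp add: \<alpha>_def)
  define s where "s = \<alpha> / A.U2 \<mu> 0"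
  define g where "g = (\<lambda>x. B.UP \<mu> (B.U2 \<mu>) x + (\<alpha> * B.U1 \<mu> x + 0 * B.U2 \<mu> x))"
  note g = B.general_isol[OF q, of \<mu> \<alpha> 0, folded g_def]
  note U = A.isol_scale[OF A.fundamental(4)[of \<mu>], of s]
  have c: "s *\<^sub>C A.cls (A.U2 \<mu>) = A.cls (\<lambda>x. s * A.U2 \<mu> x)" by (rule A.cls_scale_isol[OF A.fundamental(4)])
  show ?thesis
  proof (rule that[of s g])
    show "s \<noteq> 0" using \<alpha> A0 by (simp add: s_def)
    show "B.sqi g" using B.isol_sqi[OF g] .
    show "(s *\<^sub>C A.cls (A.U2 \<mu>), B.cls g) \<in> op_dom \<A>"
      unfolding c using D A0 B0
      by (intro domI[OF U g]) (simp_all add: A.fundamental B.fundamental DA_eq s_def g_def \<alpha>_def B.particular[OF q])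
    show "op_app (op_shift \<A> \<mu>) (s *\<^sub>C A.cls (A.U2 \<mu>), B.cls g) = eB \<mu>"
      unfolding c using app_shift_cls[OF U g _ q] A.sqi_zero by (simp add: eB_def A.cls_zero)
  qed
qed

lemma shift_sq:
  assumes "u \<in> op_dom \<A>" shows "op_app (op_shift \<A> \<mu>) u \<in> A.sq_cls \<times> B.sq_cls"
proof -
  obtain U V F X Y H where s: "A.sol U V F" "B.sol X Y H" "u = (A.cls U, B.cls X)" using assms by (rule dom_solE)
  have "A.sqi U" "B.sqi X" using A.sqi_continuous[OF A.sol_cont(1)[OF s(1)]] B.sqi_continuous[OF B.sol_cont(1)[OF s(2)]] by auto
  then show ?thesis
    unfolding s(3) app_shift A.sol_H2(3)[OF s(1)] B.sol_H2(3)[OF s(2)] using A.solD(3)[OF s(1)] B.solD(3)[OF s(2)]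
    by (simp add: A.sq_cls_scale A.sq_cls_diff A.sqi_scale A.sqi_diff A.cls_in_sq
        B.sq_cls_scale B.sq_cls_diff B.sqi_scale B.sqi_diff B.cls_in_sq)
qed

text \<open>
  The first component solves its own boundary value problem.  In the second one, \<open>\<psi>\<close> is the
  homogeneous solution with \<open>\<psi> 0 = 1\<close> and \<open>\<psi> b = 0\<close>; its multiple by \<open>U f 0\<close> restores the coupling after
  the boundary value problem with zero boundary values has been solved.
\<close>

lemma resolvent:
  assumes D: "DA \<mu> \<noteq> 0" "DB \<mu> \<noteq> 0" shows "\<mu> \<in> resolvent_set \<L> \<A>"
proof -
  define U where "U f = fst (A.bvp True \<mu> (rep_aefun f))" for f
  define X where "X g = fst (B.bvp False \<mu> (rep_aefun g))" for g
  define \<psi> where "\<psi> = (\<lambda>x. 1 * B.U1 \<mu> x + (- B.U1 \<mu> b / DB \<mu>) * B.U2 \<mu> x)"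
  define S where "S = (\<lambda>(f, g). (A.cls (U f), B.cls (\<lambda>x. U f 0 * \<psi> x + X g x)))"
  note \<psi> = fund_comb[of \<mu> 1 "- B.U1 \<mu> b / DB \<mu>", folded \<psi>_def]
  have \<psi>0: "\<psi> 0 = 1" and \<psi>b: "\<psi> b = 0" using D by (simp_all add: \<psi>_def B.fundamental DB_eq)
  obtain C1 where C1: "\<And>f x. A.sqi f \<Longrightarrow> x \<in> {a..0} \<Longrightarrow> cmod (fst (A.bvp True \<mu> f) x) \<le> C1 * A.wnorm f"
    using A.bvp_bound[OF D(1)] by blast
  obtain C2 where C2: "\<And>f x. B.sqi f \<Longrightarrow> x \<in> {0..b} \<Longrightarrow> cmod (fst (B.bvp False \<mu> f) x) \<le> C2 * B.wnorm f"
    using B.bvp_bound[OF D(2)] by blast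
  obtain K where K: "0 < K" "\<And>x. x \<in> {0..b} \<Longrightarrow> cmod (\<psi> x) \<le> K"
    using B.continuous_bounded[OF B.isol_cont(1)[OF \<psi>]] by metis
  define C where "C = sqrt A.wtotal * \<bar>C1\<bar> + sqrt B.wtotal * (\<bar>C1\<bar> * K + \<bar>C2\<bar>)"
  show ?thesis
  proof (rule linear_op.resolvent_setI[OF linear_A, where S = S and C = C])
    fix h assume "h \<in> vecs \<L>"
    then obtain f g where h: "h = (f, g)" "f \<in> A.sq_cls" "g \<in> B.sq_cls" by (auto simp: vecs_L)
    note qf = A.sq_cls_rep[OF h(2)] and qg = B.sq_cls_rep[OF h(3)]
    note Ui = A.bvp[OF qf(1) D(1), folded U_def] and Xi = B.bvp[OF qg(1) D(2), folded X_def]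
    note Yi = B.isol_lin[OF \<psi> Xi(1), of "U f 0", simplified]
    show "S h \<in> op_dom \<A> \<and> op_app (op_shift \<A> \<mu>) (S h) = h"
      using domI[OF Ui(1) Yi] Ui Xi app_shift_cls[OF Ui(1) Yi qf(1) qg(1)] qf(2) qg(2) \<psi>0 \<psi>b
      by (simp add: S_def h(1) A.bc_def B.bc_def)
    have R: "A.wnorm (rep_aefun f) \<le> nrm \<L> h" "B.wnorm (rep_aefun g) \<le> nrm \<L> h"
      unfolding h(1) nrm_L A.L2_nrm_w[OF qf(1), unfolded qf(2)] B.L2_nrm_w[OF qg(1), unfolded qg(2)]
      by (rule real_le_rsqrt; simp)+
    then have R0: "0 \<le> nrm \<L> h" using A.wnorm_nonneg order_trans by blast
    have Ub: "cmod (U f x) \<le> \<bar>C1\<bar> * nrm \<L> h" if "x \<in> {a..0}" for x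
    proof -
      have "C1 * A.wnorm (rep_aefun f) \<le> \<bar>C1\<bar> * nrm \<L> h" using R by (intro mult_mono) auto
      then show ?thesis using C1[OF qf(1) that] by (simp add: U_def)
    qed
    have Xb: "cmod (U f 0 * \<psi> x + X g x) \<le> \<bar>C1\<bar> * nrm \<L> h * K + \<bar>C2\<bar> * nrm \<L> h" if x: "x \<in> {0..b}" for x
    proof (rule norm_triangle_mono)
      show "cmod (U f 0 * \<psi> x) \<le> \<bar>C1\<bar> * nrm \<L> h * K"
        unfolding norm_mult using Ub[of 0] a_less_0 K(2)[OF x] R0 by (intro mult_mono) auto
      have "C2 * B.wnorm (rep_aefun g) \<le> \<bar>C2\<bar> * nrm \<L> h" using R by (intro mult_mono) auto
      then show "cmod (X g x) \<le> \<bar>C2\<bar> * nrm \<L> h" using C2[OF qg(1) x] by (simp add: X_def)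
    qed
    note sU = A.isol_sqi[OF Ui(1)] and sY = B.isol_sqi[OF Yi]
    have "nrm \<L> (S h) \<le> A.wnorm (U f) + B.wnorm (\<lambda>x. U f 0 * \<psi> x + X g x)"
      unfolding S_def h(1) prod.case nrm_L A.L2_nrm_w[OF sU] B.L2_nrm_w[OF sY]
      by (rule sqrt_sum_squares_le_sum) auto
    also have "\<dots> \<le> sqrt A.wtotal * (\<bar>C1\<bar> * nrm \<L> h) + sqrt B.wtotal * (\<bar>C1\<bar> * nrm \<L> h * K + \<bar>C2\<bar> * nrm \<L> h)"
      using Ub Xb R0 K(1) by (intro add_mono A.wnorm_sup[OF sU] B.wnorm_sup[OF sY]) auto
    also have "\<dots> = C * nrm \<L> h" by (simp add: C_def algebra_simps)
    finally show "nrm \<L> (S h) \<le> C * nrm \<L> h" .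
  next
    fix u assume u: "u \<in> op_dom \<A>"
    then show "op_app (op_shift \<A> \<mu>) u \<in> vecs \<L>" using shift_sq by (simp add: vecs_L)
    assume "op_app (op_shift \<A> \<mu>) u = 0"
    from kerE[OF u this] obtain s t where st:
      "u = (s *\<^sub>C A.cls (A.U2 \<mu>), B.cls (\<lambda>x. s * A.U2 \<mu> 0 * B.U1 \<mu> x + t * B.U2 \<mu> x))"
      "s * DA \<mu> = 0" "s * A.U2 \<mu> 0 * B.U1 \<mu> b + t * DB \<mu> = 0" .
    then have "s = 0" "t = 0" using D by auto
    with st(1) show "u = 0" by (simp add: B.cls_zero zero_prod_def)
  qed
qed

theorem spectrum_A: "spectrum \<L> \<A> = {\<mu>. DA \<mu> = 0 \<or> DB \<mu> = 0}"
proof (intro set_eqI iffI)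
  fix \<mu> assume "\<mu> \<in> spectrum \<L> \<A>"
  then show "\<mu> \<in> {\<mu>. DA \<mu> = 0 \<or> DB \<mu> = 0}" using resolvent by (auto simp: spectrum_def)
next
  fix \<mu> assume "\<mu> \<in> {\<mu>. DA \<mu> = 0 \<or> DB \<mu> = 0}"
  then show "\<mu> \<in> spectrum \<L> \<A>"
    using linear_op.spectrumI[OF linear_A eA_ker(1,3,2)] linear_op.spectrumI[OF linear_A eB_ker(1,3,2)] by blast
qed

lemma is_eigenvector_iff: "is_eigenvector \<A> \<mu> u \<longleftrightarrow> u \<noteq> 0 \<and> u \<in> op_dom \<A> \<and> op_app (op_shift \<A> \<mu>) u = 0"
  by (auto simp: is_eigenvector_def op_shift_def)

lemma simple_eigenvalue_rule:
  assumes e: "e \<noteq> 0" "e \<in> op_dom \<A>" "op_app (op_shift \<A> \<mu>) e = 0"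
    and ker: "\<And>u. u \<in> op_dom \<A> \<Longrightarrow> op_app (op_shift \<A> \<mu>) u = 0 \<Longrightarrow> u \<in> complex_vector.span {e}"
    and range: "\<And>z. z \<in> op_dom \<A> \<Longrightarrow> op_app (op_shift \<A> \<mu>) z \<noteq> e"
  shows "is_simple_eigenvalue \<A> \<mu>"
proof -
  have "root_space \<A> \<mu> = complex_vector.span {e}"
    unfolding root_space_def
    using e ker range by (intro linear_op.root_space_simple[OF linear_shift]) (auto simp: dom_shift)
  then show ?thesis
    using dim_single[OF e(1)] e
    unfolding is_simple_eigenvalue_def is_eigenvalue_def multiplicity_of_def is_eigenvector_iff by metis
qed

theorem simple_eigenvalue_A:
  assumes "DA \<mu> = 0 \<or> DB \<mu> = 0" "\<not> (DA \<mu> = 0 \<and> DB \<mu> = 0)"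
  shows "is_simple_eigenvalue \<A> \<mu>"
proof (cases "DB \<mu> = 0")
  case True
  then have "DA \<mu> \<noteq> 0" using assms by simp
  then show ?thesis
    using True eB_ker[OF True] ker_eB eB_not_in_range by (intro simple_eigenvalue_rule[of "eB \<mu>"]) auto
next
  case False
  then have D: "DA \<mu> = 0" using assms by simp
  have "op_app (op_shift \<A> \<mu>) z \<noteq> eA \<mu>" if "z \<in> op_dom \<A>" for z
    unfolding eA_def by (rule eA_not_in_range[OF D one_neq_zero B.isol_sqi[OF fund_comb] that, unfolded scaleC_one])
  then show ?thesis
    using False D eA_ker[OF D False] ker_eA by (intro simple_eigenvalue_rule[of "eA \<mu>"]) auto
qed

theorem double_eigenvalue_A:
  assumes D: "DA \<mu> = 0" "DB \<mu> = 0"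
  shows "is_eigenvalue \<A> \<mu> \<and> multiplicity_of \<A> \<mu> = 2 \<and>
      (\<exists>u w. is_eigenvector \<A> \<mu> u \<and> is_adjoined_to \<A> \<mu> u w \<and> root_space \<A> \<mu> = complex_vector.span {u, w})"
proof -
  obtain s g where g: "s \<noteq> 0" "B.sqi g" "(s *\<^sub>C A.cls (A.U2 \<mu>), B.cls g) \<in> op_dom \<A>"
    "op_app (op_shift \<A> \<mu>) (s *\<^sub>C A.cls (A.U2 \<mu>), B.cls g) = eB \<mu>"
    by (rule adjoined_exists[OF D])
  define w where "w = (s *\<^sub>C A.cls (A.U2 \<mu>), B.cls g)"
  note e = eB_ker[OF D(2)]
  have eig: "is_eigenvector \<A> \<mu> (eB \<mu>)" using e by (simp add: is_eigenvector_iff)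
  have rs: "root_space \<A> \<mu> = complex_vector.span {eB \<mu>, w}"
    unfolding root_space_def
    using e g eA_not_in_range[OF D(1) g(1,2)] ker_eB[OF D(2)]
    by (intro linear_op.root_space_double[OF linear_shift]) (auto simp: dom_shift w_def)
  have "multiplicity_of \<A> \<mu> = 2"
    unfolding multiplicity_of_def rs
    using e g by (intro linear_op.dim_double[OF linear_shift]) (auto simp: dom_shift w_def)
  moreover have "is_adjoined_to \<A> \<mu> (eB \<mu>) w" using eig g by (simp add: is_adjoined_to_def w_def)
  ultimately show ?thesis using eig rs unfolding is_eigenvalue_def by blast
qed

section \<open>Completeness of the root vectors\<close>

definition root_vectors :: "(aefun \<times> aefun) set"
  where "root_vectors = {u. \<exists>\<mu>. is_eigenvector \<A> \<mu> u} \<union> {w. \<exists>\<mu> u. is_adjoined_to \<A> \<mu> u w}"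

lemma dom_sq: "op_dom \<A> \<subseteq> A.sq_cls \<times> B.sq_cls"
proof
  fix u assume "u \<in> op_dom \<A>"
  then obtain U V F X Y H where s: "A.sol U V F" "B.sol X Y H" "u = (A.cls U, B.cls X)" by (rule dom_solE)
  then show "u \<in> A.sq_cls \<times> B.sq_cls"
    using A.cls_in_sq[OF A.sqi_continuous[OF A.sol_cont(1)[OF s(1)]]]
      B.cls_in_sq[OF B.sqi_continuous[OF B.sol_cont(1)[OF s(2)]]] by simp
qed

lemma root_vectors_sq: "root_vectors \<subseteq> A.sq_cls \<times> B.sq_cls"
  using dom_sq by (auto simp: root_vectors_def is_eigenvector_def is_adjoined_to_def)

lemma right_eigenvector:
  assumes "is_eigenvector (B.T False) \<mu> v" shows "(0, v) \<in> root_vectors"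
proof -
  have v: "v \<noteq> 0" "v \<in> op_dom (B.T False)" "op_app (op_shift (B.T False) \<mu>) v = B.cls (\<lambda>x. 0)"
    using assms by (auto simp: is_eigenvector_def op_shift_def B.cls_zero)
  obtain X Y where s: "B.isol \<mu> X Y (\<lambda>x. 0)" "v = B.cls X" "X 0 = 0" "B.bc False X Y = 0"
    by (rule B.T_domE_eq[OF v(2,3) B.sqi_zero])
  have "(A.cls (\<lambda>x. 0), B.cls X) \<in> op_dom \<A>"
    using s by (intro domI[OF A.isol_zero s(1)]) (auto simp: B.bc_def)
  moreover have "op_app (op_shift \<A> \<mu>) (A.cls (\<lambda>x. 0), B.cls X) = 0"
    using app_shift_cls[OF A.isol_zero s(1) A.sqi_zero B.sqi_zero] zero_pair by simp
  ultimately have "is_eigenvector \<A> \<mu> (0, v)"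
    using v s by (simp add: is_eigenvector_iff A.cls_zero zero_prod_def)
  then show ?thesis by (auto simp: root_vectors_def)
qed

text \<open>
  The first component of a root vector for \<open>\<mu>\<close> is a nonzero multiple of \<open>v\<close>: of the eigenvector \<open>eA\<close> if
  \<open>DB \<mu> \<noteq> 0\<close>, and of the adjoined vector otherwise.
\<close>

lemma left_eigenvector:
  assumes "is_eigenvector (A.T True) \<mu> v" shows "\<exists>z. (v, z) \<in> complex_vector.span root_vectors"
proof -
  have v: "v \<noteq> 0" "v \<in> op_dom (A.T True)" "op_app (op_shift (A.T True) \<mu>) v = A.cls (\<lambda>x. 0)"
    using assms by (auto simp: is_eigenvector_def op_shift_def A.cls_zero)
  obtain U V where s: "A.isol \<mu> U V (\<lambda>x. 0)" "v = A.cls U" "U a = 0" "A.bc True U V = 0"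
    by (rule A.T_domE_eq[OF v(2,3) A.sqi_zero])
  note U = A.isol_left_zero[OF s(1,3)]
  have Va: "V a \<noteq> 0" using v(1) U(1) s(2) by auto
  have D: "DA \<mu> = 0" using U(3) s(4) Va by (simp add: A.bc_def DA_eq)
  have "\<exists>t z. t \<noteq> 0 \<and> (t *\<^sub>C A.cls (A.U2 \<mu>), z) \<in> root_vectors"
  proof (cases "DB \<mu> = 0")
    case True
    obtain t g where g: "t \<noteq> 0" "B.sqi g" "(t *\<^sub>C A.cls (A.U2 \<mu>), B.cls g) \<in> op_dom \<A>"
      "op_app (op_shift \<A> \<mu>) (t *\<^sub>C A.cls (A.U2 \<mu>), B.cls g) = eB \<mu>"
      by (rule adjoined_exists[OF D True])
    have "is_eigenvector \<A> \<mu> (eB \<mu>)" using eB_ker[OF True] by (simp add: is_eigenvector_iff)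
    then have "is_adjoined_to \<A> \<mu> (eB \<mu>) (t *\<^sub>C A.cls (A.U2 \<mu>), B.cls g)"
      using g by (simp add: is_adjoined_to_def)
    then show ?thesis using g(1) unfolding root_vectors_def by blast
  next
    case False
    then have "is_eigenvector \<A> \<mu> (eA \<mu>)" using eA_ker[OF D False] by (simp add: is_eigenvector_iff)
    then have "eA \<mu> \<in> root_vectors" unfolding root_vectors_def by blast
    then have "(1 *\<^sub>C A.cls (A.U2 \<mu>), snd (eA \<mu>)) \<in> root_vectors" by (simp add: eA_def scaleC_one)
    then show ?thesis by (intro exI[of _ 1] exI[of _ "snd (eA \<mu>)"]) simp
  qed
  then obtain t z where t: "t \<noteq> 0" "(t *\<^sub>C A.cls (A.U2 \<mu>), z) \<in> root_vectors" by blast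
  have "(V a / t) *\<^sub>C (t *\<^sub>C A.cls (A.U2 \<mu>), z) = (v, (V a / t) *\<^sub>C z)"
    using t(1) U(1) s(2) by (simp add: scaleC_Pair)
  then show ?thesis
    using complex_vector.span_scale[OF complex_vector.span_base[OF t(2)], of "V a / t"] by auto
qed

text \<open>
  Approximate the first component by an element \<open>g1\<close> of the span of eigenfunctions of \<open>A\<^sub>1\<close>, lift
  \<open>g1\<close> to an element \<open>(g1, z)\<close> of the span of root vectors, and approximate the error \<open>f2 - z\<close>
  in the second component by eigenfunctions of the right problem.
\<close>

theorem root_vectors_complete: "complete_in \<L> root_vectors"
proof -
  let ?EA = "{u. \<exists>\<mu>. is_eigenvector (A.T True) \<mu> u}" and ?EB = "{u. \<exists>\<mu>. is_eigenvector (B.T False) \<mu> u}"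
  let ?S = "complex_vector.span root_vectors"
  have left: "\<exists>z. (g, z) \<in> ?S" if "g \<in> complex_vector.span ?EA" for g
    using that
  proof (induction rule: complex_vector.span_induct_alt)
    case base
    have "(0, 0) \<in> ?S" using complex_vector.span_zero[of root_vectors] by (simp add: zero_prod_def)
    then show ?case by blast
  next
    case (step t x y)
    then obtain z z' where z: "(x, z) \<in> ?S" "(y, z') \<in> ?S" using left_eigenvector by blast
    have "(t *\<^sub>C x + y, t *\<^sub>C z + z') \<in> ?S"
      using complex_vector.span_add[OF complex_vector.span_scale[OF z(1), of t] z(2)] by (simp add: scaleC_Pair)
    then show ?case by blast
  qed
  have right: "(0, g) \<in> ?S" if "g \<in> complex_vector.span ?EB" for g
    using that
  proof (induction rule: complex_vector.span_induct_alt)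
    case base
    show ?case using complex_vector.span_zero[of root_vectors] by (simp add: zero_prod_def)
  next
    case (step t x y)
    then have "(0, x) \<in> ?S" using right_eigenvector complex_vector.span_base by blast
    from complex_vector.span_add[OF complex_vector.span_scale[OF this, of t] step(2)]
    show ?case by (simp add: scaleC_Pair)
  qed
  have sub: "complex_vector.subspace (A.sq_cls \<times> B.sq_cls)"
    using pre_hilbert.subspace_X[OF A.pre_hilbert_ipw] pre_hilbert.subspace_X[OF B.pre_hilbert_ipw]
    by (auto simp: complex_vector.subspace_def scaleC_Pair zero_prod_def)
  have span_sq: "?S \<subseteq> A.sq_cls \<times> B.sq_cls" by (rule complex_vector.span_minimal[OF root_vectors_sq sub])
  have "\<exists>h\<in>?S. nrm \<L> (f - h) < e" if f: "f \<in> A.sq_cls \<times> B.sq_cls" and e: "0 < e" for f e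
  proof -
    obtain f1 f2 where f12: "f = (f1, f2)" "f1 \<in> A.sq_cls" "f2 \<in> B.sq_cls" using f by auto
    obtain g1 where g1: "g1 \<in> complex_vector.span ?EA" "nrm (L2 r {a<..<0}) (f1 - g1) < e / 2"
      using A.eigenvectors_complete[of True] f12 e unfolding complete_in_def A.L2_vecs_w by (meson half_gt_zero)
    obtain z where z: "(g1, z) \<in> ?S" using left[OF g1(1)] by blast
    have sq: "g1 \<in> A.sq_cls" "z \<in> B.sq_cls" using span_sq z by auto
    have fz: "f2 - z \<in> B.sq_cls"
      using f12 sq pre_hilbert.subspace_X[OF B.pre_hilbert_ipw] by (simp add: complex_vector.subspace_diff)
    obtain g2 where g2: "g2 \<in> complex_vector.span ?EB" "nrm (L2 \<rho> {0<..<b}) (f2 - z - g2) < e / 2"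
      using B.eigenvectors_complete[of False] fz e unfolding complete_in_def B.L2_vecs_w by (meson half_gt_zero)
    have h: "(g1, z) + (0, g2) \<in> ?S" by (rule complex_vector.span_add[OF z right[OF g2(1)]])
    have g2sq: "g2 \<in> B.sq_cls" using right[OF g2(1)] span_sq by auto
    have d: "f1 - g1 \<in> A.sq_cls" "f2 - z - g2 \<in> B.sq_cls"
      using f12 sq fz g2sq pre_hilbert.subspace_X[OF B.pre_hilbert_ipw] pre_hilbert.subspace_X[OF A.pre_hilbert_ipw]
      by (auto intro: complex_vector.subspace_diff)
    have "f - ((g1, z) + (0, g2)) = (f1 - g1, f2 - z - g2)" by (simp add: f12)
    then have "nrm \<L> (f - ((g1, z) + (0, g2))) \<le> nrm (L2 r {a<..<0}) (f1 - g1) + nrm (L2 \<rho> {0<..<b}) (f2 - z - g2)"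
      using sqrt_sum_squares_le_sum nrm_nonneg d by (simp add: nrm_L)
    also have "\<dots> < e" using g1 g2 by simp
    finally show ?thesis using h by blast
  qed
  then show ?thesis using root_vectors_sq unfolding complete_in_def vecs_L by blast
qed

end

theorem theorem1:
  fixes a b :: real and k r \<kappa> \<rho> :: "real \<Rightarrow> real"
  assumes "a < 0" and "0 < b"
    and "smooth_on_Icc a 0 k" and "\<forall>x\<in>{a..0}. k x > 0"
    and "smooth_on_Icc a 0 r" and "\<forall>x\<in>{a..0}. r x > 0"
    and "smooth_on_Icc 0 b \<kappa>" and "\<forall>x\<in>{0..b}. \<kappa> x > 0"
    and "smooth_on_Icc 0 b \<rho>" and "\<forall>x\<in>{0..b}. \<rho> x > 0"
  shows "spectrum (L_space a b r \<rho>) (A_mat a b k r \<kappa> \<rho>) =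
      spectrum (L2 r {a<..<0}) (A1 a k r) \<union> spectrum (L2 \<rho> {0<..<b}) (A2_hat b \<kappa> \<rho>) \<and>
    (\<forall>\<mu>\<in>spectrum (L_space a b r \<rho>) (A_mat a b k r \<kappa> \<rho>) -
        (spectrum (L2 r {a<..<0}) (A1 a k r) \<inter> spectrum (L2 \<rho> {0<..<b}) (A2_hat b \<kappa> \<rho>)).
      is_simple_eigenvalue (A_mat a b k r \<kappa> \<rho>) \<mu>) \<and>
    (\<forall>\<mu>\<in>spectrum (L2 r {a<..<0}) (A1 a k r) \<inter> spectrum (L2 \<rho> {0<..<b}) (A2_hat b \<kappa> \<rho>).
      is_eigenvalue (A_mat a b k r \<kappa> \<rho>) \<mu> \<and>
      multiplicity_of (A_mat a b k r \<kappa> \<rho>) \<mu> = 2 \<and>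
      (\<exists>u w. is_eigenvector (A_mat a b k r \<kappa> \<rho>) \<mu> u \<and>
             is_adjoined_to (A_mat a b k r \<kappa> \<rho>) \<mu> u w \<and>
             root_space (A_mat a b k r \<kappa> \<rho>) \<mu> = complex_vector.span {u, w})) \<and>
    complete_in (L_space a b r \<rho>)
      ({u. \<exists>\<mu>. is_eigenvector (A_mat a b k r \<kappa> \<rho>) \<mu> u} \<union>
       {w. \<exists>\<mu> u. is_adjoined_to (A_mat a b k r \<kappa> \<rho>) \<mu> u w})"
proof -
  interpret coupled a b k r \<kappa> \<rho>
    by unfold_locales (use assms in auto)
  have specs: "spectrum (L2 r {a<..<0}) (A1 a k r) = {\<mu>. DA \<mu> = 0}"
    "spectrum (L2 \<rho> {0<..<b}) (A2_hat b \<kappa> \<rho>) = {\<mu>. DB \<mu> = 0}"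
    by (simp_all add: A1_eq A2_hat_eq A.spectrum_T B.spectrum_T)
  show ?thesis
    unfolding specs spectrum_A
    using simple_eigenvalue_A double_eigenvalue_A root_vectors_complete[unfolded root_vectors_def] by blast
qed

end
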